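(* For every even integer $n\ge 8$, $R(W_n,W_n) \le 6n-10$.
   Context: For graphs $G_1,G_2$, the Ramsey number $R(G_1,G_2)$ is the smallest positive integer $N$ such that every red-blue edge-coloring of $K_N$ contains a red copy of $G_1$ or a blue copy of $G_2$. The wheel $W_n$ is the graph on $n$ vertices obtained by adding a new vertex adjacent to every vertex of the cycle $C_{n-1}$. *)

theory Defs
  imports Complex_Main "HOL-Library.Ramsey"
begin

section \<open>Simple graphs and copies\<close>

type_synonym 'a ugraph = "'a set \<times> 'a set set"

abbreviation verts :: "'a ugraph \<Rightarrow> 'a set" where
  "verts G \<equiv> fst G"

abbreviation edges :: "'a ugraph \<Rightarrow> 'a set set" where
  "edges G \<equiv> snd G"

definition simple_graph :: "'a ugraph \<Rightarrow> bool" where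
  "simple_graph G \<longleftrightarrow> finite (verts G) \<and> edges G \<subseteq> [verts G]\<^bsup>2\<^esup>"

text \<open>A copy need not be an induced subgraph.\<close>

definition contains_copy :: "'b ugraph \<Rightarrow> 'a ugraph \<Rightarrow> bool" where
  "contains_copy H G \<longleftrightarrow>
     (\<exists>\<phi>. inj_on \<phi> (verts G) \<and> \<phi> ` verts G \<subseteq> verts H \<and> (\<forall>e\<in>edges G. \<phi> ` e \<in> edges H))"

section \<open>Ramsey numbers\<close>

datatype colour = Red | Blue

text \<open>
  An edge-colouring of the complete graph on \<open>{..<N}\<close> is given by a total function on
  sets of vertices; its values outside \<open>[{..<N}]\<^bsup>2\<^esup>\<close> are irrelevant.
\<close>

definition colour_class :: "nat \<Rightarrow> (nat set \<Rightarrow> colour) \<Rightarrow> colour \<Rightarrow> nat ugraph" where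
  "colour_class N c k = ({..<N}, {e \<in> [{..<N}]\<^bsup>2\<^esup>. c e = k})"

definition ramsey_arrows :: "nat \<Rightarrow> 'a ugraph \<Rightarrow> 'b ugraph \<Rightarrow> bool" where
  "ramsey_arrows N G1 G2 \<longleftrightarrow>
     (\<forall>c. contains_copy (colour_class N c Red) G1 \<or> contains_copy (colour_class N c Blue) G2)"

definition ramsey_number :: "'a ugraph \<Rightarrow> 'b ugraph \<Rightarrow> nat" where
  "ramsey_number G1 G2 = (LEAST N. N > 0 \<and> ramsey_arrows N G1 G2)"

section \<open>Wheels\<close>

text \<open>The following is the usual cycle only for \<open>m \<ge> 3\<close>.\<close>

definition cycle_graph :: "nat \<Rightarrow> nat ugraph" where
  "cycle_graph m = ({..<m}, {{i, Suc i mod m} | i. i < m})"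

text \<open>The rim is the cycle on \<open>{..<n - 1}\<close> and the hub is the vertex \<open>n - 1\<close>; here \<open>n \<ge> 4\<close>.\<close>

definition wheel :: "nat \<Rightarrow> nat ugraph" where
  "wheel n =
     (insert (n - 1) (verts (cycle_graph (n - 1))),
      edges (cycle_graph (n - 1)) \<union> {{n - 1, v} | v. v \<in> verts (cycle_graph (n - 1))})"

section \<open>Well-definedness\<close>

lemma contains_copy_if_complete:
  assumes "simple_graph G" "R \<subseteq> verts H" "finite R" "card R = card (verts G)" "[R]\<^bsup>2\<^esup> \<subseteq> edges H"
  shows "contains_copy H G"
proof -
  from assms obtain \<phi> where b: "bij_betw \<phi> (verts G) R"
    unfolding simple_graph_def by (metis finite_same_card_bij)
  have im: "\<phi> ` e \<in> [R]\<^bsup>2\<^esup>" if "e \<in> edges G" for e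
  proof -
    from that assms(1) have "e \<in> [verts G]\<^bsup>2\<^esup>" by (auto simp: simple_graph_def)
    then obtain x y where "e = {x,y}" "x \<in> verts G" "y \<in> verts G" "x \<noteq> y"
      by (rule nsets2_E)
    with b show ?thesis by (auto simp: bij_betw_def inj_on_def)
  qed
  have "inj_on \<phi> (verts G)" "\<phi> ` verts G \<subseteq> verts H"
    using b assms(2) by (auto simp: bij_betw_def)
  moreover have "\<forall>e\<in>edges G. \<phi> ` e \<in> edges H"
    using im assms(5) by (meson subsetD)
  ultimately show ?thesis
    unfolding contains_copy_def by (intro exI[of _ \<phi>] conjI)
qed

lemma ramsey_number_exists:
  assumes "simple_graph G1" "simple_graph G2"
  shows "\<exists>N>0. ramsey_arrows N G1 G2"
proof -
  obtain r where r: "r \<ge> 1"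
    and *: "\<forall>(V::nat set) E. finite V \<and> card V \<ge> r \<longrightarrow>
      (\<exists>R \<subseteq> V. card R = card (verts G1) \<and> clique R E \<or> card R = card (verts G2) \<and> indep R E)"
    using ramsey2[of "card (verts G1)" "card (verts G2)"] by blast
  have "contains_copy (colour_class r c Red) G1 \<or> contains_copy (colour_class r c Blue) G2" for c
  proof -
    obtain R where R: "R \<subseteq> {..<r}" and
      d: "card R = card (verts G1) \<and> clique R {e. c e = Red} \<or>
          card R = card (verts G2) \<and> indep R {e. c e = Red}"
      using *[rule_format, of "{..<r}" "{e. c e = Red}"] by auto
    have fin: "finite R" using R finite_subset by blast
    from d show ?thesis
    proof (elim disjE conjE)
      assume 1: "card R = card (verts G1)" and 2: "clique R {e. c e = Red}"
      have "[R]\<^bsup>2\<^esup> \<subseteq> edges (colour_class r c Red)"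
        using R 2 by (auto simp: colour_class_def clique_def subset_iff elim!: nsets2_E)
      with contains_copy_if_complete[of G1 R "colour_class r c Red"] assms 1 R fin
      show ?thesis by (auto simp: colour_class_def)
    next
      assume 1: "card R = card (verts G2)" and 2: "indep R {e. c e = Red}"
      have "c {x, y} = Blue" if "x \<in> R" "y \<in> R" "x \<noteq> y" for x y
        using 2 that by (cases "c {x, y}") (auto simp: indep_def)
      then have "[R]\<^bsup>2\<^esup> \<subseteq> edges (colour_class r c Blue)"
        using R by (auto simp: colour_class_def subset_iff elim!: nsets2_E)
      with contains_copy_if_complete[of G2 R "colour_class r c Blue"] assms 1 R fin
      show ?thesis by (auto simp: colour_class_def)
    qed
  qed
  with r show ?thesis unfolding ramsey_arrows_def by (intro exI[of _ r]) auto
qed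

lemma simple_graph_wheel:
  assumes "n \<ge> 4"
  shows "simple_graph (wheel n)"
proof -
  have "i \<noteq> Suc i mod (n - Suc 0)" if "i < n - Suc 0" for i
    using that assms by (cases "Suc i = n - Suc 0") auto
  then show ?thesis
    using assms by (auto simp: simple_graph_def wheel_def cycle_graph_def)
qed

lemma card_verts_wheel: "n \<ge> 4 \<Longrightarrow> card (verts (wheel n)) = n"
  by (simp add: wheel_def cycle_graph_def)

end

theory Submission
  imports Defs
begin

text \<open>
  Write \<open>n = 2 * k\<close>. Any vertex \<open>v\<close> of the complete graph on \<open>12 * k - 10\<close> vertices has \<open>6 * k - 5\<close>
  neighbours in one colour, say red. If this set \<open>A\<close> contains a red cycle of length \<open>2 * k - 1\<close>, then \<open>v\<close> is
  the hub of a red wheel; suppose it does not, and suppose also that there is no blue wheel.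

  A set of \<open>3 * k - 1\<close> vertices without a monochromatic cycle of length \<open>2 * k - 1\<close> has a monochromatic
  complete bipartite subgraph with \<open>k\<close> vertices on each side: it has a monochromatic cycle of length at least
  \<open>2 * k - 1\<close>, and a shortest such cycle is longer than \<open>2 * k - 1\<close> and has a rigid structure.
  A red biclique in \<open>A\<close> yields a blue wheel. A vertex of blue degree at least \<open>3 * k - 1\<close> in \<open>A\<close> therefore
  has a blue neighbourhood that is, up to one vertex, the union of two red cliques; doing this twice yields a
  blue complete tripartite graph with \<open>k\<close> vertices in each class, which is impossible.
  So all red degrees in \<open>A\<close> are at least \<open>3 * k - 4\<close>. There is a red triangle, and an odd red cycle of
  length \<open>j \<le> 2 * k - 3\<close> extends to one of length \<open>j + 2\<close>: otherwise the outer red neighbourhoods of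
  consecutive cycle vertices are joined in blue, which again gives blue wheels.
\<close>

section \<open>Paths and cycles\<close>

text \<open>As \<open>n\<close> is even, the rim has odd length \<open>2 * k - 1\<close>, and no
  bipartite graph contains an odd cycle; this obstacle shapes the proof. When a colour is complete
  between sets of \<open>k\<close> and \<open>k - 1\<close> vertices, one more edge of that colour
  inside the larger set closes such a rim, and so does a further vertex with a neighbour of that
  colour on each side. Excluding rims therefore makes the larger set a clique of the other colour
  and makes every further vertex see all of one side in the other colour. Most structural claims
  below are instances of this alternative; in blue it is usually applied inside the blue
  neighbourhood of some hub. The size \<open>6 * k - 5\<close> is
  \<open>3 * (2 * k - 2) + 1\<close>: in a blue tripartite graph every vertex of \<open>A\<close>
  must be red to a whole class, and at most \<open>2 * k - 2\<close> vertices can be so for any one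
  class. The bound \<open>k >= 4\<close> is met with equality in several counts, such as
  \<open>2 * k <= 3 * k - 4\<close>.\<close>

definition pth :: "('a \<Rightarrow> 'a \<Rightarrow> bool) \<Rightarrow> 'a list \<Rightarrow> 'a \<Rightarrow> 'a \<Rightarrow> bool" where
  "pth R xs a b \<longleftrightarrow> xs \<noteq> [] \<and> hd xs = a \<and> last xs = b \<and> distinct xs \<and> successively R xs"

definition cyc :: "('a \<Rightarrow> 'a \<Rightarrow> bool) \<Rightarrow> 'a list \<Rightarrow> bool" where
  "cyc R xs \<longleftrightarrow> length xs \<ge> 3 \<and> distinct xs \<and> successively R xs \<and> R (last xs) (hd xs)"

definition has_cycle :: "('a \<Rightarrow> 'a \<Rightarrow> bool) \<Rightarrow> 'a set \<Rightarrow> nat \<Rightarrow> bool" where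
  "has_cycle R S n \<longleftrightarrow> (\<exists>xs. cyc R xs \<and> set xs \<subseteq> S \<and> length xs = n)"

lemma has_cycle_mono: "has_cycle R S n \<Longrightarrow> S \<subseteq> T \<Longrightarrow> has_cycle R T n"
  unfolding has_cycle_def by blast

lemma pth_single [simp]: "pth R [a] b c \<longleftrightarrow> a = b \<and> a = c"
  by (auto simp: pth_def)

lemma pth_append:
  assumes "pth R xs a b" "pth R ys c d" "set xs \<inter> set ys = {}" "R b c"
  shows "pth R (xs @ ys) a d"
  using assms by (auto simp: pth_def successively_append_iff)

lemma pth_Cons:
  assumes "pth R ys c d" "a \<notin> set ys" "R a c"
  shows "pth R (a # ys) a d"
  using pth_append[of R "[a]" a a ys c d] assms by auto

lemma pth_snoc:
  assumes "pth R ys c d" "a \<notin> set ys" "R d a"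
  shows "pth R (ys @ [a]) c a"
  using pth_append[of R ys c d "[a]" a a] assms by auto

lemma pth_rev:
  assumes "symp R" "pth R xs a b"
  shows "pth R (rev xs) b a"
proof -
  have "successively (\<lambda>x y. R y x) xs \<longleftrightarrow> successively R xs"
    using assms(1) by (intro successively_cong) (auto dest: sympD)
  then show ?thesis using assms(2)
    by (simp add: pth_def hd_rev last_rev)
qed

lemma cyc_close: "pth R xs a b \<Longrightarrow> R b a \<Longrightarrow> length xs \<ge> 3 \<Longrightarrow> cyc R xs"
  by (auto simp: pth_def cyc_def)

lemma has_cycle_close:
  assumes "pth R xs a b" "R b a" "length xs = n" "n \<ge> 3" "set xs \<subseteq> S"
  shows "has_cycle R S n"
  unfolding has_cycle_def using cyc_close[OF assms(1,2)] assms(3-5) by (intro exI[of _ xs]) simp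

lemma symp_not: "symp R \<Longrightarrow> symp (\<lambda>x y. \<not> R x y)"
  by (auto simp: symp_def)

section \<open>Cycles of prescribed length in complete bipartite graphs\<close>

lemma pick_other: "finite P \<Longrightarrow> card P \<ge> 2 \<Longrightarrow> \<exists>p\<in>P. p \<noteq> a"
  using card_mono[of "{a}" P] by (cases "P \<subseteq> {a}") auto

lemma bip_path:
  assumes "finite P" "finite Q" "P \<inter> Q = {}" "symp R"
    "\<And>p q. p \<in> P \<Longrightarrow> q \<in> Q \<Longrightarrow> R p q" "p \<in> P" "q \<in> Q" "n \<ge> 1" "n \<le> card P" "n \<le> card Q"
  shows "\<exists>xs. pth R xs p q \<and> set xs \<subseteq> P \<union> Q \<and> length xs = 2 * n"
  using assms
proof (induction n arbitrary: P Q p)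
  case 0 then show ?case by simp
next
  case (Suc n)
  show ?case
  proof (cases "n = 0")
    case True
    have "pth R [p, q] p q" using Suc.prems by (auto simp: pth_def)
    then show ?thesis using True Suc.prems by (intro exI[of _ "[p,q]"]) auto
  next
    case False
    obtain q1 where q1: "q1 \<in> Q" "q1 \<noteq> q" using pick_other[of Q q] Suc.prems False by auto
    obtain p1 where p1: "p1 \<in> P" "p1 \<noteq> p" using pick_other[of P p] Suc.prems False by auto
    have "\<exists>xs. pth R xs p1 q \<and> set xs \<subseteq> (P - {p}) \<union> (Q - {q1}) \<and> length xs = 2 * n"
    proof (rule Suc.IH)
      show "n \<le> card (P - {p})" "n \<le> card (Q - {q1})" using Suc.prems q1 by auto
    qed (use Suc.prems q1 p1 False in auto)
    then obtain xs where xs: "pth R xs p1 q" "set xs \<subseteq> (P - {p}) \<union> (Q - {q1})" "length xs = 2 * n"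
      by blast
    have "R q1 p1" using Suc.prems(4,5) p1 q1 by (meson sympD)
    then have 1: "pth R (q1 # xs) q1 q"
      using xs q1 p1 Suc.prems(3) by (intro pth_Cons[OF xs(1)]) auto
    have "pth R (p # q1 # xs) p q"
      using xs q1 p1 Suc.prems(3,5,6) by (intro pth_Cons[OF 1]) auto
    then show ?thesis using xs q1 Suc.prems by (intro exI[of _ "p # q1 # xs"]) auto
  qed
qed

lemma bip_path_same:
  assumes "finite P" "finite Q" "P \<inter> Q = {}" "symp R"
    "\<And>p q. p \<in> P \<Longrightarrow> q \<in> Q \<Longrightarrow> R p q" "p \<in> P" "p' \<in> P" "p \<noteq> p'"
    "n \<ge> 1" "Suc n \<le> card P" "n \<le> card Q"
  shows "\<exists>xs. pth R xs p p' \<and> set xs \<subseteq> P \<union> Q \<and> length xs = 2 * n + 1"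
proof -
  obtain q where q: "q \<in> Q" using assms by fastforce
  have "\<exists>xs. pth R xs p q \<and> set xs \<subseteq> (P - {p'}) \<union> Q \<and> length xs = 2 * n"
    by (rule bip_path) (use assms q in auto)
  then obtain xs where xs: "pth R xs p q" "set xs \<subseteq> (P - {p'}) \<union> Q" "length xs = 2 * n" by blast
  have "R q p'" using assms(4,5,7) q by (meson sympD)
  then have "pth R (xs @ [p']) p p'"
    by (intro pth_snoc[OF xs(1)]) (use assms(3,7) xs in auto)
  then show ?thesis using xs assms by (intro exI[of _ "xs @ [p']"]) auto
qed

lemma bip_even_cycle:
  assumes "finite P" "finite Q" "P \<inter> Q = {}" "symp R"
    "\<And>p q. p \<in> P \<Longrightarrow> q \<in> Q \<Longrightarrow> R p q" "n \<ge> 2" "n \<le> card P" "n \<le> card Q"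
  shows "has_cycle R (P \<union> Q) (2 * n)"
proof -
  obtain p q where "p \<in> P" "q \<in> Q" using assms by fastforce
  then obtain xs where xs: "pth R xs p q" "set xs \<subseteq> P \<union> Q" "length xs = 2 * n"
    using bip_path[of P Q R p q n] assms by auto
  have "R q p" using assms(4,5) \<open>p \<in> P\<close> \<open>q \<in> Q\<close> by (meson sympD)
  then show ?thesis
    using has_cycle_close[OF xs(1) _ xs(3) _ xs(2)] assms(6) by simp
qed

text \<open>An alternating path with both ends in \<open>P\<close> has odd order, and the edge
  inside \<open>P\<close> closes it.\<close>

lemma bip_odd_cycle:
  assumes "finite P" "finite Q" "P \<inter> Q = {}" "symp R"
    "\<And>p q. p \<in> P \<Longrightarrow> q \<in> Q \<Longrightarrow> R p q" "p \<in> P" "p' \<in> P" "p \<noteq> p'" "R p p'"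
    "n \<ge> 1" "Suc n \<le> card P" "n \<le> card Q"
  shows "has_cycle R (P \<union> Q) (2 * n + 1)"
proof -
  obtain xs where xs: "pth R xs p p'" "set xs \<subseteq> P \<union> Q" "length xs = 2 * n + 1"
    using bip_path_same[of P Q R p p' n] assms by auto
  have "R p' p" using assms(4,9) by (meson sympD)
  then show ?thesis
    using has_cycle_close[OF xs(1) _ xs(3) _ xs(2)] assms(10) by simp
qed

text \<open>The vertex \<open>y\<close> closes an alternating path whose ends lie on different
  sides. Here \<open>n\<close> vertices on each side suffice, one fewer in \<open>P\<close> than an
  edge inside \<open>P\<close> requires.\<close>

lemma bip_apex_cycle:
  assumes "finite P" "finite Q" "P \<inter> Q = {}" "symp R"
    "\<And>p q. p \<in> P \<Longrightarrow> q \<in> Q \<Longrightarrow> R p q" "p \<in> P" "q \<in> Q" "y \<notin> P" "y \<notin> Q" "R y p" "R y q"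
    "n \<ge> 1" "n \<le> card P" "n \<le> card Q"
  shows "has_cycle R (insert y (P \<union> Q)) (2 * n + 1)"
proof -
  obtain xs where xs: "pth R xs p q" "set xs \<subseteq> P \<union> Q" "length xs = 2 * n"
    using bip_path[of P Q R p q n] assms by auto
  have "R q y" using assms(4,11) by (meson sympD)
  then have 1: "pth R (xs @ [y]) p y"
    by (intro pth_snoc[OF xs(1)]) (use assms(8,9) xs in auto)
  show ?thesis
    by (rule has_cycle_close[OF 1]) (use assms(10,12) xs in auto)
qed

lemma bip_extra_cycle:
  assumes "finite P" "finite Q" "P \<inter> Q = {}" "symp R"
    "\<And>p q. p \<in> P \<Longrightarrow> q \<in> Q \<Longrightarrow> R p q" "p \<in> P" "p' \<in> P" "p \<noteq> p'" "y \<notin> P" "y \<notin> Q" "R y p" "R y p'"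
    "n \<ge> 1" "Suc n \<le> card P" "n \<le> card Q"
  shows "has_cycle R (insert y (P \<union> Q)) (2 * n + 2)"
proof -
  obtain xs where xs: "pth R xs p p'" "set xs \<subseteq> P \<union> Q" "length xs = 2 * n + 1"
    using bip_path_same[of P Q R p p' n] assms by auto
  have "R p' y" using assms(4,12) by (meson sympD)
  then have 1: "pth R (xs @ [y]) p y"
    by (intro pth_snoc[OF xs(1)]) (use assms(9,10) xs in auto)
  show ?thesis
    by (rule has_cycle_close[OF 1]) (use assms(11,13) xs in auto)
qed

section \<open>Paths and cycles in cliques\<close>

definition complete_on :: "('a \<Rightarrow> 'a \<Rightarrow> bool) \<Rightarrow> 'a set \<Rightarrow> bool" where
  "complete_on R P \<longleftrightarrow> (\<forall>x\<in>P. \<forall>y\<in>P. x \<noteq> y \<longrightarrow> R x y)"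

lemma complete_onD: "complete_on R P \<Longrightarrow> x \<in> P \<Longrightarrow> y \<in> P \<Longrightarrow> x \<noteq> y \<Longrightarrow> R x y"
  by (simp add: complete_on_def)

lemma complete_on_subset: "complete_on R P \<Longrightarrow> Q \<subseteq> P \<Longrightarrow> complete_on R Q"
  by (auto simp: complete_on_def)

lemma complete_on_successively:
  "complete_on R (set xs) \<Longrightarrow> distinct xs \<Longrightarrow> successively R xs"
  by (simp add: successively_conv_nth nth_eq_iff_index_eq complete_on_def)

text \<open>The ends need only be joined to the clique \<open>P\<close> and may lie outside it. This
  lets the vertices attached to a clique be used as if they belonged to it. The number
  \<open>n\<close> counts inner vertices.\<close>

lemma core_path:
  assumes "finite P" "complete_on R P" "symp R" "y \<noteq> y'"
    "\<And>p. p \<in> P \<Longrightarrow> p \<noteq> y \<Longrightarrow> R y p" "\<And>p. p \<in> P \<Longrightarrow> p \<noteq> y' \<Longrightarrow> R y' p"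
    "n \<le> card (P - {y, y'})" "n = 0 \<Longrightarrow> R y y'"
  shows "\<exists>xs. pth R xs y y' \<and> set xs \<subseteq> P \<union> {y, y'} \<and> length xs = n + 2"
proof -
  obtain T where T: "T \<subseteq> P - {y, y'}" "card T = n" "finite T"
    using assms(7) by (rule obtain_subset_with_card_n)
  obtain ts where ts: "set ts = T" "distinct ts"
    using finite_distinct_list[OF T(3)] by blast
  have len: "length ts = n" using ts T distinct_card[OF ts(2)] by simp
  show ?thesis
  proof (cases "n = 0")
    case True
    have "pth R [y, y'] y y'" using assms(4,8) True by (auto simp: pth_def)
    then show ?thesis using True by (intro exI[of _ "[y, y']"]) auto
  next
    case False
    then have ne: "ts \<noteq> []" using len by auto
    have p: "pth R ts (hd ts) (last ts)"
      using ne ts T assms(2) by (auto simp: pth_def intro!: complete_on_successively complete_on_subset[OF assms(2)])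
    have h: "hd ts \<in> T" "last ts \<in> T" using ne ts by auto
    have sub: "hd ts \<in> P" "hd ts \<noteq> y" "last ts \<in> P" "last ts \<noteq> y'" "y \<notin> set ts" "y' \<notin> set (y # ts)"
      using h T(1) ts(1) assms(4) by auto
    have 1: "pth R (y # ts) y (last ts)"
      using pth_Cons[OF p] sub assms(5) by blast
    have "R (last ts) y'" using sympD[OF assms(3) assms(6)] sub by blast
    then have "pth R ((y # ts) @ [y']) y y'"
      using pth_snoc[OF 1] sub by blast
    then show ?thesis using T ts len by (intro exI[of _ "(y # ts) @ [y']"]) auto
  qed
qed

lemma clique_path:
  assumes "finite P" "complete_on R P" "symp R" "y \<in> P" "y' \<in> P" "y \<noteq> y'" "2 \<le> n" "n \<le> card P"
  shows "\<exists>xs. pth R xs y y' \<and> set xs \<subseteq> P \<and> length xs = n"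
proof -
  have "card (P - {y, y'}) = card P - 2" using assms by (simp add: card_Diff_subset)
  then have "\<exists>xs. pth R xs y y' \<and> set xs \<subseteq> P \<union> {y, y'} \<and> length xs = (n - 2) + 2"
    using complete_onD[OF assms(2)] assms(4-8) by (intro core_path assms(1-3)) auto
  then show ?thesis using assms(4,5,7) by (auto simp: insert_absorb)
qed

lemma clique_cycle:
  assumes "finite P" "complete_on R P" "symp R" "3 \<le> n" "n \<le> card P"
  shows "has_cycle R P n"
proof -
  obtain p where p: "p \<in> P" using assms by fastforce
  obtain p' where p': "p' \<in> P" "p' \<noteq> p" using pick_other[of P p] assms by auto
  obtain xs where xs: "pth R xs p p'" "set xs \<subseteq> P" "length xs = n"
    using clique_path[of P R p p' n] assms p p' by auto
  have "R p' p" using complete_onD[OF assms(2)] p p' by auto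
  then show ?thesis using has_cycle_close[OF xs(1) _ xs(3) _ xs(2)] assms(4) by simp
qed

text \<open>A cycle of length \<open>L\<close> is also handled as a function of period \<open>L\<close>, so that no index has to be
  reduced modulo \<open>L\<close>.\<close>

definition cyf :: "('a \<Rightarrow> 'a \<Rightarrow> bool) \<Rightarrow> (nat \<Rightarrow> 'a) \<Rightarrow> nat \<Rightarrow> bool" where
  "cyf R x L \<longleftrightarrow> L \<ge> 3 \<and> (\<forall>i. x (i + L) = x i) \<and> inj_on x {..<L} \<and> (\<forall>i. R (x i) (x (Suc i)))"

lemma cyf_period: "cyf R x L \<Longrightarrow> x (i + L) = x i"
  by (simp add: cyf_def)

lemma cyf_mod:
  assumes "cyf R x L" shows "x (i mod L) = x i"
proof -
  have "x (j + L * t) = x j" for j t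
    by (induction t) (use assms in \<open>auto simp: cyf_def add.assoc[symmetric] add.commute[of L]\<close>)
  from this[of "i mod L" "i div L"] show ?thesis by simp
qed

lemma cyf_eq_iff:
  assumes "cyf R x L" shows "x i = x j \<longleftrightarrow> i mod L = j mod L"
proof -
  have "x i = x j \<longleftrightarrow> x (i mod L) = x (j mod L)" using cyf_mod[OF assms] by metis
  also have "\<dots> \<longleftrightarrow> i mod L = j mod L"
    using assms by (auto simp: cyf_def inj_on_def)
  finally show ?thesis .
qed

lemma cyf_range: "cyf R x L \<Longrightarrow> range x = x ` {..<L}"
proof -
  assume c: "cyf R x L"
  have "x i \<in> x ` {..<L}" for i
    using cyf_mod[OF c, of i] c by (metis cyf_def image_eqI lessThan_iff mod_less_divisor
        order_less_le_trans zero_less_numeral)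
  then show ?thesis by auto
qed

lemma cyf_card_range: "cyf R x L \<Longrightarrow> card (range x) = L"
  using cyf_range[of R x L] by (simp add: card_image cyf_def)

lemma cyf_finite_range: "cyf R x L \<Longrightarrow> finite (range x)"
  using cyf_range[of R x L] by simp

lemma cyf_inj_window:
  assumes "cyf R x L" shows "inj_on x {a..<a + L}"
proof (rule inj_onI)
  fix i j assume ij: "i \<in> {a..<a + L}" "j \<in> {a..<a + L}" "x i = x j"
  have "i' mod L = j' mod L \<Longrightarrow> i' \<in> {a..<a + L} \<Longrightarrow> j' \<in> {a..<a + L} \<Longrightarrow> i' \<le> j' \<Longrightarrow> i' = j'" for i' j'
  proof -
    assume h: "i' mod L = j' mod L" "i' \<in> {a..<a + L}" "j' \<in> {a..<a + L}" "i' \<le> j'"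
    then have "L dvd j' - i'" by (metis mod_eq_dvd_iff_nat)
    moreover have "j' - i' < L" using h by auto
    ultimately have "j' - i' = 0" by (meson dvd_imp_le gr0I leD)
    then show "i' = j'" using h by simp
  qed
  moreover have "i mod L = j mod L" using cyf_eq_iff[OF assms] ij(3) by blast
  ultimately show "i = j" using ij(1,2) by (metis nat_le_linear)
qed

lemma cyf_shift: "cyf R x L \<Longrightarrow> cyf R (\<lambda>i. x (d + i)) L"
  unfolding cyf_def
proof (intro conjI allI; elim conjE)
  assume h: "3 \<le> L" "\<forall>i. x (i + L) = x i" "inj_on x {..<L}" "\<forall>i. R (x i) (x (Suc i))"
  then have c: "cyf R x L" by (simp add: cyf_def)
  show "inj_on (\<lambda>i. x (d + i)) {..<L}"
  proof (rule inj_onI)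
    fix i j assume "i \<in> {..<L}" "j \<in> {..<L}" "x (d + i) = x (d + j)"
    then show "i = j" using inj_onD[OF cyf_inj_window[OF c, of d], of "d + i" "d + j"] by simp
  qed
qed (auto simp: add.assoc[symmetric])

lemma cyf_shift_range:
  assumes "cyf R x L" shows "range (\<lambda>i. x (d + i)) = range x"
proof -
  have "x i \<in> range (\<lambda>i. x (d + i))" for i
  proof -
    have "x i = x (d + (i + d * (L - 1)))"
    proof -
      have "d + (i + d * (L - 1)) = i + d * L" using assms by (cases L) (auto simp: cyf_def)
      then show ?thesis using cyf_eq_iff[OF assms, of i "d + (i + d * (L - 1))"]
        by (metis mod_mult_self1)
    qed
    then show ?thesis by blast
  qed
  then show ?thesis by auto
qed

lemma cyc_cyf:
  assumes "cyc R xs"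
  shows "cyf R (\<lambda>i. xs ! (i mod length xs)) (length xs)" "range (\<lambda>i. xs ! (i mod length xs)) = set xs"
proof -
  let ?L = "length xs"
  have L: "?L \<ge> 3" and d: "distinct xs" and s: "successively R xs" and c: "R (last xs) (hd xs)"
    using assms by (auto simp: cyc_def)
  have R: "R (xs ! (i mod ?L)) (xs ! (Suc i mod ?L))" for i
  proof (cases "Suc (i mod ?L) = ?L")
    case True
    then have "Suc i mod ?L = 0" by (simp add: mod_Suc)
    moreover have "i mod ?L = ?L - 1" using True by simp
    moreover have "xs \<noteq> []" using L by auto
    ultimately show ?thesis using c by (simp add: last_conv_nth hd_conv_nth)
  next
    case False
    have "i mod ?L < ?L" using L by (intro mod_less_divisor) auto
    then show ?thesis using False s by (simp add: mod_Suc successively_conv_nth)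
  qed
  then show "cyf R (\<lambda>i. xs ! (i mod ?L)) ?L"
    using L d by (auto simp: cyf_def inj_on_def nth_eq_iff_index_eq)
  show "range (\<lambda>i. xs ! (i mod ?L)) = set xs"
  proof
    show "range (\<lambda>i. xs ! (i mod ?L)) \<subseteq> set xs" using L by (auto intro!: nth_mem mod_less_divisor)
    show "set xs \<subseteq> range (\<lambda>i. xs ! (i mod ?L))"
      by (auto simp: in_set_conv_nth image_iff) (metis mod_less)
  qed
qed

lemma has_cycle_cyf:
  assumes "has_cycle R S n" obtains x where "cyf R x n" "range x \<subseteq> S"
proof -
  obtain xs where "cyc R xs" "set xs \<subseteq> S" "length xs = n" using assms by (auto simp: has_cycle_def)
  then show ?thesis using cyc_cyf[of R xs] that by blast
qed

section \<open>Arcs of a cycle and detours through outside vertices\<close>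

lemma arc:
  assumes "cyf R x L" "a < b" "b \<le> a + L"
  shows "pth R (map x [a..<b]) (x a) (x (b - 1))"
proof -
  have "inj_on x {a..<b}" by (rule inj_on_subset[OF cyf_inj_window[OF assms(1), of a]]) (use assms in auto)
  then have "distinct (map x [a..<b])" by (simp add: distinct_map)
  moreover have "successively R (map x [a..<b])"
    using assms(1) by (auto simp: successively_conv_nth cyf_def)
  ultimately show ?thesis using assms(2) by (auto simp: pth_def last_map hd_map)
qed

lemma arcs_disjoint:
  assumes "cyf R x L" "b \<le> c" "d \<le> a + L" "a \<le> c"
  shows "set (map x [a..<b]) \<inter> set (map x [c..<d]) = {}"
proof -
  have "x i \<noteq> x j" if "i \<in> {a..<b}" "j \<in> {c..<d}" for i j
    using inj_onD[OF cyf_inj_window[OF assms(1), of a], of i j] that assms(2-4) by auto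
  then show ?thesis by auto
qed

lemma ear:
  assumes "cyf R x L" "pth R ys u w" "set ys \<inter> range x = {}" "R (x i) u" "R w (x (Suc i))"
  shows "has_cycle R (set ys \<union> range x) (L + length ys)"
proof -
  have 1: "pth R (map x [Suc i..<Suc i + L]) (x (Suc i)) (x i)"
    using arc[OF assms(1), of "Suc i" "Suc i + L"] assms(1) by (auto simp: cyf_def)
  have dj: "set ys \<inter> set (map x [Suc i..<Suc i + L]) = {}" using assms(3) by auto
  have L: "3 \<le> L" using assms(1) by (simp add: cyf_def)
  have "pth R (ys @ map x [Suc i..<Suc i + L]) u (x i)"
    by (rule pth_append[OF assms(2) 1 dj assms(5)])
  then show ?thesis
    by (rule has_cycle_close) (use assms(4) L in auto)
qed

lemma ear1:
  assumes "symp R" "cyf R x L" "w \<notin> range x" "R w (x i)" "R w (x (Suc i))"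
  shows "has_cycle R (insert w (range x)) (L + 1)"
  using ear[OF assms(2), of "[w]" w w i] assms by (auto dest: sympD)

lemma ear2:
  assumes "symp R" "cyf R x L" "u \<notin> range x" "w \<notin> range x" "u \<noteq> w" "R u w" "R u (x i)" "R w (x (Suc i))"
  shows "has_cycle R (insert u (insert w (range x))) (L + 2)"
proof -
  have "pth R [u, w] u w" using assms by (auto simp: pth_def)
  from ear[OF assms(2) this, of i] show ?thesis
    using assms(3,4,8) sympD[OF assms(1,7)] by (simp add: insert_commute)
qed

text \<open>The cycle is cut after \<open>x i\<close> and after \<open>x j\<close>. The arc from
  \<open>x (Suc i)\<close> to \<open>x j\<close> is traversed backwards; \<open>u\<close> then joins
  the two arcs at \<open>x i\<close> and \<open>x j\<close>, and \<open>w\<close> joins them at the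
  two successors.\<close>

lemma crossing:
  assumes "symp R" "cyf R x L" "u \<notin> range x" "w \<notin> range x" "u \<noteq> w" "i < j" "j < i + L"
    "R u (x i)" "R u (x j)" "R w (x (Suc i))" "R w (x (Suc j))"
  shows "has_cycle R (insert u (insert w (range x))) (L + 2)"
proof -
  have a1: "pth R (map x [Suc i..<Suc j]) (x (Suc i)) (x j)"
    using arc[OF assms(2), of "Suc i" "Suc j"] assms(6,7) by simp
  have a2: "pth R (map x [Suc j..<Suc i + L]) (x (Suc j)) (x i)"
    using arc[OF assms(2), of "Suc j" "Suc i + L"] assms(2,6,7) by (simp add: cyf_def)
  have dj: "set (map x [Suc i..<Suc j]) \<inter> set (map x [Suc j..<Suc i + L]) = {}"
    by (rule arcs_disjoint[OF assms(2)]) (use assms(6,7) in auto)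
  note r = pth_rev[OF assms(1) a1]
  have wn: "w \<notin> set (rev (map x [Suc i..<Suc j]))" "w \<notin> set (map x [Suc j..<Suc i + L])" using assms(4) by auto
  have p1: "pth R (rev (map x [Suc i..<Suc j]) @ [w]) (x j) w"
    by (rule pth_snoc[OF r wn(1) sympD[OF assms(1,10)]])
  have dj2: "set (rev (map x [Suc i..<Suc j]) @ [w]) \<inter> set (map x [Suc j..<Suc i + L]) = {}"
    using dj wn(2) by auto
  have p2: "pth R ((rev (map x [Suc i..<Suc j]) @ [w]) @ map x [Suc j..<Suc i + L]) (x j) (x i)"
    by (rule pth_append[OF p1 a2 dj2 assms(11)])
  have un: "u \<notin> set ((rev (map x [Suc i..<Suc j]) @ [w]) @ map x [Suc j..<Suc i + L])"
    using assms(3,5) by auto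
  have p3: "pth R (u # (rev (map x [Suc i..<Suc j]) @ [w]) @ map x [Suc j..<Suc i + L]) u (x i)"
    by (rule pth_Cons[OF p2 un assms(9)])
  show ?thesis
    by (rule has_cycle_close[OF p3 sympD[OF assms(1,8)]]) (use assms(2,6,7) in \<open>auto simp: cyf_def\<close>)
qed

lemma two_ears:
  assumes "symp R" "cyf R x L" "u \<notin> range x" "w \<notin> range x" "u \<noteq> w" "i < j" "j < i + L"
    "R u (x i)" "R u (x (Suc i))" "R w (x j)" "R w (x (Suc j))"
  shows "has_cycle R (insert u (insert w (range x))) (L + 2)"
proof -
  have a1: "pth R (map x [Suc i..<Suc j]) (x (Suc i)) (x j)"
    using arc[OF assms(2), of "Suc i" "Suc j"] assms(6,7) by simp
  have a2: "pth R (map x [Suc j..<Suc i + L]) (x (Suc j)) (x i)"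
    using arc[OF assms(2), of "Suc j" "Suc i + L"] assms(2,6,7) by (simp add: cyf_def)
  have dj: "set (map x [Suc i..<Suc j]) \<inter> set (map x [Suc j..<Suc i + L]) = {}"
    by (rule arcs_disjoint[OF assms(2)]) (use assms(6,7) in auto)
  have wn: "w \<notin> set (map x [Suc i..<Suc j])" "w \<notin> set (map x [Suc j..<Suc i + L])" using assms(4) by auto
  have p1: "pth R (map x [Suc i..<Suc j] @ [w]) (x (Suc i)) w"
    by (rule pth_snoc[OF a1 wn(1) sympD[OF assms(1,10)]])
  have dj2: "set (map x [Suc i..<Suc j] @ [w]) \<inter> set (map x [Suc j..<Suc i + L]) = {}"
    using dj wn(2) by auto
  have p2: "pth R ((map x [Suc i..<Suc j] @ [w]) @ map x [Suc j..<Suc i + L]) (x (Suc i)) (x i)"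
    by (rule pth_append[OF p1 a2 dj2 assms(11)])
  have un: "u \<notin> set ((map x [Suc i..<Suc j] @ [w]) @ map x [Suc j..<Suc i + L])"
    using assms(3,5) by auto
  have p3: "pth R (u # (map x [Suc i..<Suc j] @ [w]) @ map x [Suc j..<Suc i + L]) u (x i)"
    by (rule pth_Cons[OF p2 un assms(9)])
  show ?thesis
    by (rule has_cycle_close[OF p3 sympD[OF assms(1,8)]]) (use assms(2,6,7) in \<open>auto simp: cyf_def\<close>)
qed

text \<open>Otherwise \<open>X\<close> and its cyclic shift would be disjoint, too many elements for
  \<open>L\<close> residues.\<close>

lemma consecutive_in_cycle:
  assumes "X \<subseteq> {..<L}" "L < 2 * card X"
  shows "\<exists>i\<in>X. Suc i mod L \<in> X"
proof (rule ccontr)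
  assume "\<not> ?thesis"
  then have n: "\<And>i. i \<in> X \<Longrightarrow> Suc i mod L \<notin> X" by blast
  have f: "finite X" using assms(1) finite_subset by blast
  have L: "L > 0" using assms by (cases L) auto
  have inj: "inj_on (\<lambda>i. Suc i mod L) X"
  proof (rule inj_onI)
    fix i j assume h: "i \<in> X" "j \<in> X" "Suc i mod L = Suc j mod L"
    then have "i < L" "j < L" using assms(1) by auto
    then show "i = j" using h(3) by (auto simp: mod_Suc split: if_splits)
  qed
  have "card (X \<union> (\<lambda>i. Suc i mod L) ` X) = card X + card X"
    using n f inj by (subst card_Un_disjoint) (auto simp: card_image)
  moreover have "X \<union> (\<lambda>i. Suc i mod L) ` X \<subseteq> {..<L}" using assms(1) L by auto
  then have "card (X \<union> (\<lambda>i. Suc i mod L) ` X) \<le> L" using card_mono[of "{..<L}"] by auto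
  ultimately show False using assms(2) by linarith
qed

section \<open>Long monochromatic cycles\<close>

lemma pick_except_one:
  assumes "finite Z" "card Z \<ge> 2" "\<And>z z'. z \<in> Z \<Longrightarrow> z' \<in> Z \<Longrightarrow> z \<noteq> z' \<Longrightarrow> Pr z \<or> Pr z'"
  shows "\<exists>z\<in>Z. Pr z"
proof -
  obtain z where "z \<in> Z" using assms(2) by fastforce
  moreover obtain z' where "z' \<in> Z" "z' \<noteq> z" using pick_other[OF assms(1,2)] by blast
  ultimately show ?thesis using assms(3) by blast
qed

text \<open>The end of a longest path has small degree: the predecessors of its neighbours are ends of
  longest paths as well, so they miss everything beyond the first \<open>2 * b\<close> vertices.\<close>
lemma low_degree_vertex:
  assumes sy: "symp R" and fin: "finite S" and card: "2 * a + b + 2 \<le> card S"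
    and ab: "2 \<le> a" "b \<le> a" "a \<le> Suc b"
    and noR: "\<And>n. n > 2 * b \<Longrightarrow> \<not> has_cycle R S n"
    and noB: "\<And>n. n > 2 * a \<Longrightarrow> \<not> has_cycle (\<lambda>x y. \<not> R x y) S n"
  shows "\<exists>w\<in>S. card {y \<in> S. y \<noteq> w \<and> R w y} \<le> a - 1"
proof -
  define Pth where "Pth ys \<longleftrightarrow> ys \<noteq> [] \<and> distinct ys \<and> successively R ys \<and> set ys \<subseteq> S" for ys
  note syB = symp_not[OF sy]
  have b1: "b \<ge> 1" using ab by simp
  have "S \<noteq> {}" using card by auto
  then obtain s where s: "s \<in> S" by blast
  have "Pth [s]" using s by (simp add: Pth_def)
  moreover have "length ys < Suc (card S)" if "Pth ys" for ys
    using card_mono[OF fin, of "set ys"] distinct_card[of ys] that by (simp add: Pth_def)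
  ultimately obtain xs where xs: "Pth xs" and max: "\<And>ys. Pth ys \<Longrightarrow> length ys \<le> length xs"
    using ex_has_greatest_nat[of Pth "[s]" length "Suc (card S)"] by blast
  define n where "n = length xs"
  define w where "w = xs ! 0"
  have n0: "n > 0" using xs by (simp add: Pth_def n_def)
  have dx: "distinct xs" and xsS: "set xs \<subseteq> S" using xs by (auto simp: Pth_def)
  have pthI: "pth R ys (hd ys) (last ys)" if "Pth ys" for ys
    using that by (simp add: Pth_def pth_def)
  have wS: "w \<in> S" using xsS n0 by (auto simp: w_def n_def)
  \<comment> \<open>A neighbour off the path would prolong it; a neighbour at a position
    \<open>m >= 2 * b\<close> would close a cycle of length \<open>m + 1 > 2 * b\<close>.\<close>
  have far: "\<not> R (ys ! 0) z" if ys: "Pth ys" "length ys = n" and z: "z \<in> S" "z \<notin> set (take (2 * b) ys)" for ys z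
  proof
    assume Rz: "R (ys ! 0) z"
    have ne: "ys \<noteq> []" using ys by (simp add: Pth_def)
    show False
    proof (cases "z \<in> set ys")
      case False
      have "Pth (z # ys)"
        using ys(1) z False Rz sympD[OF sy Rz] by (auto simp: Pth_def successively_Cons hd_conv_nth)
      from max[OF this] ys(2) show False by (simp add: n_def)
    next
      case True
      then obtain m where m: "m < length ys" "ys ! m = z" by (metis in_set_conv_nth)
      have mb: "m \<ge> 2 * b"
      proof (rule ccontr)
        assume "\<not> m \<ge> 2 * b"
        then have "take (2 * b) ys ! m = z" "m < length (take (2 * b) ys)" using m by auto
        then show False using z(2) nth_mem by metis
      qed
      have tk: "Pth (take (Suc m) ys)"
        using ys(1) m successively_append_iff[of R "take (Suc m) ys" "drop (Suc m) ys"]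
        by (auto simp: Pth_def dest: in_set_takeD)
      have l: "last (take (Suc m) ys) = z" using m by (simp add: take_Suc_conv_app_nth)
      have h: "hd (take (Suc m) ys) = ys ! 0" using ne by (simp add: hd_conv_nth)
      have "has_cycle R S (Suc m)"
        by (rule has_cycle_close[OF pthI[OF tk]])
          (use m mb b1 l h sympD[OF sy Rz] tk in \<open>auto simp: Pth_def\<close>)
      with noR mb show False by auto
    qed
  qed
  define P0 where "P0 = set (take (2 * b) xs)"
  define Z where "Z = S - P0"
  have finZ: "finite Z" using fin by (simp add: Z_def)
  have cP0: "card P0 \<le> 2 * b" unfolding P0_def using card_length[of "take (2 * b) xs"] by simp
  have P0S: "P0 \<subseteq> S" using xsS by (auto simp: P0_def dest: in_set_takeD)
  have cZ: "card Z \<ge> 2 * a - b + 2"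
  proof -
    have "card Z = card S - card P0" unfolding Z_def using P0S fin by (simp add: card_Diff_subset finite_subset)
    then show ?thesis using card cP0 ab by linarith
  qed
  define I where "I = {i. 0 < i \<and> i < n \<and> R w (xs ! i)}"
  have I2: "i < 2 * b" if "i \<in> I" for i
  proof (rule ccontr)
    assume "\<not> i < 2 * b"
    then have "xs ! i \<notin> set (take (2 * b) xs)"
      using that dx by (auto simp: I_def n_def in_set_conv_nth nth_eq_iff_index_eq)
    moreover have "xs ! i \<in> S" using that xsS by (auto simp: I_def n_def)
    ultimately show False using far[OF xs, of "xs ! i"] that by (auto simp: I_def n_def w_def)
  qed
  have finI: "finite I" by (rule finite_subset[of _ "{..<n}"]) (auto simp: I_def)
  have nb: "{y \<in> S. y \<noteq> w \<and> R w y} \<subseteq> (\<lambda>i. xs ! i) ` I"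
  proof
    fix y assume y: "y \<in> {y \<in> S. y \<noteq> w \<and> R w y}"
    then have "y \<in> set (take (2 * b) xs)" using far[OF xs, of y] by (auto simp: w_def n_def)
    then obtain i where "i < n" "xs ! i = y" by (metis in_set_conv_nth in_set_takeD n_def)
    then show "y \<in> (\<lambda>i. xs ! i) ` I" using y by (cases i) (auto simp: I_def w_def)
  qed
  have "card {y \<in> S. y \<noteq> w \<and> R w y} \<le> a - 1"
  proof (rule ccontr)
    assume "\<not> ?thesis"
    then have "a \<le> card {y \<in> S. y \<noteq> w \<and> R w y}" by simp
    also have "\<dots> \<le> card I" using surj_card_le[OF finI nb] .
    finally obtain J where J: "J \<subseteq> I" "card J = a" "finite J" by (rule obtain_subset_with_card_n)
    define W where "W = (\<lambda>i. xs ! (i - 1)) ` J"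
    have injJ: "inj_on (\<lambda>i. xs ! (i - 1)) J"
    proof (rule inj_onI)
      fix i j assume h: "i \<in> J" "j \<in> J" "xs ! (i - 1) = xs ! (j - 1)"
      then have "0 < i" "i < n" "0 < j" "j < n" using J(1) by (auto simp: I_def)
      then have "i - 1 = j - 1"
        using h(3) nth_eq_iff_index_eq[OF dx, of "i - 1" "j - 1"] by (simp add: n_def)
      then show "i = j" using \<open>0 < i\<close> \<open>0 < j\<close> by simp
    qed
    have cW: "card W = a" unfolding W_def using J(2) injJ by (simp add: card_image)
    have finW: "finite W" using J(3) by (simp add: W_def)
    have WP0: "W \<subseteq> P0"
    proof
      fix v assume "v \<in> W"
      then obtain i where i: "i \<in> J" "v = xs ! (i - 1)" by (auto simp: W_def)
      then have "i - 1 < 2 * b" "i - 1 < n" using I2[of i] J(1) by (auto simp: I_def)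
      then have "take (2 * b) xs ! (i - 1) = v" "i - 1 < length (take (2 * b) xs)"
        using i by (auto simp: n_def)
      then show "v \<in> P0" unfolding P0_def using nth_mem by metis
    qed
    have WZ: "\<not> R v z" if "v \<in> W" "z \<in> Z" for v z
    proof -
      obtain i where i: "i \<in> J" "v = xs ! (i - 1)" using \<open>v \<in> W\<close> by (auto simp: W_def)
      then have ii: "0 < i" "i < n" "R w (xs ! i)" "i < 2 * b" using J(1) I2 by (auto simp: I_def)
      \<comment> \<open>Rotation: reversing the part before the neighbour \<open>xs ! i\<close> of
        \<open>w\<close> gives a longest path that starts at \<open>v\<close>. Since
        \<open>i < 2 * b\<close>, its first \<open>2 * b\<close> vertices again form
        \<open>P0\<close>.\<close>
      define ys where "ys = rev (take i xs) @ drop i xs"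
      have tne: "take i xs \<noteq> []" "drop i xs \<noteq> []" using ii n0 by (auto simp: n_def)
      have "successively R (take i xs)" "successively R (drop i xs)"
        using xs successively_append_iff[of R "take i xs" "drop i xs"] by (auto simp: Pth_def)
      then have "successively R (rev (take i xs))"
        using pth_rev[OF sy, of "take i xs"] tne dx by (auto simp: pth_def)
      moreover have "last (rev (take i xs)) = w" using tne by (simp add: last_rev hd_conv_nth w_def)
      moreover have "hd (drop i xs) = xs ! i" using ii by (simp add: hd_drop_conv_nth n_def)
      ultimately have sucy: "successively R ys"
        using ii(3) \<open>successively R (drop i xs)\<close> tne by (auto simp: ys_def successively_append_iff)
      have disy: "distinct ys" using dx
        by (metis append_take_drop_id distinct_append distinct_rev set_rev ys_def)
      have sety: "set ys = set xs" unfolding ys_def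
        by (metis append_take_drop_id set_append set_rev)
      have py: "Pth ys" using sucy disy sety xsS tne by (auto simp: Pth_def ys_def)
      have ly: "length ys = n" using ii by (simp add: ys_def n_def)
      have y0: "ys ! 0 = v" using ii i tne
        by (simp add: ys_def nth_append rev_nth n_def)
      have "set (take (2 * b) ys) = P0"
      proof -
        have "take (2 * b) xs = take i xs @ take (2 * b - i) (drop i xs)"
          using ii(4) by (metis le_add_diff_inverse less_imp_le_nat take_add)
        moreover have "take (2 * b) ys = rev (take i xs) @ take (2 * b - i) (drop i xs)"
          using ii(2,4) by (simp add: ys_def n_def)
        ultimately show ?thesis by (simp add: P0_def)
      qed
      then show ?thesis using far[OF py ly, of z] that(2) y0 by (auto simp: Z_def)
    qed
    have WZd: "Z \<inter> W = {}" using WP0 by (auto simp: Z_def)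
    have ZWB: "\<not> R z v" if "z \<in> Z" "v \<in> W" for z v using WZ[OF that(2,1)] sympD[OF sy] by blast
    have cliqueZ: "complete_on R Z"
      unfolding complete_on_def
    proof (intro ballI impI, rule ccontr)
      fix z z' assume z: "z \<in> Z" "z' \<in> Z" "z \<noteq> z'" "\<not> R z z'"
      have "has_cycle (\<lambda>x y. \<not> R x y) (Z \<union> W) (2 * a + 1)"
        by (rule bip_odd_cycle[OF finZ finW WZd syB ZWB z]) (use cZ cW ab in auto)
      then have "has_cycle (\<lambda>x y. \<not> R x y) S (2 * a + 1)"
        by (rule has_cycle_mono) (use WP0 P0S in \<open>auto simp: Z_def\<close>)
      then show False using noB by auto
    qed
    \<comment> \<open>A vertex outside \<open>W\<close> and \<open>Z\<close> can miss at most one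
      vertex of \<open>Z\<close>; two missed vertices would close an even cycle in the complement
      that is longer than \<open>2 * a\<close>.\<close>
    have one: "R y z \<or> R y z'" if y: "y \<in> S" "y \<notin> W" "y \<notin> Z" and z: "z \<in> Z" "z' \<in> Z" "z \<noteq> z'" for y z z'
    proof (rule ccontr)
      assume h: "\<not> ?thesis"
      have "has_cycle (\<lambda>x y. \<not> R x y) (insert y (Z \<union> W)) (2 * a + 2)"
        by (rule bip_extra_cycle[OF finZ finW WZd syB ZWB z y(3,2)]) (use h cZ cW ab in auto)
      then have "has_cycle (\<lambda>x y. \<not> R x y) S (2 * a + 2)"
        by (rule has_cycle_mono) (use WP0 P0S y in \<open>auto simp: Z_def\<close>)
      then show False using noB by auto
    qed
    \<comment> \<open>The last index of \<open>P0\<close>. The set \<open>W\<close> consists of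
      predecessors of vertices in \<open>P0\<close>, so it cannot contain
      \<open>xs ! m\<close>.\<close>
    define m where "m = min (2 * b) n - 1"
    have m: "m < n" "m < 2 * b" using n0 b1 by (auto simp: m_def)
    have mP0: "xs ! i \<in> P0" if "i \<le> m" for i
    proof -
      have "take (2 * b) xs ! i = xs ! i" "i < length (take (2 * b) xs)" using m that by (auto simp: n_def)
      then show ?thesis unfolding P0_def using nth_mem by metis
    qed
    have mW: "xs ! m \<notin> W"
    proof
      assume "xs ! m \<in> W"
      then obtain i where i: "i \<in> J" "xs ! m = xs ! (i - 1)" by (auto simp: W_def)
      then have "0 < i" "i < n" "i < 2 * b" using J(1) I2 by (auto simp: I_def)
      moreover have "m = i - 1"
        using i(2) m \<open>i < n\<close> nth_eq_iff_index_eq[OF dx, of m "i - 1"] by (simp add: n_def)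
      ultimately show False by (auto simp: m_def)
    qed
    have S0: "xs ! i \<in> S" "xs ! i \<notin> Z" if "i \<le> m" for i using mP0[OF that] P0S by (auto simp: Z_def)
    obtain z where z: "z \<in> Z" "R (xs ! m) z"
      using pick_except_one[OF finZ, of "\<lambda>z. R (xs ! m) z"] one[OF S0(1) mW S0(2)] cZ by auto
    show False
    proof (cases "n \<le> 2 * b")
      case True
      then have Zx: "z \<notin> set xs" using z(1) by (simp add: Z_def P0_def n_def)
      have "last xs = xs ! m" using True n0 by (auto simp: m_def n_def last_conv_nth)
      then have "Pth (xs @ [z])"
        using xs Zx z by (auto simp: Pth_def successively_append_iff Z_def)
      from max[OF this] show False by simp
    next
      case False
      then have m2: "m = 2 * b - 1" by (simp add: m_def)
      \<comment> \<open>\<open>W\<close> has only \<open>a\<close> vertices, so an early vertex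
        avoids it. The segment from \<open>f\<close> to \<open>m\<close> and all of \<open>Z\<close>
        then form a cycle of length at least \<open>(2 * b - a) + (2 * a - b + 2)\<close>, which
        exceeds \<open>2 * b\<close>.\<close>
      obtain f where f: "f \<le> m" "f \<le> a" "xs ! f \<notin> W"
      proof (cases "a \<le> m")
        case True
        have "\<exists>f\<le>a. xs ! f \<notin> W"
        proof (rule ccontr)
          assume "\<not> ?thesis"
          then have "(\<lambda>i. xs ! i) ` {..a} \<subseteq> W" by auto
          moreover have "inj_on (\<lambda>i. xs ! i) {..a}"
            using True m dx by (auto simp: inj_on_def nth_eq_iff_index_eq n_def)
          ultimately have "card {..a} \<le> card W" using finW by (metis card_inj_on_le)
          then show False using cW by simp
        qed
        then show ?thesis using that True by auto
      next
        case False
        then show ?thesis using that[of m] mW by auto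
      qed
      have "card (Z - {z}) \<ge> 2" using cZ ab z(1) finZ by simp
      then obtain z' where z': "z' \<in> Z - {z}" "R (xs ! f) z'"
        using pick_except_one[of "Z - {z}" "\<lambda>z. R (xs ! f) z"] one[OF S0(1)[OF f(1)] f(3) S0(2)[OF f(1)]] finZ by auto
      obtain ps where ps: "pth R ps z z'" "set ps \<subseteq> Z" "length ps = card Z"
        using clique_path[OF finZ cliqueZ sy z(1), of z' "card Z"] z' cZ by auto
      define sg where "sg = drop f (take (2 * b) xs)"
      have lsg: "length sg = 2 * b - f" using False f m2 by (simp add: sg_def n_def)
      have sgne: "sg \<noteq> []" using lsg f m2 b1 by auto
      have sgP: "set sg \<subseteq> P0" by (auto simp: sg_def P0_def dest: in_set_dropD)
      have psg: "pth R sg (xs ! f) (xs ! m)"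
      proof -
        have "successively R (take (2 * b) xs)"
          using xs successively_append_iff[of R "take (2 * b) xs" "drop (2 * b) xs"] by (auto simp: Pth_def)
        then have "successively R sg"
          using successively_append_iff[of R "take f (take (2 * b) xs)" sg] by (simp add: sg_def del: take_take)
        moreover have "hd sg = xs ! f" using False f m2 sgne by (auto simp: sg_def hd_drop_conv_nth n_def)
        moreover have "last sg = xs ! m"
          using sgne m2 False f b1 by (simp add: last_conv_nth lsg) (simp add: sg_def n_def)
        moreover have "distinct sg" using dx by (simp add: sg_def)
        ultimately show ?thesis using sgne by (simp add: pth_def)
      qed
      have pc: "pth R (sg @ ps) (xs ! f) z'"
        by (rule pth_append[OF psg ps(1) _ z(2)]) (use sgP ps(2) in \<open>auto simp: Z_def\<close>)
      have "3 \<le> card Z" using cZ ab by linarith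
      then have "has_cycle R S (length sg + card Z)"
        using ps sgP P0S sympD[OF sy z'(2)] by (intro has_cycle_close[OF pc]) (auto simp: Z_def)
      moreover have "length sg + card Z > 2 * b" using lsg cZ f ab m2 by linarith
      ultimately show False using noR by blast
    qed
  qed
  then show ?thesis using wS by blast
qed


text \<open>If the long cycle that avoids \<open>w\<close> cannot absorb \<open>w\<close>, or
  \<open>w\<close> together with one more vertex, then \<open>b + 1\<close> cycle vertices are
  joined in the complement to \<open>b + 1\<close> vertices off the cycle. That biclique contains a
  forbidden cycle of length \<open>2 * b + 2\<close>.\<close>

lemma circumference_step:
  assumes sy: "symp R" and fin: "finite S" and card: "2 * a + b + 2 \<le> card S"
    and ab: "2 \<le> a" "b \<le> a" "a \<le> Suc b"
    and w: "w \<in> S" "card {y \<in> S. y \<noteq> w \<and> \<not> R w y} \<le> a - 1"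
    and D: "has_cycle R (S - {w}) L" "L \<ge> 2 * a - 1"
    and noR: "\<And>n. n > 2 * a \<Longrightarrow> \<not> has_cycle R S n"
    and noB: "\<And>n. n > 2 * b \<Longrightarrow> \<not> has_cycle (\<lambda>x y. \<not> R x y) S n"
  shows False
proof -
  obtain x where x: "cyf R x L" and xS: "range x \<subseteq> S - {w}" using has_cycle_cyf[OF D(1)] by blast
  note syB = symp_not[OF sy]
  have Lle: "L \<le> 2 * a" using noR[of L] has_cycle_mono[OF D(1), of S] by fastforce
  have wx: "w \<notin> range x" using xS by auto
  have L3: "L \<ge> 3" using x by (simp add: cyf_def)
  define N where "N = {i. i < L \<and> \<not> R w (x i)}"
  define O1 where "O1 = {y \<in> S - {w} - range x. \<not> R w y}"
  have finN: "finite N" by (simp add: N_def)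
  have finO1: "finite O1" using fin by (simp add: O1_def)
  have injN: "inj_on x N" using x by (auto simp: cyf_def N_def intro: inj_on_subset)
  have NO: "card N + card O1 \<le> a - 1"
  proof -
    have "card (x ` N \<union> O1) = card N + card O1"
      using finN finO1 injN by (subst card_Un_disjoint) (auto simp: card_image O1_def)
    moreover have "x ` N \<union> O1 \<subseteq> {y \<in> S. y \<noteq> w \<and> \<not> R w y}"
      using xS by (auto simp: N_def O1_def)
    then have "card (x ` N \<union> O1) \<le> card {y \<in> S. y \<noteq> w \<and> \<not> R w y}"
      using fin by (intro card_mono) auto
    ultimately show ?thesis using w(2) by linarith
  qed
  \<comment> \<open>On a cycle of length \<open>2 * a\<close>, \<open>w\<close> misses at most
    \<open>a - 1\<close> vertices, so it has two consecutive neighbours and can be inserted.\<close>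
  have LL: "L = 2 * a - 1"
  proof (rule ccontr)
    assume "L \<noteq> 2 * a - 1"
    then have L: "L = 2 * a" using Lle D(2) by linarith
    define X where "X = {..<L} - N"
    have "card X = L - card N" unfolding X_def using finN by (subst card_Diff_subset) (auto simp: N_def)
    then have "L < 2 * card X" using NO L ab by linarith
    then obtain i where i: "i \<in> X" "Suc i mod L \<in> X"
      using consecutive_in_cycle[of X L] by (auto simp: X_def)
    then have "R w (x i)" "R w (x (Suc i mod L))" by (auto simp: X_def N_def)
    then have "R w (x i)" "R w (x (Suc i))" using cyf_mod[OF x] by auto
    then have "has_cycle R (insert w (range x)) (L + 1)" by (rule ear1[OF sy x wx])
    then have "has_cycle R S (L + 1)" by (rule has_cycle_mono) (use w xS in auto)
    then show False using noR[of "L + 1"] L by simp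
  qed
  define Out where "Out = S - {w} - range x"
  have finOut: "finite Out" using fin by (simp add: Out_def)
  have cOut: "card Out \<ge> b + 2"
  proof -
    have "card Out = card (S - {w}) - card (range x)"
      unfolding Out_def using xS fin by (intro card_Diff_subset) (auto intro: finite_subset)
    then show ?thesis using cyf_card_range[OF x] card w(1) fin LL ab by simp
  qed
  have O1Out: "O1 \<subseteq> Out" by (auto simp: O1_def Out_def)
  \<comment> \<open>The shift by one is deliberate: for \<open>i\<close> in \<open>M\<close>, an
    edge from an outer neighbour \<open>u\<close> of \<open>w\<close> to \<open>x i\<close> gives
    the detour \<open>x i\<close>, \<open>u\<close>, \<open>w\<close>,
    \<open>x (Suc i)\<close>.\<close>
  define M where "M = {i. i < L \<and> R w (x (Suc i))}"
  have finM: "finite M" by (simp add: M_def)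
  have cM: "card M \<ge> L - card N"
  proof -
    have "(\<lambda>i. Suc i mod L) ` ({..<L} - M) \<subseteq> N"
      using L3 cyf_mod[OF x] by (auto simp: M_def N_def)
    moreover have "inj_on (\<lambda>i. Suc i mod L) ({..<L} - M)"
      by (rule inj_onI) (auto simp: mod_Suc split: if_splits)
    ultimately have "card ({..<L} - M) \<le> card N" using card_inj_on_le finN by blast
    moreover have "card ({..<L} - M) = L - card M"
      using finM by (subst card_Diff_subset) (auto simp: M_def)
    ultimately show ?thesis by linarith
  qed
  have contr: False if "has_cycle R (insert u (insert w (range x))) (L + 2)" "u \<in> Out" for u
  proof -
    have "has_cycle R S (L + 2)" by (rule has_cycle_mono[OF that(1)]) (use w xS that(2) in \<open>auto simp: Out_def\<close>)
    then show False using noR[of "L + 2"] LL ab by simp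
  qed
  have jump: "\<not> R u (x i)" if "u \<in> Out" "R w u" "R w (x (Suc i))" for u i
  proof
    assume "R u (x i)"
    then have "has_cycle R (insert u (insert w (range x))) (L + 2)"
      using that wx sympD[OF sy that(2)] by (intro ear2[OF sy x]) (auto simp: Out_def)
    then show False using contr that(1) by blast
  qed
  have jump': "\<not> R u (x (Suc i))" if "u \<in> Out" "R w u" "R w (x i)" for u i
  proof
    assume "R u (x (Suc i))"
    then have "has_cycle R (insert w (insert u (range x))) (L + 2)"
      using that wx by (intro ear2[OF sy x]) (auto simp: Out_def)
    then show False using contr[of u] that(1) by (simp add: insert_commute)
  qed
  have cross: "\<not> (R u (x i) \<and> R u (x j))" if "u \<in> Out" "i \<in> M" "j \<in> M" "i \<noteq> j" for u i j
  proof -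
    have *: "\<not> (R u (x i) \<and> R u (x j))" if "u \<in> Out" "i \<in> M" "j \<in> M" "i < j" for i j
    proof
      assume "R u (x i) \<and> R u (x j)"
      then have "has_cycle R (insert u (insert w (range x))) (L + 2)"
        using that wx by (intro crossing[OF sy x, of u w i j]) (auto simp: Out_def M_def)
      then show False using contr that(1) by blast
    qed
    show ?thesis using *[of i j] *[of j i] that by (cases "i < j") auto
  qed
  have big: False if Q: "Q \<subseteq> {..<L}" "card Q \<ge> b + 1" and P: "P \<subseteq> Out" "card P \<ge> b + 1"
    and PQ: "\<And>u i. u \<in> P \<Longrightarrow> i \<in> Q \<Longrightarrow> \<not> R u (x i)" for P Q
  proof -
    have finQ: "finite Q" using Q(1) finite_subset by blast
    have "card (x ` Q) = card Q"
      using x Q(1) by (intro card_image) (auto simp: cyf_def intro: inj_on_subset)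
    then have "has_cycle (\<lambda>x y. \<not> R x y) (P \<union> x ` Q) (2 * (b + 1))"
      using P Q PQ finQ finOut ab by (intro bip_even_cycle[OF _ _ _ syB]) (auto intro: finite_subset simp: Out_def)
    then have "has_cycle (\<lambda>x y. \<not> R x y) S (2 * (b + 1))"
      by (rule has_cycle_mono) (use P(1) xS in \<open>auto simp: Out_def\<close>)
    then show False using noB[of "2 * (b + 1)"] by simp
  qed
  show False
  proof (cases "O1 = {}")
    case False
    then obtain u0 where u0: "u0 \<in> O1" by blast
    \<comment> \<open>Each vertex of \<open>O1\<close> spoils at most one index of \<open>M\<close>,
      by \<open>cross\<close>. Leaving out \<open>u0\<close> saves one of them, so at least
      \<open>a + 1\<close> indices survive, while \<open>Out - {u0}\<close> still has
      \<open>b + 1\<close> vertices.\<close>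
    define B where "B = (\<Union>u\<in>O1 - {u0}. {i \<in> M. R u (x i)})"
    have "card {i \<in> M. R u (x i)} \<le> 1" if "u \<in> O1" for u
    proof -
      have "u \<in> Out" using that O1Out by blast
      then have "i = j" if "i \<in> {i \<in> M. R u (x i)}" "j \<in> {i \<in> M. R u (x i)}" for i j
        using cross[of u i j] that by blast
      then show ?thesis using finM by (simp add: card_le_Suc0_iff_eq)
    qed
    then have "card B \<le> (\<Sum>u\<in>O1 - {u0}. 1)"
      unfolding B_def using finO1 by (intro order_trans[OF card_UN_le] sum_mono) auto
    then have cB: "card B \<le> card O1 - 1" using u0 finO1 by simp
    have "card O1 \<ge> 1" using u0 finO1 by (metis One_nat_def Suc_leI card_gt_0_iff empty_iff)
    have "card (M - B) \<ge> card M - card B" by (rule diff_card_le_card_Diff) (auto simp: B_def finO1 finM)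
    then have "card (M - B) \<ge> b + 1" using cM cB NO LL ab \<open>card O1 \<ge> 1\<close> by linarith
    moreover have "card (Out - {u0}) \<ge> b + 1" using cOut finOut u0 O1Out by auto
    moreover have "\<not> R u (x i)" if "u \<in> Out - {u0}" "i \<in> M - B" for u i
    proof (cases "u \<in> O1")
      case True then show ?thesis using that by (auto simp: B_def)
    next
      case False
      then have "R w u" using that by (auto simp: O1_def Out_def)
      then show ?thesis using jump[of u i] that by (auto simp: M_def)
    qed
    ultimately show False using big[of "M - B" "Out - {u0}"] by (auto simp: M_def)
  next
    case True
    have wu: "R w u" if "u \<in> Out" for u using True that by (auto simp: O1_def Out_def)
    show False
    proof (cases "card M \<ge> b + 1")
      case True
      then show False
        using big[of M Out] cOut jump wu by (auto simp: M_def)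
    next
      case False
      then have Lb: "L - card N \<le> b" using cM by linarith
      then have ba: "b = a" using NO LL ab by linarith
      then have "card N \<ge> a - 1" using Lb LL ab by linarith
      then have "card N = a - 1" using NO by linarith
      note ba = ba this
      define Pr where "Pr j \<longleftrightarrow> \<not> R w (x j)" for j
      \<comment> \<open>Now \<open>M\<close> has exactly \<open>a = b\<close> indices and one more
        is needed: \<open>i + 1\<close>, where \<open>w\<close> sees \<open>x i\<close> but not
        \<open>x (i + 2)\<close>. If no such \<open>i\<close> existed, non-neighbours of
        \<open>w\<close> would spread backwards in steps of two and, the length being odd, fill the
        cycle.\<close>
      have "\<exists>i. Pr (Suc (Suc i)) \<and> \<not> Pr i"
      proof (rule ccontr)
        assume "\<not> ?thesis"
        then have st: "Pr (Suc (Suc i)) \<Longrightarrow> Pr i" for i by blast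
        have st2: "Pr (i + 2 * t) \<Longrightarrow> Pr i" for i t
          by (induction t) (use st in auto)
        have "N \<noteq> {}" using ba ab by auto
        then obtain j0 where j0: "Pr j0" by (auto simp: N_def Pr_def)
        have per: "Pr (j + L * t) \<longleftrightarrow> Pr j" for j t
          by (simp add: Pr_def) (metis cyf_mod[OF x] mod_mult_self2)
        have "Pr j" for j
        proof -
          have odd: "odd L" using LL ab by auto
          define t where "t = (if even (j0 + L * j - j) then j else Suc j)"
          have le: "j \<le> j0 + L * j" using L3 by (cases L) auto
          have "even (j0 + L * t - j)" "j \<le> j0 + L * t"
            using odd le by (auto simp: t_def)
          then obtain s where "j0 + L * t = j + 2 * s" by (metis dvd_def le_add_diff_inverse)
          then show ?thesis using st2[of j s] per[of j0 t] j0 by simp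
        qed
        then have "N = {..<L}" by (auto simp: N_def Pr_def)
        then show False using ba LL ab by simp
      qed
      then obtain i where i: "\<not> R w (x (Suc (Suc i)))" "R w (x i)" by (auto simp: Pr_def)
      define q where "q = Suc i mod L"
      have xq: "x q = x (Suc i)" unfolding q_def by (rule cyf_mod[OF x])
      have "x (Suc q) = x (Suc (Suc i))"
        unfolding q_def using cyf_eq_iff[OF x] by (simp add: mod_Suc_eq)
      then have qM: "q \<notin> M" using i(1) by (simp add: M_def)
      have "card (insert q M) \<ge> b + 1" using qM finM cM NO LL ba ab by simp
      moreover have "insert q M \<subseteq> {..<L}" using L3 by (auto simp: M_def q_def)
      moreover have "\<not> R u (x j)" if "u \<in> Out" "j \<in> insert q M" for u j
        using that jump[OF that(1) wu[OF that(1)]] jump'[OF that(1) wu[OF that(1)] i(2)] xq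
        by (auto simp: M_def)
      ultimately show False using big[of "insert q M" Out] cOut by auto
    qed
  qed
qed

text \<open>Starts the induction on \<open>a\<close>: for \<open>a = 2\<close> a triangle is already
  a cycle longer than \<open>2 * a - 2\<close>.\<close>

lemma ramsey_triangle:
  assumes "symp R" "finite S" "card S \<ge> 6"
  shows "has_cycle R S 3 \<or> has_cycle (\<lambda>x y. \<not> R x y) S 3"
proof -
  obtain v where v: "v \<in> S" using assms(3) by fastforce
  have main: "has_cycle Q S 3 \<or> has_cycle (\<lambda>x y. \<not> Q x y) S 3"
    if Q: "symp Q" "card {y \<in> S - {v}. Q v y} \<ge> 3" for Q
  proof -
    obtain T where T: "T \<subseteq> {y \<in> S - {v}. Q v y}" "card T = 3" "finite T"
      using obtain_subset_with_card_n[OF Q(2)] by metis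
    show ?thesis
    proof (cases "\<exists>y\<in>T. \<exists>z\<in>T. y \<noteq> z \<and> Q y z")
      case True
      then obtain y z where yz: "y \<in> T" "z \<in> T" "y \<noteq> z" "Q y z" by blast
      have "pth Q [v, y, z] v z" using yz T(1) by (auto simp: pth_def)
      then have "has_cycle Q S 3"
        using yz T(1) v by (intro has_cycle_close[of Q "[v, y, z]" v z]) (auto intro: sympD[OF Q(1)])
      then show ?thesis ..
    next
      case False
      then have "complete_on (\<lambda>x y. \<not> Q x y) T" by (auto simp: complete_on_def)
      then have "has_cycle (\<lambda>x y. \<not> Q x y) T 3"
        using T by (intro clique_cycle symp_not[OF Q(1)]) auto
      then have "has_cycle (\<lambda>x y. \<not> Q x y) S 3" by (rule has_cycle_mono) (use T in auto)
      then show ?thesis ..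
    qed
  qed
  have "card {y \<in> S - {v}. R v y} + card {y \<in> S - {v}. \<not> R v y} = card (S - {v})"
    using assms(2) by (subst card_Un_disjoint[symmetric]) (auto intro: arg_cong[of _ _ card])
  then have "card {y \<in> S - {v}. R v y} \<ge> 3 \<or> card {y \<in> S - {v}. \<not> R v y} \<ge> 3"
    using assms v by (simp add: card_Diff_singleton) linarith
  then show ?thesis using main[of R] main[OF symp_not[OF assms(1)]] assms(1) by auto
qed

text \<open>Removing the vertex of low degree costs one vertex, while the cycle needed in the rest
  may be shorter by two in one colour. Hence the induction alternates between equal bounds and
  bounds that differ by two; this is the second kind, reduced to the first kind for
  \<open>a - 1\<close>.\<close>

lemma circumference_unbalanced:
  assumes a: "2 \<le> a" and R: "symp R" "finite S" "3 * a + 1 \<le> card S"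
    and IH: "\<And>S'. S' \<subseteq> S \<Longrightarrow> 3 * a \<le> card S' \<Longrightarrow>
      \<exists>n > 2 * a - 2. has_cycle R S' n \<or> has_cycle (\<lambda>x y. \<not> R x y) S' n"
  shows "(\<exists>n > 2 * a. has_cycle R S n) \<or> (\<exists>n > 2 * a - 2. has_cycle (\<lambda>x y. \<not> R x y) S n)"
proof (rule ccontr)
  assume n: "\<not> ?thesis"
  have b: "2 * (a - 1) = 2 * a - 2" by simp
  have "\<exists>w\<in>S. card {y \<in> S. y \<noteq> w \<and> \<not> R w y} \<le> a - 1"
    by (rule low_degree_vertex[OF symp_not[OF R(1)] R(2), where b = "a - 1"]) (use n a R(3) in auto)
  then obtain w where w: "w \<in> S" "card {y \<in> S. y \<noteq> w \<and> \<not> R w y} \<le> a - 1" by blast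
  have "3 * a \<le> card (S - {w})" using R w by simp
  then obtain m where m: "m > 2 * a - 2" "has_cycle R (S - {w}) m \<or> has_cycle (\<lambda>x y. \<not> R x y) (S - {w}) m"
    using IH[of "S - {w}"] by blast
  have "\<not> has_cycle (\<lambda>x y. \<not> R x y) (S - {w}) m" using n m(1) has_cycle_mono[of _ "S - {w}" m S] by blast
  then have D: "has_cycle R (S - {w}) m" using m(2) by blast
  show False
    by (rule circumference_step[OF R(1,2) _ a _ _ w D, of "a - 1"]) (use n a R(3) m(1) in auto)
qed

text \<open>The other half of the alternation: it is reduced to the unbalanced statement for the
  same \<open>a\<close> with the colours exchanged.\<close>

lemma circumference_balanced:
  assumes a: "2 \<le> a" and R: "symp R" "finite S" "3 * a + 2 \<le> card S"
    and IH: "\<And>S'. S' \<subseteq> S \<Longrightarrow> 3 * a + 1 \<le> card S' \<Longrightarrow>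
      (\<exists>n > 2 * a. has_cycle (\<lambda>x y. \<not> R x y) S' n) \<or> (\<exists>n > 2 * a - 2. has_cycle R S' n)"
  shows "\<exists>n > 2 * a. has_cycle R S n \<or> has_cycle (\<lambda>x y. \<not> R x y) S n"
proof (rule ccontr)
  assume n: "\<not> ?thesis"
  have "\<exists>w\<in>S. card {y \<in> S. y \<noteq> w \<and> \<not> R w y} \<le> a - 1"
    by (rule low_degree_vertex[OF symp_not[OF R(1)] R(2), where b = a]) (use n a R(3) in auto)
  then obtain w where w: "w \<in> S" "card {y \<in> S. y \<noteq> w \<and> \<not> R w y} \<le> a - 1" by blast
  have "3 * a + 1 \<le> card (S - {w})" using R w by simp
  then have "(\<exists>n > 2 * a. has_cycle (\<lambda>x y. \<not> R x y) (S - {w}) n) \<or> (\<exists>n > 2 * a - 2. has_cycle R (S - {w}) n)"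
    using IH[of "S - {w}"] by blast
  moreover have "\<not> (\<exists>n > 2 * a. has_cycle (\<lambda>x y. \<not> R x y) (S - {w}) n)"
    using n has_cycle_mono[of _ "S - {w}" _ S] by blast
  ultimately obtain m where m: "m > 2 * a - 2" and D: "has_cycle R (S - {w}) m" by blast
  show False
    by (rule circumference_step[OF R(1,2) _ a _ _ w D, of a]) (use n a R(3) m(1) in auto)
qed

lemma circumference_aux:
  assumes "2 \<le> a"
  shows "\<forall>R S. symp R \<longrightarrow> finite (S::'a set) \<longrightarrow> 3 * a + 2 \<le> card S \<longrightarrow>
      (\<exists>n > 2 * a. has_cycle R S n \<or> has_cycle (\<lambda>x y. \<not> R x y) S n)"
  using assms
proof (induction a rule: less_induct)
  case (less a)
  have E2: "(\<exists>n > 2 * a. has_cycle R S n) \<or> (\<exists>n > 2 * a - 2. has_cycle (\<lambda>x y. \<not> R x y) S n)"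
    if R: "symp R" "finite S" "3 * a + 1 \<le> card S" for R and S :: "'a set"
  proof (rule circumference_unbalanced[OF less.prems R])
    fix S' assume S': "S' \<subseteq> S" "3 * a \<le> card S'"
    then have fin: "finite S'" using R(2) finite_subset by blast
    show "\<exists>n > 2 * a - 2. has_cycle R S' n \<or> has_cycle (\<lambda>x y. \<not> R x y) S' n"
    proof (cases "a = 2")
      case True
      then show ?thesis using ramsey_triangle[OF R(1) fin] S'(2) by (intro exI[of _ 3]) auto
    next
      case False
      have e: "2 * (a - 1) = 2 * a - 2" by simp
      have "3 * (a - 1) + 2 \<le> card S'" using S'(2) less.prems by linarith
      then show ?thesis using less.IH[of "a - 1", unfolded e] False less.prems R(1) fin by auto
    qed
  qed
  show ?case
  proof (intro allI impI)
    fix R :: "'a \<Rightarrow> 'a \<Rightarrow> bool" and S :: "'a set"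
    assume R: "symp R" "finite S" "3 * a + 2 \<le> card S"
    show "\<exists>n > 2 * a. has_cycle R S n \<or> has_cycle (\<lambda>x y. \<not> R x y) S n"
    proof (rule circumference_balanced[OF less.prems R])
      fix S' assume S': "S' \<subseteq> S" "3 * a + 1 \<le> card S'"
      then have "finite S'" using R(2) finite_subset by blast
      then show "(\<exists>n > 2 * a. has_cycle (\<lambda>x y. \<not> R x y) S' n) \<or> (\<exists>n > 2 * a - 2. has_cycle R S' n)"
        using E2[OF symp_not[OF R(1)], of S'] S'(2) by simp
    qed
  qed
qed

lemma circumference:
  assumes "symp R" "finite S" "2 \<le> a" "3 * a + 2 \<le> card S"
  shows "\<exists>n > 2 * a. has_cycle R S n \<or> has_cycle (\<lambda>x y. \<not> R x y) S n"
  using circumference_aux[OF assms(3)] assms by blast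

section \<open>Shortening monochromatic cycles\<close>

lemma skip_one:
  assumes "cyf R x L" "L \<ge> 4" "R (x i) (x (i + 2))"
  shows "has_cycle R (range x) (L - 1)"
proof -
  have p: "pth R (map x [i + 2..<i + L + 1]) (x (i + 2)) (x i)"
    using arc[OF assms(1), of "i + 2" "i + L + 1"] assms(1,2) by (simp add: cyf_def)
  show ?thesis
    by (rule has_cycle_close[OF p assms(3)]) (use assms(2) in auto)
qed

text \<open>The new cycle omits only \<open>x (j + 1)\<close>: it runs backwards from
  \<open>x j\<close> to \<open>x (i + 1)\<close>, takes the second chord to
  \<open>x (j + 2)\<close>, continues to \<open>x i\<close> and returns by the first chord.\<close>

lemma crossing_chords:
  assumes "symp R" "cyf R x L" "L \<ge> 4" "i < j" "j + 2 \<le> i + L" "R (x i) (x j)" "R (x (i + 1)) (x (j + 2))"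
  shows "has_cycle R (range x) (L - 1)"
proof -
  have a1: "pth R (map x [i + 1..<j + 1]) (x (i + 1)) (x j)"
    using arc[OF assms(2), of "i + 1" "j + 1"] assms(4,5) by simp
  have a2: "pth R (map x [j + 2..<i + L + 1]) (x (j + 2)) (x i)"
    using arc[OF assms(2), of "j + 2" "i + L + 1"] assms(2,4,5) by (simp add: cyf_def)
  have dj: "set (rev (map x [i + 1..<j + 1])) \<inter> set (map x [j + 2..<i + L + 1]) = {}"
    unfolding set_rev by (rule arcs_disjoint[OF assms(2)]) (use assms(4,5) in auto)
  have p: "pth R (rev (map x [i + 1..<j + 1]) @ map x [j + 2..<i + L + 1]) (x j) (x i)"
    by (rule pth_append[OF pth_rev[OF assms(1) a1] a2 dj assms(7)])
  show ?thesis
    by (rule has_cycle_close[OF p assms(6)]) (use assms(3-5) in auto)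
qed

text \<open>If no cycle of length \<open>2 * l\<close> exists, then chords of length 2 have the other colour; they form a
  second cycle of length \<open>2 * l + 1\<close>, and the same argument there fixes the colours of the chords of
  length 4, 3 and 5 inconsistently.\<close>
lemma shorten_odd_cycle:
  assumes sy: "symp R" and x: "cyf R x (2 * l + 1)" and l: "l \<ge> 3"
  shows "has_cycle R (range x) (2 * l) \<or> has_cycle (\<lambda>x y. \<not> R x y) (range x) (2 * l)"
proof (rule ccontr)
  assume n: "\<not> ?thesis"
  define L where "L = 2 * l + 1"
  note xL = x[folded L_def]
  note syB = symp_not[OF sy]
  have L: "L \<ge> 4" "L - 1 = 2 * l" using l by (auto simp: L_def)
  have per: "x (i + L) = x i" for i using xL by (simp add: cyf_def)
  have s2: "\<not> R (x i) (x (i + 2))" for i using skip_one[OF xL L(1)] n L(2) by auto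
  \<comment> \<open>Doubling is a bijection modulo the odd number \<open>L\<close>, so the chords of
    length 2 form a single cycle through all vertices.\<close>
  define y where "y i = x (2 * i)" for i
  have y: "cyf (\<lambda>u v. \<not> R u v) y L"
    unfolding cyf_def
  proof (intro conjI allI)
    show "3 \<le> L" using L by simp
    show "y (i + L) = y i" for i
      using per[of "2 * i + L"] per[of "2 * i"] by (simp add: y_def algebra_simps)
    show "inj_on y {..<L}"
    proof (rule inj_onI)
      fix i j assume h: "i \<in> {..<L}" "j \<in> {..<L}" "y i = y j"
      then have m: "2 * i mod L = 2 * j mod L" using cyf_eq_iff[OF xL] by (simp add: y_def)
      have d: "2 * k mod L = (if k \<le> l then 2 * k else 2 * k - L)" if "k < L" for k
        using that by (auto simp: L_def mod_if)
      then have e: "(if i \<le> l then 2 * i else 2 * i - L) = (if j \<le> l then 2 * j else 2 * j - L)"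
        using m d[of i] d[of j] h by simp
      have 1: "2 * a - L = 2 * (a - l - 1) + 1" if "l < a" for a using that by (simp add: L_def)
      have 2: "2 * a \<noteq> 2 * b + 1" for a b :: nat by presburger
      show "i = j"
        using e 1[of i] 1[of j] 2[of i] 2[of j] by (cases "i \<le> l"; cases "j \<le> l") (simp_all, metis, metis)
    qed
    show "\<not> R (y i) (y (Suc i))" for i using s2[of "2 * i"] by (simp add: y_def)
  qed
  have ry: "range y \<subseteq> range x" by (auto simp: y_def)
  have ny: "\<not> has_cycle (\<lambda>u v. \<not> R u v) (range y) (L - 1)"
    using n L(2) has_cycle_mono[OF _ ry] by auto
  have "R (y i) (y (i + 2))" for i using skip_one[OF y L(1)] ny by blast
  then have "R (y i) (y (i + 2))" for i by blast
  moreover have "y (i + 2) = x (2 * i + 4)" for i by (simp only: y_def distrib_left) simp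
  ultimately have e4: "R (x (2 * i)) (x (2 * i + 4))" for i by (metis y_def)
  have s4: "R (x i) (x (i + 4))" for i
  proof (cases "even i")
    case True then show ?thesis using e4[of "i div 2"] by simp
  next
    case False
    then have "2 * ((i + L) div 2) = i + L" by (simp add: L_def)
    then show ?thesis using e4[of "(i + L) div 2"] per[of i] per[of "i + 4"] by (simp add: algebra_simps)
  qed
  \<comment> \<open>The chord from \<open>x 3\<close> to \<open>x 7\<close> has length 4 and thus
    colour \<open>R\<close>; the chord from \<open>x 4\<close> to \<open>x 9\<close> would cross it
    in the way that shortens the cycle.\<close>
  have s5: "\<not> R (x 4) (x 9)"
    using crossing_chords[OF sy xL L(1), of 3 7] s4[of 3] n L l by (auto simp: L_def)
  have s3: "\<not> R (x 2) (x 5)"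
  proof
    assume "R (x 2) (x 5)"
    then have "R (x 5) (x (L + 2))" using sympD[OF sy] per[of 2] by (simp add: add.commute)
    moreover have "R (x 4) (x L)" using sympD[OF sy s4[of 0]] per[of 0] by simp
    ultimately show False
      using crossing_chords[OF sy xL L(1), of 4 L] n L l by (auto simp: L_def)
  qed
  \<comment> \<open>Odd indices are reached on the second turn: \<open>2 * (l + 3) = L + 5\<close>
    and \<open>2 * (l + 5) = L + 9\<close>. The two chords excluded above thus become crossing
    chords of the cycle \<open>y\<close>.\<close>
  have y5: "y (l + 3) = x 5" using per[of 5] by (simp add: y_def L_def algebra_simps)
  have y9: "y (l + 5) = x 9" using per[of 9] by (simp add: y_def L_def algebra_simps)
  have h1: "1 < l + 3" "l + 3 + 2 \<le> 1 + L" using l by (simp_all add: L_def)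
  have h2: "\<not> R (y 1) (y (l + 3))" unfolding y5 using s3 by (simp add: y_def)
  have "l + 3 + 2 = l + 5" by simp
  then have "y (l + 3 + 2) = x 9" using y9 by metis
  moreover have "y (1 + 1) = x 4" by (simp add: y_def)
  ultimately have h3: "\<not> R (y (1 + 1)) (y (l + 3 + 2))" using s5 by metis
  from crossing_chords[OF syB y L(1) h1 h2 h3] ny show False by blast
qed

text \<open>Chords of length 2 have the other colour, since an \<open>R\<close>-chord would skip one
  vertex. So each parity class carries a cycle of the other colour, and further edges of that colour
  quickly link these two cycles into one of length \<open>2 * l - 1\<close>. \<open>E\<close> and
  \<open>F\<close> are the parity classes.\<close>

lemma shorten_even_cycle:
  assumes sy: "symp R" and x: "cyf R x (2 * l)" and l: "l \<ge> 3"
    and nR: "\<not> has_cycle R (range x) (2 * l - 1)" and nB: "\<not> has_cycle (\<lambda>x y. \<not> R x y) (range x) (2 * l - 1)"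
  obtains E F where "E \<inter> F = {}" "E \<union> F = range x" "card E = l" "card F = l"
    "complete_on (\<lambda>x y. \<not> R x y) E" "complete_on (\<lambda>x y. \<not> R x y) F"
    "\<And>e e' f f'. e \<in> E \<Longrightarrow> e' \<in> E \<Longrightarrow> f \<in> F \<Longrightarrow> f' \<in> F \<Longrightarrow> e \<noteq> e' \<Longrightarrow> f \<noteq> f' \<Longrightarrow> R e f \<or> R e' f'"
proof -
  define L where "L = 2 * l"
  note xL = x[folded L_def]
  note syB = symp_not[OF sy]
  have L: "L \<ge> 4" "L - 1 = 2 * l - 1" using l by (auto simp: L_def)
  have per: "x (i + L) = x i" for i using xL by (simp add: cyf_def)
  have s2: "\<not> R (x i) (x (i + 2))" for i using skip_one[OF xL L(1)] nR L(2) by auto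
  \<comment> \<open>An \<open>R\<close>-chord between \<open>x i\<close> and \<open>x j\<close>
    would force the crossing chords from \<open>x (i + 1)\<close> to \<open>x (j + 2)\<close> and
    from \<open>x (i - 1)\<close> to \<open>x (j - 2)\<close> into the other colour. They link the
    walk in steps of two through the class of \<open>i + 1\<close> to the walk through the class of
    \<open>j\<close> that omits \<open>x j\<close>: a cycle of length
    \<open>l + (l - 1)\<close>.\<close>
  have cl: "\<not> R (x i) (x j)" if c: "2 \<le> i" "i < j" "j < i + L" "even (j - i)" for i j
  proof
    assume Rij: "R (x i) (x j)"
    have j2: "j \<noteq> i + 2" using s2[of i] Rij by auto
    have jL: "j + 2 \<noteq> i + L" using s2[of j] sympD[OF sy Rij] per[of i] by auto
    have jj: "i + 4 \<le> j" "j + 4 \<le> i + L"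
    proof -
      obtain s where s: "j = i + 2 * s" using c(2,4) by (metis dvd_def le_add_diff_inverse less_imp_le_nat)
      have "s \<noteq> 0" "s \<noteq> 1" "s < l" "Suc s \<noteq> l" using j2 jL c s by (auto simp: L_def)
      then have "2 \<le> s" "Suc s < l" by simp_all
      then show "i + 4 \<le> j" "j + 4 \<le> i + L" unfolding L_def s by simp_all
    qed
    have b1: "\<not> R (x (i + 1)) (x (j + 2))"
      using crossing_chords[OF sy xL L(1), of i j] Rij nR L(2) jj by auto
    have b2: "\<not> R (x (i - 1)) (x (j - 2))"
    proof
      assume b: "R (x (i - 1)) (x (j - 2))"
      have "i - 1 + 1 = i" "j - 2 + 2 = j" using c(1) jj by simp_all
      then have "R (x (i - 1 + 1)) (x (j - 2 + 2))" using Rij by metis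
      moreover have "i - 1 < j - 2" "j - 2 + 2 \<le> i - 1 + L" using jj by simp_all
      ultimately show False using crossing_chords[OF sy xL L(1), of "i - 1" "j - 2"] b nR L(2) by metis
    qed
    have inj: "a + 2 * s = a + 2 * t" if "x (a + 2 * s) = x (a + 2 * t)" "s < l" "t < l" for a s t
      using inj_onD[OF cyf_inj_window[OF xL, of a] that(1)] that(2,3) by (auto simp: L_def)
    have pe: "pth (\<lambda>u v. \<not> R u v) (map (\<lambda>t. x (a + 2 * t)) [0..<m]) (x a) (x (a + 2 * (m - 1)))"
      if "0 < m" "m \<le> l" for a m
    proof -
      have "distinct (map (\<lambda>t. x (a + 2 * t)) [0..<m])"
        using inj[of a] that by (auto simp: distinct_map inj_on_def)
      moreover have "successively (\<lambda>u v. \<not> R u v) (map (\<lambda>t. x (a + 2 * t)) [0..<m])"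
        using s2 by (auto simp: successively_conv_nth)
      ultimately show ?thesis using that by (auto simp: pth_def last_map hd_map)
    qed
    have p1: "pth (\<lambda>u v. \<not> R u v) (map (\<lambda>t. x (i + 1 + 2 * t)) [0..<l]) (x (i + 1)) (x (i - 1))"
    proof -
      have "i + 1 + 2 * (l - 1) = (i - 1) + L" using l c(1) by (simp add: L_def)
      then show ?thesis using pe[of l "i + 1"] per[of "i - 1"] l by simp
    qed
    have p2: "pth (\<lambda>u v. \<not> R u v) (map (\<lambda>t. x (j + 2 + 2 * t)) [0..<l - 1]) (x (j + 2)) (x (j - 2))"
    proof -
      have "j + 2 + 2 * (l - 1 - 1) = (j - 2) + L" using l c by (simp add: L_def)
      then show ?thesis using pe[of "l - 1" "j + 2"] per[of "j - 2"] l by simp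
    qed
    have dj: "set (map (\<lambda>t. x (i + 1 + 2 * t)) [0..<l]) \<inter> set (rev (map (\<lambda>t. x (j + 2 + 2 * t)) [0..<l - 1])) = {}"
    proof -
      have "x (i + 1 + 2 * s) \<noteq> x (j + 2 + 2 * t)" for s t
      proof
        assume "x (i + 1 + 2 * s) = x (j + 2 + 2 * t)"
        then have "(i + 1 + 2 * s) mod L = (j + 2 + 2 * t) mod L" using cyf_eq_iff[OF xL] by blast
        then have "even (i + 1 + 2 * s) \<longleftrightarrow> even (j + 2 + 2 * t)"
          by (metis L_def dvd_mod_iff dvd_triv_left)
        then show False using c(2,4) by auto
      qed
      then show ?thesis by auto
    qed
    have p3: "pth (\<lambda>u v. \<not> R u v) (map (\<lambda>t. x (i + 1 + 2 * t)) [0..<l] @ rev (map (\<lambda>t. x (j + 2 + 2 * t)) [0..<l - 1])) (x (i + 1)) (x (j + 2))"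
      by (rule pth_append[OF p1 pth_rev[OF syB p2] dj b2])
    have "has_cycle (\<lambda>u v. \<not> R u v) (range x) (2 * l - 1)"
      by (rule has_cycle_close[OF p3]) (use b1 sympD[OF sy] l in auto)
    then show False using nB by blast
  qed
  define E where "E = (\<lambda>t. x (2 + 2 * t)) ` {..<l}"
  define F where "F = (\<lambda>t. x (3 + 2 * t)) ` {..<l}"
  have inj: "i = j" if "x i = x j" "2 \<le> i" "2 \<le> j" "i < 2 + L" "j < 2 + L" for i j
    using inj_onD[OF cyf_inj_window[OF xL, of 2] that(1)] that(2-) by auto
  have cE: "card E = l" unfolding E_def
    by (subst card_image) (auto simp: inj_on_def L_def dest: inj)
  have cF: "card F = l" unfolding F_def
    by (subst card_image) (auto simp: inj_on_def L_def dest: inj)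
  have EF: "E \<inter> F = {}"
  proof -
    have "x (2 + 2 * s) \<noteq> x (3 + 2 * t)" if "s < l" "t < l" for s t
      using inj[of "2 + 2 * s" "3 + 2 * t"] that by (auto simp: L_def) presburger
    then show ?thesis by (auto simp: E_def F_def)
  qed
  have finEF: "finite E" "finite F" by (auto simp: E_def F_def)
  have sub: "E \<union> F \<subseteq> range x" by (auto simp: E_def F_def)
  have "card (E \<union> F) = L" using card_Un_disjoint[OF finEF EF] cE cF by (simp add: L_def)
  then have U: "E \<union> F = range x"
    using card_subset_eq[OF cyf_finite_range[OF xL] sub] cyf_card_range[OF xL] by simp
  have clq: "complete_on (\<lambda>x y. \<not> R x y) ((\<lambda>t. x (c + 2 * t)) ` {..<l})" if c: "c \<ge> 2" for c
    unfolding complete_on_def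
  proof (intro ballI impI)
    fix u v assume uv: "u \<in> (\<lambda>t. x (c + 2 * t)) ` {..<l}" "v \<in> (\<lambda>t. x (c + 2 * t)) ` {..<l}" "u \<noteq> v"
    then obtain s t where st: "u = x (c + 2 * s)" "v = x (c + 2 * t)" "s < l" "t < l" "s \<noteq> t" by auto
    show "\<not> R u v"
    proof (cases "s < t")
      case True then show ?thesis using cl[of "c + 2 * s" "c + 2 * t"] st c by (auto simp: L_def)
    next
      case False
      then have "\<not> R v u" using cl[of "c + 2 * t" "c + 2 * s"] st c by (auto simp: L_def)
      then show ?thesis using sympD[OF sy] by blast
    qed
  qed
  have clE: "complete_on (\<lambda>x y. \<not> R x y) E" unfolding E_def by (rule clq) simp
  have clF: "complete_on (\<lambda>x y. \<not> R x y) F" unfolding F_def by (rule clq) simp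
  \<comment> \<open>Two disjoint cross edges of the other colour would join a path through all of
    \<open>E\<close> to a path through all but one vertex of \<open>F\<close>.\<close>
  have c7: "R e f \<or> R e' f'" if h: "e \<in> E" "e' \<in> E" "f \<in> F" "f' \<in> F" "e \<noteq> e'" "f \<noteq> f'" for e e' f f'
  proof (rule ccontr)
    assume c: "\<not> ?thesis"
    obtain ps where ps: "pth (\<lambda>x y. \<not> R x y) ps e e'" "set ps \<subseteq> E" "length ps = l"
      using clique_path[OF finEF(1) clE syB h(1,2,5), of l] cE l by auto
    obtain qs where qs: "pth (\<lambda>x y. \<not> R x y) qs f' f" "set qs \<subseteq> F" "length qs = l - 1"
      using clique_path[OF finEF(2) clF syB h(4,3), of "l - 1"] h(6) cF l by (metis One_nat_def Suc_1 diff_le_self diff_le_mono diff_Suc_1 numeral_3_eq_3)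
    have p: "pth (\<lambda>x y. \<not> R x y) (ps @ qs) e f"
      by (rule pth_append[OF ps(1) qs(1)]) (use ps qs EF c in auto)
    have "has_cycle (\<lambda>x y. \<not> R x y) (range x) (2 * l - 1)"
      by (rule has_cycle_close[OF p]) (use ps qs U c sympD[OF sy] l in auto)
    then show False using nB by blast
  qed
  show ?thesis by (rule that[OF EF U cE cF clE clF c7])
qed

section \<open>From long cycles to monochromatic bicliques\<close>

definition has_biclique :: "('a \<Rightarrow> 'a \<Rightarrow> bool) \<Rightarrow> 'a set \<Rightarrow> nat \<Rightarrow> bool" where
  "has_biclique R S k \<longleftrightarrow> (\<exists>P Q. P \<subseteq> S \<and> Q \<subseteq> S \<and> P \<inter> Q = {} \<and> card P = k \<and> card Q = k \<and>
     (\<forall>p\<in>P. \<forall>q\<in>Q. R p q))"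

lemma has_bicliqueI:
  assumes "P \<subseteq> S" "Q \<subseteq> S" "P \<inter> Q = {}" "k \<le> card P" "k \<le> card Q" "\<And>p q. p \<in> P \<Longrightarrow> q \<in> Q \<Longrightarrow> R p q"
  shows "has_biclique R S k"
proof -
  obtain P' where P': "P' \<subseteq> P" "card P' = k" "finite P'" using assms(4) by (rule obtain_subset_with_card_n)
  obtain Q' where Q': "Q' \<subseteq> Q" "card Q' = k" "finite Q'" using assms(5) by (rule obtain_subset_with_card_n)
  show ?thesis unfolding has_biclique_def
  proof (rule exI[of _ P'], rule exI[of _ Q'], intro conjI ballI)
    show "P' \<subseteq> S" using P'(1) assms(1) by blast
    show "Q' \<subseteq> S" using Q'(1) assms(2) by blast
    show "P' \<inter> Q' = {}" using P'(1) Q'(1) assms(3) by blast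
    show "card P' = k" "card Q' = k" using P'(2) Q'(2) by simp_all
    show "R p q" if "p \<in> P'" "q \<in> Q'" for p q using P'(1) Q'(1) assms(6) that by blast
  qed
qed

text \<open>Edges that pairwise meet form a star or a triangle, and a bipartite graph has no
  triangle. The centre may lie on either side.\<close>

lemma star_cases:
  assumes "\<And>e e' f f'. e \<in> E \<Longrightarrow> e' \<in> E \<Longrightarrow> f \<in> F \<Longrightarrow> f' \<in> F \<Longrightarrow> e \<noteq> e' \<Longrightarrow> f \<noteq> f' \<Longrightarrow> \<not> B e f \<or> \<not> B e' f'"
  obtains (none) "\<And>e f. e \<in> E \<Longrightarrow> f \<in> F \<Longrightarrow> \<not> B e f"
  | (left) e0 f0 where "e0 \<in> E" "f0 \<in> F" "B e0 f0" "\<And>e f. e \<in> E \<Longrightarrow> f \<in> F \<Longrightarrow> B e f \<Longrightarrow> e = e0"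
  | (right) e0 f0 where "e0 \<in> E" "f0 \<in> F" "B e0 f0" "\<And>e f. e \<in> E \<Longrightarrow> f \<in> F \<Longrightarrow> B e f \<Longrightarrow> f = f0"
proof (cases "\<exists>e0\<in>E. \<exists>f0\<in>F. B e0 f0")
  case False then show ?thesis using none by blast
next
  case True
  then obtain e0 f0 where e0: "e0 \<in> E" "f0 \<in> F" "B e0 f0" by blast
  show ?thesis
  proof (cases "\<forall>e\<in>E. \<forall>f\<in>F. B e f \<longrightarrow> e = e0")
    case True then show ?thesis using left[OF e0] by blast
  next
    case False
    then obtain e1 f1 where e1: "e1 \<in> E" "f1 \<in> F" "B e1 f1" "e1 \<noteq> e0" by blast
    then have "f1 = f0" using assms[of e1 e0 f1 f0] e0 by blast
    have "f = f0" if "e \<in> E" "f \<in> F" "B e f" for e f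
    proof (rule ccontr)
      assume "f \<noteq> f0"
      then have "e = e0" using assms[of e e0 f f0] that e0 by blast
      moreover have "e = e1" using assms[of e e1 f f0] that e1 \<open>f \<noteq> f0\<close> \<open>f1 = f0\<close> by blast
      ultimately have "e = e0" "e = e1" by auto
      then show False using e1 by simp
    qed
    then show ?thesis using right[OF e0] by blast
  qed
qed

text \<open>The tight case: without the star centre \<open>e0\<close> the clique \<open>E\<close>
  keeps only \<open>k - 1\<close> vertices. The missing vertex must come from the at least
  \<open>k - 1\<close> vertices of \<open>S\<close> outside both cliques, so their attachment to
  \<open>P\<close> and \<open>F\<close> is analysed.\<close>

lemma biclique_of_two_cliques:
  assumes sy: "symp R" and S: "finite S" "3 * k - 1 \<le> card S" and k: "4 \<le> k"
    and EF: "E \<subseteq> S" "F \<subseteq> S" "E \<inter> F = {}" "card E = k" "card F = k"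
    and clE: "complete_on (\<lambda>x y. \<not> R x y) E" and clF: "complete_on (\<lambda>x y. \<not> R x y) F"
    and e0: "e0 \<in> E" "o1 \<in> F" "\<not> R e0 o1"
    and star: "\<And>e f. e \<in> E \<Longrightarrow> f \<in> F \<Longrightarrow> \<not> R e f \<Longrightarrow> e = e0"
    and nR: "\<not> has_cycle R S (2 * k - 1)" and nB: "\<not> has_cycle (\<lambda>x y. \<not> R x y) S (2 * k - 1)"
  shows "has_biclique R S k \<or> has_biclique (\<lambda>x y. \<not> R x y) S k"
proof -
  note syB = symp_not[OF sy]
  have fin: "finite E" "finite F" using EF(1,2) S(1) by (auto intro: finite_subset)
  have Bsym: "\<not> R y x" if "\<not> R x y" for x y using that sympD[OF sy] by blast
  define P where "P = E - {e0}"
  have P: "finite P" "card P = k - 1" "P \<subseteq> E" "e0 \<notin> P" "P \<inter> F = {}" using fin EF e0 by (auto simp: P_def)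
  have RPF: "R p f" if "p \<in> P" "f \<in> F" for p f using star[of p f] that by (auto simp: P_def)
  define T where "T = S - (E \<union> F)"
  have T: "finite T" "k - 1 \<le> card T" "T \<inter> E = {}" "T \<inter> F = {}" "T \<subseteq> S"
  proof -
    have "card (E \<union> F) = 2 * k" using card_Un_disjoint[OF fin EF(3)] EF by simp
    moreover have "card T = card S - card (E \<union> F)"
      unfolding T_def using EF fin by (intro card_Diff_subset) auto
    ultimately show "k - 1 \<le> card T" using S(2) by simp
  qed (use S in \<open>auto simp: T_def\<close>)
  have k2: "2 \<le> k - 2" "k - 2 \<le> card F" "2 \<le> k - 1" "k - 1 \<le> card E" using k EF by auto
  obtain p0 where p0: "p0 \<in> P" using P k by fastforce
  obtain o2 where o2: "o2 \<in> F" "o2 \<noteq> o1" using pick_other[of F o1] fin EF k by auto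
  have F1: False if "y \<in> T" "p \<in> P" "f \<in> F" "R y p" "R y f" for y p f
  proof -
    have "has_cycle R (insert y (P \<union> F)) (2 * (k - 1) + 1)"
      by (rule bip_apex_cycle[OF P(1) fin(2) P(5) sy RPF that(2,3) _ _ that(4,5)])
        (use that(1) T P EF k in auto)
    moreover have "2 * (k - 1) + 1 = 2 * k - 1" using k by simp
    moreover have "insert y (P \<union> F) \<subseteq> S" using that(1) T(5) P(3) EF by blast
    ultimately show False using nR has_cycle_mono by metis
  qed
  \<comment> \<open>Otherwise \<open>k\<close> vertices of \<open>E\<close>, then \<open>y\<close>,
    then \<open>k - 2\<close> vertices of \<open>F\<close> would close up through \<open>e0\<close>
    to a cycle of length \<open>2 * k - 1\<close>.\<close>
  have link: "o' = f" if h: "y \<in> T" "p \<in> P" "\<not> R y p" "f \<in> F" "\<not> R y f" "o' \<in> F" "\<not> R e0 o'" for y p f o'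
  proof (rule ccontr)
    assume ne: "o' \<noteq> f"
    obtain ps where ps: "pth (\<lambda>x y. \<not> R x y) ps e0 p" "set ps \<subseteq> E" "length ps = k"
      using clique_path[OF fin(1) clE syB e0(1), of p k] h(2) P EF(4) k by auto
    obtain qs where qs: "pth (\<lambda>x y. \<not> R x y) qs f o'" "set qs \<subseteq> F" "length qs = k - 2"
      using clique_path[OF fin(2) clF syB h(4) h(6) ne[symmetric] k2(1,2)] by blast
    have p1: "pth (\<lambda>x y. \<not> R x y) (ps @ [y]) e0 y"
      by (rule pth_snoc[OF ps(1) _ Bsym[OF h(3)]]) (use ps(2) h(1) T in auto)
    have p2: "pth (\<lambda>x y. \<not> R x y) ((ps @ [y]) @ qs) e0 o'"
      by (rule pth_append[OF p1 qs(1) _ h(5)]) (use ps(2) qs(2) h(1) T EF in auto)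
    have "has_cycle (\<lambda>x y. \<not> R x y) S (2 * k - 1)"
      by (rule has_cycle_close[OF p2 Bsym[OF h(7)]]) (use ps qs h(1) T EF k in auto)
    then show False using nB by blast
  qed
  define TP where "TP = {y \<in> T. \<forall>p\<in>P. \<not> R y p}"
  \<comment> \<open>By \<open>F1\<close>, an \<open>R\<close>-neighbour in \<open>P\<close> excludes
    all of \<open>F\<close>. Applying \<open>link\<close> with \<open>o2\<close>, which differs from
    \<open>o1\<close>, then makes \<open>y\<close> an \<open>R\<close>-neighbour of all of
    \<open>P\<close>.\<close>
  have out: "(\<forall>f\<in>F. \<not> R y f) \<and> (\<forall>p\<in>P. R y p)" if y: "y \<in> T" "y \<notin> TP" for y
  proof -
    have a: "\<forall>f\<in>F. \<not> R y f" using F1[OF y(1)] y by (auto simp: TP_def)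
    moreover have "R y p" if "p \<in> P" for p
      using link[OF y(1) that _ o2(1) _ e0(2,3)] a o2 by blast
    ultimately show ?thesis by blast
  qed
  consider (full) y where "y \<in> TP" "\<forall>f\<in>F. R y f" | (empty) "TP = {}" | (rest) y where "y \<in> TP" "\<forall>y\<in>TP. \<exists>f\<in>F. \<not> R y f"
    by blast
  then show ?thesis
  proof cases
    case full
    have yT: "y \<in> T" using full by (simp add: TP_def)
    have "has_biclique R S k"
    proof (rule has_bicliqueI[of "insert y P" S F])
      show "k \<le> card (insert y P)" using yT P T k by (subst card_insert_disjoint) auto
      show "insert y P \<inter> F = {}" "insert y P \<subseteq> S" "F \<subseteq> S" "k \<le> card F" using yT P T EF by auto
      fix p q assume "p \<in> insert y P" "q \<in> F"
      then show "R p q" using full(2) RPF by blast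
    qed
    then show ?thesis by blast
  next
    case empty
    have "has_cycle (\<lambda>x y. \<not> R x y) (F \<union> T) (2 * (k - 1) + 1)"
      by (rule bip_odd_cycle[OF fin(2) T(1) _ syB _ o2(1) e0(2) o2(2)])
        (use T empty out Bsym complete_onD[OF clF o2(1) e0(2) o2(2)] EF k in auto)
    moreover have "2 * (k - 1) + 1 = 2 * k - 1" using k by simp
    moreover have "F \<union> T \<subseteq> S" using T(5) EF by blast
    ultimately show ?thesis using nB has_cycle_mono by metis
  next
    case rest
    have TPT: "y \<in> T \<and> (\<forall>p\<in>P. \<not> R y p)" if "y \<in> TP" for y using that by (simp add: TP_def)
    have yo1: "\<not> R y o1" if y: "y \<in> TP" for y
    proof -
      obtain f where f: "f \<in> F" "\<not> R y f" using rest(2) y by blast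
      then have "o1 = f" using link[of y p0 f o1] TPT[OF y] p0 e0 by blast
      then show ?thesis using f by simp
    qed
    have e0o: "f = o1" if "f \<in> F" "\<not> R e0 f" for f
      using link[of y p0 o1 f] TPT[OF rest(1)] p0 e0(2) yo1[OF rest(1)] that by blast
    show ?thesis
    proof (cases "T = TP")
      case True
      have c: "card (insert o1 P) = k" "card (insert e0 T) \<ge> k"
      proof -
        have "o1 \<notin> P" "e0 \<notin> T" using P e0 T by auto
        then show "card (insert o1 P) = k" "card (insert e0 T) \<ge> k" using P T k by auto
      qed
      have "has_biclique (\<lambda>x y. \<not> R x y) S k"
      proof (rule has_bicliqueI[of "insert o1 P" S "insert e0 T"])
        show "insert o1 P \<subseteq> S" "insert e0 T \<subseteq> S" using e0 EF P(3) T(5) by auto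
        show "insert o1 P \<inter> insert e0 T = {}" using e0 EF P T by auto
        fix p q assume h: "p \<in> insert o1 P" "q \<in> insert e0 T"
        have 1: "\<not> R p e0" if "p \<in> P" using complete_onD[OF clE _ e0(1), of p] that by (auto simp: P_def)
        have 2: "\<not> R p q" if "p \<in> P" "q \<in> T" using TPT[of q] that True Bsym by blast
        have 3: "\<not> R o1 q" if "q \<in> T" using yo1[of q] that True Bsym by blast
        show "\<not> R p q" using h 1 2 3 Bsym[OF e0(3)] by blast
      qed (use c in auto)
      then show ?thesis by blast
    next
      case False
      then obtain w where w: "w \<in> T" "w \<notin> TP" by (auto simp: TP_def)
      note wo = out[OF w]
      show ?thesis
      proof (cases "R e0 w")
        case True
        have "has_biclique R S k"
        proof (rule has_bicliqueI[of E S "insert w (F - {o1})"])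
          show "insert w (F - {o1}) \<subseteq> S" using w T(5) EF by auto
          show "E \<inter> insert w (F - {o1}) = {}" using w T EF by auto
          show "k \<le> card (insert w (F - {o1}))"
          proof -
            have "w \<notin> F" using w T by auto
            then show ?thesis using fin EF e0 by (simp add: card_insert_if)
          qed
          fix p q assume h: "p \<in> E" "q \<in> insert w (F - {o1})"
          show "R p q"
          proof (cases "p = e0")
            case True
            then show ?thesis using h(2) \<open>R e0 w\<close> e0o by blast
          next
            case False
            then have "p \<in> P" using h by (simp add: P_def)
            then show ?thesis using h(2) RPF wo sympD[OF sy] by blast
          qed
        qed (use EF in auto)
        then show ?thesis by blast
      next
        case False
        have y: "y \<in> T" "\<not> R y p0" "\<not> R y o1" "y \<noteq> w"
          using TPT[OF rest(1)] p0 yo1[OF rest(1)] w rest(1) by auto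
        \<comment> \<open>The cycle takes \<open>k - 1\<close> vertices of \<open>E\<close>, then
          \<open>y\<close>, then \<open>k - 2\<close> vertices of \<open>F\<close>, then
          \<open>w\<close>, and returns to \<open>e0\<close>.\<close>
        obtain ps where ps: "pth (\<lambda>x y. \<not> R x y) ps e0 p0" "set ps \<subseteq> E" "length ps = k - 1"
          using clique_path[OF fin(1) clE syB e0(1) _ _ k2(3,4), of p0] p0 P(3,4) by blast
        obtain qs where qs: "pth (\<lambda>x y. \<not> R x y) qs o1 o2" "set qs \<subseteq> F" "length qs = k - 2"
          using clique_path[OF fin(2) clF syB e0(2) o2(1) o2(2)[symmetric] k2(1,2)] by blast
        have p1: "pth (\<lambda>x y. \<not> R x y) (ps @ [y]) e0 y"
          by (rule pth_snoc[OF ps(1) _ Bsym[OF y(2)]]) (use ps(2) y(1) T in auto)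
        have p2: "pth (\<lambda>x y. \<not> R x y) ((ps @ [y]) @ qs) e0 o2"
          by (rule pth_append[OF p1 qs(1) _ y(3)]) (use ps(2) qs(2) y(1) T EF in auto)
        have "\<not> R o2 w" using wo o2(1) Bsym by blast
        then have p3: "pth (\<lambda>x y. \<not> R x y) (((ps @ [y]) @ qs) @ [w]) e0 w"
          using ps(2) qs(2) w y(4) T by (intro pth_snoc[OF p2]) auto
        have "has_cycle (\<lambda>x y. \<not> R x y) S (2 * k - 1)"
          by (rule has_cycle_close[OF p3 Bsym[OF False]]) (use ps qs y(1) w T EF k in auto)
        then show ?thesis using nB by blast
      qed
    qed
  qed
qed

text \<open>Descent on the length of a monochromatic cycle. The relation is quantified in the
  induction because a shorter cycle may appear in the other colour. An odd cycle always shortens; an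
  even one that does not consists of two cliques of the other colour.\<close>

lemma mono_biclique_aux:
  assumes S: "finite S" "3 * k - 1 \<le> card S" and k: "4 \<le> k"
  shows "symp R \<Longrightarrow> \<not> has_cycle R S (2 * k - 1) \<Longrightarrow> \<not> has_cycle (\<lambda>x y. \<not> R x y) S (2 * k - 1) \<Longrightarrow>
    has_cycle R S n \<Longrightarrow> 2 * k - 1 \<le> n \<Longrightarrow> has_biclique R S k \<or> has_biclique (\<lambda>x y. \<not> R x y) S k"
proof (induction n arbitrary: R rule: less_induct)
  case (less n)
  note sy = less.prems(1) and nR = less.prems(2) and nB = less.prems(3)
  note syB = symp_not[OF sy]
  have n: "2 * k \<le> n" using nR less.prems(4,5) by (cases "n = 2 * k - 1") auto
  have down: ?case if "has_cycle R S n' \<or> has_cycle (\<lambda>x y. \<not> R x y) S n'" "n' < n" "2 * k - 1 \<le> n'" for n'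
    using less.IH[OF that(2) sy nR nB _ that(3)] less.IH[OF that(2) syB nB _ _ that(3)] nR that(1) by auto
  obtain x where x: "cyf R x n" "range x \<subseteq> S" using has_cycle_cyf[OF less.prems(4)] by blast
  show ?case
  proof (cases "even n")
    case False
    then obtain l where l: "n = 2 * l + 1" by (auto elim: oddE)
    have "has_cycle R (range x) (2 * l) \<or> has_cycle (\<lambda>x y. \<not> R x y) (range x) (2 * l)"
      by (rule shorten_odd_cycle[OF sy]) (use x l n k in auto)
    then show ?thesis using down[of "2 * l"] has_cycle_mono[OF _ x(2)] l n by auto
  next
    case True
    then obtain l where l: "n = 2 * l" by (auto elim: evenE)
    show ?thesis
    proof (cases "has_cycle R (range x) (2 * l - 1) \<or> has_cycle (\<lambda>x y. \<not> R x y) (range x) (2 * l - 1)")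
      case True
      then show ?thesis using down[of "2 * l - 1"] has_cycle_mono[OF _ x(2)] l n k by auto
    next
      case False
      have l3: "l \<ge> 3" using l n k by simp
      have nn: "\<not> has_cycle R (range x) (2 * l - 1)" "\<not> has_cycle (\<lambda>x y. \<not> R x y) (range x) (2 * l - 1)"
        using False by auto
      obtain E F where EF: "E \<inter> F = {}" "E \<union> F = range x" "card E = l" "card F = l"
        "complete_on (\<lambda>x y. \<not> R x y) E" "complete_on (\<lambda>x y. \<not> R x y) F"
        and st: "\<And>e e' f f'. e \<in> E \<Longrightarrow> e' \<in> E \<Longrightarrow> f \<in> F \<Longrightarrow> f' \<in> F \<Longrightarrow> e \<noteq> e' \<Longrightarrow> f \<noteq> f' \<Longrightarrow> R e f \<or> R e' f'"
        by (rule shorten_even_cycle[OF sy x(1)[unfolded l] l3 nn]) (rule that)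
      have sub: "E \<subseteq> S" "F \<subseteq> S" using EF x by auto
      have fin: "finite E" "finite F" using sub S(1) by (auto intro: finite_subset)
      have lk: "k \<le> l" using l n by simp
      have st': "\<not> \<not> R e f \<or> \<not> \<not> R e' f'" if "e \<in> E" "e' \<in> E" "f \<in> F" "f' \<in> F" "e \<noteq> e'" "f \<noteq> f'" for e e' f f'
        using st[OF that] by blast
      show ?thesis
      proof (rule star_cases[of E F "\<lambda>e f. \<not> R e f", OF st'], assumption+, goal_cases none left right)
        case none
        have "has_biclique R S k" by (rule has_bicliqueI[OF sub EF(1)]) (use none EF lk in auto)
        then show ?thesis by blast
      next
        case (left e0 f0)
        show ?thesis
        \<comment> \<open>Deleting the star centre leaves \<open>l - 1\<close> vertices in its
          clique, which is enough unless \<open>l = k\<close>.\<close>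
        proof (cases "l = k")
          case True
          show ?thesis
            by (rule biclique_of_two_cliques[OF sy S k sub EF(1) _ _ EF(5,6) left(1-3) _ nR nB])
              (use True EF(3,4) left(4) in auto)
        next
          case False
          have "has_biclique R S k"
          proof (rule has_bicliqueI[of "E - {e0}" S F])
            show "k \<le> card (E - {e0})" "k \<le> card F" using EF(3,4) lk False left(1) fin by auto
            show "R p q" if "p \<in> E - {e0}" "q \<in> F" for p q using left(4)[of p q] that by auto
          qed (use sub EF(1) in auto)
          then show ?thesis by blast
        qed
      next
        case (right e0 f0)
        have Bs: "\<not> R y x \<Longrightarrow> \<not> R x y" for x y using sympD[OF sy, of x y] by blast
        show ?thesis
        proof (cases "l = k")
          case True
          have "F \<inter> E = {}" using EF by blast
          show ?thesis
            by (intro biclique_of_two_cliques[OF sy S k sub(2,1) _ _ _ EF(6,5) right(2,1) Bs[OF right(3)] _ nR nB])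
              (use EF(3,4) True \<open>F \<inter> E = {}\<close> Bs right(4) in auto)
        next
          case False
          have "has_biclique R S k"
          proof (rule has_bicliqueI[of E S "F - {f0}"])
            show "k \<le> card (F - {f0})" "k \<le> card E" using EF(3,4) lk False right(2) fin by auto
            show "R p q" if "p \<in> E" "q \<in> F - {f0}" for p q using right(4)[of p q] that by auto
          qed (use sub EF(1) in auto)
          then show ?thesis by blast
        qed
      qed
    qed
  qed
qed

lemma mono_biclique:
  assumes "symp R" "finite S" "3 * k - 1 \<le> card S" "4 \<le> k"
    "\<not> has_cycle R S (2 * k - 1)" "\<not> has_cycle (\<lambda>x y. \<not> R x y) S (2 * k - 1)"
  shows "has_biclique R S k \<or> has_biclique (\<lambda>x y. \<not> R x y) S k"
proof -
  have "3 * (k - 1) + 2 \<le> card S" "2 \<le> k - 1" using assms(3,4) by simp_all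
  then obtain n where n: "n > 2 * (k - 1)" "has_cycle R S n \<or> has_cycle (\<lambda>x y. \<not> R x y) S n"
    using circumference[OF assms(1,2)] by blast
  have "2 * k - 1 \<le> n" using n(1) by simp
  then show ?thesis
    using n(2) mono_biclique_aux[OF assms(2-4) assms(1,5,6), of n]
      mono_biclique_aux[OF assms(2-4) symp_not[OF assms(1)] assms(6), of n] assms(5) by auto
qed

lemma has_bicliqueE:
  assumes "has_biclique R S k"
  obtains P Q where "P \<subseteq> S" "Q \<subseteq> S" "P \<inter> Q = {}" "card P = k" "card Q = k" "\<And>p q. p \<in> P \<Longrightarrow> q \<in> Q \<Longrightarrow> R p q"
proof -
  obtain P Q where h: "P \<subseteq> S" "Q \<subseteq> S" "P \<inter> Q = {}" "card P = k" "card Q = k" "\<forall>p\<in>P. \<forall>q\<in>Q. R p q"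
    using assms unfolding has_biclique_def by metis
  show ?thesis by (rule that[OF h(1-5)]) (use h(6) in blast)
qed

text \<open>Between \<open>k\<close> vertices of \<open>C\<close> and the rest of \<open>D\<close>
  all edges are present, and an edge inside \<open>C\<close> corrects the parity.\<close>

lemma core_cycle:
  assumes sy: "symp R" and D: "finite D" "C \<subseteq> D" "k \<le> card C" "2 \<le> k" "2 * k - 1 \<le> card D"
    and co: "\<And>y c. y \<in> D \<Longrightarrow> c \<in> C \<Longrightarrow> y \<noteq> c \<Longrightarrow> R y c"
  shows "has_cycle R D (2 * k - 1)"
proof -
  obtain P where P: "P \<subseteq> C" "card P = k" "finite P" using D(3) by (rule obtain_subset_with_card_n)
  have PD: "P \<subseteq> D" using P D by blast
  obtain p where p: "p \<in> P" using P D(4) by fastforce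
  obtain p' where p': "p' \<in> P" "p' \<noteq> p" using pick_other[of P p] P D by auto
  have "card (D - P) = card D - k" using P PD by (simp add: card_Diff_subset)
  then have c: "k - 1 \<le> card (D - P)" using D(4,5) by simp
  have R: "R p q" if "p \<in> P" "q \<in> D - P" for p q
    using sympD[OF sy co[of q p]] that P(1) by blast
  have "has_cycle R (P \<union> (D - P)) (2 * (k - 1) + 1)"
    by (rule bip_odd_cycle[OF P(3) _ _ sy R p p'(1)])
      (use D(1,4) P p p' c PD co[of p p'] in auto)
  moreover have "P \<union> (D - P) = D" "2 * (k - 1) + 1 = 2 * k - 1" using PD D(4) by auto
  ultimately show ?thesis by metis
qed

section \<open>Colourings without wheels\<close>

text \<open>The setting to be refuted: \<open>A\<close> is part of the neighbourhood of a fixed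
  vertex in one colour, called red and given by \<open>R\<close>. A red rim in \<open>A\<close>
  would get that vertex as hub; a blue rim needs a hub inside \<open>A\<close>.\<close>

locale no_wheel =
  fixes R :: "'a \<Rightarrow> 'a \<Rightarrow> bool" and A :: "'a set" and k :: nat
  assumes sym: "symp R" and finA: "finite A" and k4: "4 \<le> k" and cardA: "card A = 6 * k - 5"
    and no_red: "\<not> has_cycle R A (2 * k - 1)"
    and no_blue: "\<And>h. h \<in> A \<Longrightarrow> \<not> has_cycle (\<lambda>x y. \<not> R x y) {y \<in> A. y \<noteq> h \<and> \<not> R h y} (2 * k - 1)"
begin

abbreviation "B \<equiv> (\<lambda>x y. \<not> R x y)"

lemma symB: "symp B"
  by (rule symp_not[OF sym])

lemma Rs: "R x y \<Longrightarrow> R y x"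
  by (rule sympD[OF sym])

lemma Bs: "\<not> R x y \<Longrightarrow> \<not> R y x"
  using Rs by blast

lemma finite_sub: "X \<subseteq> A \<Longrightarrow> finite X"
  using finA finite_subset by blast

lemma redE: "has_cycle R X (2 * k - 1) \<Longrightarrow> X \<subseteq> A \<Longrightarrow> False"
  using no_red has_cycle_mono by blast

lemma wheelE:
  assumes "h \<in> A" "has_cycle B Y (2 * k - 1)" "Y \<subseteq> A" "h \<notin> Y" "\<And>y. y \<in> Y \<Longrightarrow> \<not> R h y"
  shows False
proof -
  have "Y \<subseteq> {y \<in> A. y \<noteq> h \<and> \<not> R h y}" using assms by auto
  then show False using no_blue[OF assms(1)] has_cycle_mono[OF assms(2)] by blast
qed

lemma red_clique_card:
  assumes "X \<subseteq> A" "complete_on R X" shows "card X \<le> 2 * k - 2"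
proof (rule ccontr)
  assume "\<not> ?thesis"
  then have "has_cycle R X (2 * k - 1)"
    using k4 by (intro clique_cycle[OF finite_sub[OF assms(1)] assms(2) sym]) auto
  then show False using redE assms by blast
qed

text \<open>A blue edge inside \<open>P\<close> would turn the blue biclique into a blue rim around
  \<open>h\<close>.\<close>

lemma bip_wheel:
  assumes "h \<in> A" "P \<subseteq> A" "Q \<subseteq> A" "P \<inter> Q = {}" "h \<notin> P" "h \<notin> Q"
    "\<And>p q. p \<in> P \<Longrightarrow> q \<in> Q \<Longrightarrow> \<not> R p q" "\<And>p. p \<in> P \<Longrightarrow> \<not> R h p" "\<And>q. q \<in> Q \<Longrightarrow> \<not> R h q"
    "k \<le> card P" "k - 1 \<le> card Q"
  shows "complete_on R P"
proof (rule ccontr)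
  assume "\<not> ?thesis"
  then obtain p p' where p: "p \<in> P" "p' \<in> P" "p \<noteq> p'" "\<not> R p p'" by (auto simp: complete_on_def)
  have "has_cycle B (P \<union> Q) (2 * (k - 1) + 1)"
    by (rule bip_odd_cycle[OF finite_sub[OF assms(2)] finite_sub[OF assms(3)] assms(4) symB assms(7) p(1-3)])
      (use p assms k4 in auto)
  moreover have "2 * (k - 1) + 1 = 2 * k - 1" using k4 by simp
  ultimately have c: "has_cycle B (P \<union> Q) (2 * k - 1)" by metis
  show False by (rule wheelE[OF assms(1) c]) (use assms in auto)
qed

lemma bip_apex_red:
  assumes "P \<subseteq> A" "Q \<subseteq> A" "P \<inter> Q = {}" "\<And>p q. p \<in> P \<Longrightarrow> q \<in> Q \<Longrightarrow> R p q"
    "k - 1 \<le> card P" "k - 1 \<le> card Q" "y \<in> A" "y \<notin> P" "y \<notin> Q" "p \<in> P" "q \<in> Q" "R y p" "R y q"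
  shows False
proof -
  have "has_cycle R (insert y (P \<union> Q)) (2 * (k - 1) + 1)"
    by (rule bip_apex_cycle[OF finite_sub[OF assms(1)] finite_sub[OF assms(2)] assms(3) sym assms(4,10,11,8,9,12,13)])
      (use assms k4 in auto)
  moreover have "2 * (k - 1) + 1 = 2 * k - 1" using k4 by simp
  ultimately show False using redE assms by (metis insert_subset le_sup_iff)
qed

lemma bip_red:
  assumes "P \<subseteq> A" "Q \<subseteq> A" "P \<inter> Q = {}" "\<And>p q. p \<in> P \<Longrightarrow> q \<in> Q \<Longrightarrow> R p q" "k \<le> card P" "k - 1 \<le> card Q"
  shows "complete_on B P"
proof (rule ccontr)
  assume "\<not> ?thesis"
  then obtain p p' where p: "p \<in> P" "p' \<in> P" "p \<noteq> p'" "R p p'" by (auto simp: complete_on_def)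
  have "has_cycle R (P \<union> Q) (2 * (k - 1) + 1)"
    by (rule bip_odd_cycle[OF finite_sub[OF assms(1)] finite_sub[OF assms(2)] assms(3) sym assms(4) p(1-3)])
      (use p assms k4 in auto)
  moreover have "2 * (k - 1) + 1 = 2 * k - 1" using k4 by simp
  ultimately show False using redE assms by (metis le_sup_iff)
qed

text \<open>\<open>P\<close> and \<open>Q\<close> are blue cliques, so any vertex of
  \<open>V = P\<close> or \<open>V = Q\<close> can be a hub over the rest of \<open>V\<close> and
  the vertices blue to \<open>V\<close>; those must form a red clique. Hence \<open>TP\<close> is a
  red clique of the largest possible size, and few of its vertices can have a red neighbour in
  \<open>Q\<close>, which makes \<open>TQ\<close> too large.\<close>

lemma red_biclique_aux:
  assumes PQ: "P \<subseteq> A" "Q \<subseteq> A" "P \<inter> Q = {}" "card P = k" "card Q = k" "\<And>p q. p \<in> P \<Longrightarrow> q \<in> Q \<Longrightarrow> R p q"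
    and TP: "TP = {y \<in> A - (P \<union> Q). \<forall>p\<in>P. \<not> R y p}" and TQ: "TQ = {y \<in> A - (P \<union> Q). \<forall>q\<in>Q. \<not> R y q}"
    and c: "2 * k - 2 \<le> card TP"
  shows False
proof -
  have wh: "complete_on R T" if h: "V \<subseteq> A" "card V = k" "complete_on B V" "T \<subseteq> A" "T \<inter> V = {}"
    "\<And>t v. t \<in> T \<Longrightarrow> v \<in> V \<Longrightarrow> \<not> R t v" "2 * k - 2 \<le> card T" for V T
  proof -
    obtain v where v: "v \<in> V" using h(2) k4 by fastforce
    show ?thesis
    proof (rule bip_wheel[of v T "V - {v}"])
      show "k \<le> card T" "k - 1 \<le> card (V - {v})" using h(2,7) v k4 by auto
      show "\<not> R v p" if "p \<in> T" for p using Bs h(6) v that by blast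
      show "\<not> R v q" if "q \<in> V - {v}" for q using complete_onD[OF h(3) v] that by blast
    qed (use h v in auto)
  qed
  have clP: "complete_on B P" by (rule bip_red[OF PQ(1-3,6)]) (use PQ in auto)
  have clQ: "complete_on B Q" by (rule bip_red[OF PQ(2,1) _ Rs[OF PQ(6)]]) (use PQ in auto)
  have sub: "TP \<subseteq> A" "TQ \<subseteq> A" "TP \<inter> P = {}" "TQ \<inter> Q = {}" "TP \<inter> Q = {}" using TP TQ by auto
  have fin: "finite TP" "finite TQ" using sub finite_sub by auto
  have cT: "complete_on R TP"
    by (rule wh[OF PQ(1,4) clP sub(1,3)]) (use c TP in auto)
  then have cc: "card TP = 2 * k - 2" using red_clique_card[OF sub(1)] c by simp
  \<comment> \<open>A second red neighbour would close a red rim through \<open>q\<close> and all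
    \<open>2 * k - 2\<close> vertices of \<open>TP\<close>.\<close>
  have one: "t = t'" if h: "q \<in> Q" "t \<in> TP" "t' \<in> TP" "R t q" "R t' q" for q t t'
  proof (rule ccontr)
    assume ne: "t \<noteq> t'"
    obtain ps where ps: "pth R ps t t'" "set ps \<subseteq> TP" "length ps = 2 * k - 2"
    proof -
      have "2 \<le> 2 * k - 2" "2 * k - 2 \<le> card TP" using cc k4 by simp_all
      then show ?thesis using clique_path[OF fin(1) cT sym h(2,3) ne, of "2 * k - 2"] that by blast
    qed
    have p: "pth R (ps @ [q]) t q" by (rule pth_snoc[OF ps(1) _ h(5)]) (use ps h sub in auto)
    have "has_cycle R A (2 * k - 1)"
      by (rule has_cycle_close[OF p Rs[OF h(4)]]) (use ps h sub PQ k4 in auto)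
    then show False using no_red by blast
  qed
  have "\<forall>t\<in>TP - TQ. \<exists>q\<in>Q. R t q" using TP TQ by blast
  then obtain g where g: "\<And>t. t \<in> TP - TQ \<Longrightarrow> g t \<in> Q \<and> R t (g t)" by metis
  have "inj_on g (TP - TQ)"
  proof (rule inj_onI)
    fix t t' assume h: "t \<in> TP - TQ" "t' \<in> TP - TQ" "g t = g t'"
    then show "t = t'" using one[of "g t" t t'] g[OF h(1)] g[OF h(2)] by auto
  qed
  then have "card (TP - TQ) \<le> card Q"
    by (rule card_inj_on_le) (use g PQ finite_sub in auto)
  then have cD: "card (TP - TQ) \<le> k" using PQ by simp
  have "R y p \<Longrightarrow> R y q \<Longrightarrow> False" if "y \<in> A - (P \<union> Q)" "p \<in> P" "q \<in> Q" for y p q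
    by (rule bip_apex_red[OF PQ(1-3,6), of y p q]) (use that PQ in auto)
  then have "A - (P \<union> Q) \<subseteq> TP \<union> TQ" using TP TQ by blast
  then have "A - (P \<union> Q) \<subseteq> (TP - TQ) \<union> TQ" by blast
  then have "card (A - (P \<union> Q)) \<le> card (TP - TQ) + card TQ"
    using fin by (meson card_Un_le card_mono finite_Diff finite_UnI order_trans)
  moreover have "card (A - (P \<union> Q)) = 4 * k - 5"
  proof -
    have "card (P \<union> Q) = 2 * k" using PQ finite_sub by (subst card_Un_disjoint) auto
    then show ?thesis using PQ cardA finite_sub[of "P \<union> Q"] by (subst card_Diff_subset) auto
  qed
  \<comment> \<open>At least \<open>4 * k - 5 - k\<close> vertices remain for \<open>TQ\<close>, and
    \<open>3 * k - 5 >= 2 * k - 1\<close> as \<open>k >= 4\<close>.\<close>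
  ultimately have cTQ: "2 * k - 1 \<le> card TQ" using cD k4 by linarith
  have "complete_on R TQ"
    by (rule wh[OF PQ(2,5) clQ sub(2,4)]) (use cTQ TQ in auto)
  then show False using red_clique_card[OF sub(2)] cTQ k4 by simp
qed

lemma no_red_biclique: "\<not> has_biclique R A k"
proof
  assume "has_biclique R A k"
  then obtain P Q where PQ: "P \<subseteq> A" "Q \<subseteq> A" "P \<inter> Q = {}" "card P = k" "card Q = k" "\<And>p q. p \<in> P \<Longrightarrow> q \<in> Q \<Longrightarrow> R p q"
    by (rule has_bicliqueE) (rule that)
  define TP where "TP = {y \<in> A - (P \<union> Q). \<forall>p\<in>P. \<not> R y p}"
  define TQ where "TQ = {y \<in> A - (P \<union> Q). \<forall>q\<in>Q. \<not> R y q}"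
  have "R y p \<Longrightarrow> R y q \<Longrightarrow> False" if "y \<in> A - (P \<union> Q)" "p \<in> P" "q \<in> Q" for y p q
    by (rule bip_apex_red[OF PQ(1-3,6), of y p q]) (use that PQ in auto)
  then have "A - (P \<union> Q) \<subseteq> TP \<union> TQ" using TP_def TQ_def by blast
  then have "card (A - (P \<union> Q)) \<le> card TP + card TQ"
    using finA by (auto simp: TP_def TQ_def intro!: order_trans[OF card_mono card_Un_le])
  moreover have "card (A - (P \<union> Q)) = 4 * k - 5"
  proof -
    have "card (P \<union> Q) = 2 * k" using PQ finite_sub by (subst card_Un_disjoint) auto
    then show ?thesis using PQ cardA finite_sub[of "P \<union> Q"] by (subst card_Diff_subset) auto
  qed
  ultimately consider "2 * k - 2 \<le> card TP" | "2 * k - 2 \<le> card TQ" using k4 by linarith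
  then show False
  proof cases
    case 1 then show False using red_biclique_aux[OF PQ TP_def TQ_def] by blast
  next
    case 2
    have "Q \<inter> P = {}" using PQ by blast
    then show False using red_biclique_aux[OF PQ(2,1) _ PQ(5,4) Rs[OF PQ(6)], of TQ TP] 2 TP_def TQ_def
      by (simp add: Un_commute)
  qed
qed

text \<open>A vertex that has a blue neighbour in each class extends the blue biclique on two
  classes to a rim, with its neighbour in the third class as hub. So every vertex of
  \<open>A\<close> is red to a whole class, while \<open>core_cycle\<close> allows at most
  \<open>2 * k - 2\<close> such vertices per class; \<open>6 * k - 5\<close> is one too
  many.\<close>

lemma no_blue_tripartite:
  assumes sub: "C1 \<subseteq> A" "C2 \<subseteq> A" "C3 \<subseteq> A" and disj: "C1 \<inter> C2 = {}" "C1 \<inter> C3 = {}" "C2 \<inter> C3 = {}"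
    and c: "k \<le> card C1" "k \<le> card C2" "k \<le> card C3"
    and b12: "\<And>x y. x \<in> C1 \<Longrightarrow> y \<in> C2 \<Longrightarrow> \<not> R x y" and b13: "\<And>x y. x \<in> C1 \<Longrightarrow> y \<in> C3 \<Longrightarrow> \<not> R x y"
    and b23: "\<And>x y. x \<in> C2 \<Longrightarrow> y \<in> C3 \<Longrightarrow> \<not> R x y"
  shows False
proof -
  have ne: "C1 \<noteq> {}" "C2 \<noteq> {}" "C3 \<noteq> {}" using c k4 by auto
  obtain c1 c2 c3 where cc: "c1 \<in> C1" "c2 \<in> C2" "c3 \<in> C3" using ne by blast
  have cl1: "complete_on R C1"
    by (rule bip_wheel[of c2 C1 C3]) (use sub disj c cc b12 b13 b23 Bs in auto)
  have cl2: "complete_on R C2"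
    by (rule bip_wheel[of c1 C2 C3]) (use sub disj c cc b12 b13 b23 Bs in auto)
  have cl3: "complete_on R C3"
    by (rule bip_wheel[of c1 C3 C2]) (use sub disj c cc b12 b13 b23 Bs in auto)
  define D where "D C = {y \<in> A. \<forall>c\<in>C. y \<noteq> c \<longrightarrow> R y c}" for C
  have small: "card (D C) < 2 * k - 1" if "C \<subseteq> A" "k \<le> card C" "complete_on R C" for C
  proof (rule ccontr)
    assume "\<not> ?thesis"
    then have "has_cycle R (D C) (2 * k - 1)"
      using that k4 by (intro core_cycle[of R "D C" C k] sym) (auto simp: D_def complete_on_def finA)
    then show False using redE[of "D C"] by (auto simp: D_def)
  qed
  have "y \<in> D C1 \<union> D C2 \<union> D C3" if y: "y \<in> A" for y
  proof (rule ccontr)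
    assume n: "y \<notin> D C1 \<union> D C2 \<union> D C3"
    then obtain d1 d2 d3 where d: "d1 \<in> C1" "d2 \<in> C2" "d3 \<in> C3" "\<not> R y d1" "\<not> R y d2" "\<not> R y d3"
      using y by (auto simp: D_def)
    have yn: "y \<notin> C1" "y \<notin> C2" "y \<notin> C3"
      using n y cl1 cl2 cl3 by (auto simp: D_def complete_on_def)
    have "has_cycle B (insert y (C1 \<union> C2)) (2 * (k - 1) + 1)"
      by (rule bip_apex_cycle[OF finite_sub[OF sub(1)] finite_sub[OF sub(2)] disj(1) symB b12 d(1,2) yn(1,2) d(4,5)])
        (use c k4 in auto)
    moreover have "2 * (k - 1) + 1 = 2 * k - 1" using k4 by simp
    ultimately have cy: "has_cycle B (insert y (C1 \<union> C2)) (2 * k - 1)" by metis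
    show False
      by (rule wheelE[of d3, OF _ cy]) (use d sub y yn disj Bs b13 b23 in auto)
  qed
  then have "card A \<le> card (D C1 \<union> D C2 \<union> D C3)"
    using finA by (intro card_mono) (auto simp: D_def)
  also have "\<dots> \<le> card (D C1 \<union> D C2) + card (D C3)" by (rule card_Un_le)
  also have "\<dots> \<le> card (D C1) + card (D C2) + card (D C3)" by (simp add: card_Un_le)
  finally show False using small[OF sub(1) c(1) cl1] small[OF sub(2) c(2) cl2] small[OF sub(3) c(3) cl3] cardA k4
    by linarith
qed


text \<open>The margin in \<open>k + 1\<close> pays for deleting one more vertex from a clique when
  a tripartite graph with classes of size \<open>k\<close> is built, and it supplies the free path
  ends required by \<open>clique_insertion\<close>.\<close>

definition red_split :: "'a set \<Rightarrow> 'a set \<Rightarrow> 'a set \<Rightarrow> bool" where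
  "red_split S S1 S2 \<longleftrightarrow> S1 \<subseteq> S \<and> S2 \<subseteq> S \<and> S1 \<inter> S2 = {} \<and> complete_on R S1 \<and> complete_on R S2 \<and>
    (\<forall>x\<in>S1. \<forall>y\<in>S2. \<not> R x y) \<and> k + 1 \<le> card S1 \<and> k + 1 \<le> card S2 \<and> card S \<le> card S1 + card S2 + 1"

lemma red_split_sym: "red_split S S1 S2 \<Longrightarrow> red_split S S2 S1"
  using Bs by (auto simp: red_split_def)

lemma blue_bip_clique:
  assumes "S \<subseteq> A" "\<not> has_cycle B S (2 * k - 1)"
    "P \<subseteq> S" "Q \<subseteq> S" "P \<inter> Q = {}" "\<And>p q. p \<in> P \<Longrightarrow> q \<in> Q \<Longrightarrow> \<not> R p q" "k \<le> card P" "k - 1 \<le> card Q"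
  shows "complete_on R P"
proof (rule ccontr)
  assume "\<not> ?thesis"
  then obtain p p' where p: "p \<in> P" "p' \<in> P" "p \<noteq> p'" "\<not> R p p'" by (auto simp: complete_on_def)
  have f: "finite P" "finite Q" using assms(1,3,4) by (auto intro!: finite_sub)
  have "has_cycle B (P \<union> Q) (2 * (k - 1) + 1)"
    by (rule bip_odd_cycle[OF f assms(5) symB assms(6) p(1-3)]) (use p assms k4 in auto)
  moreover have "2 * (k - 1) + 1 = 2 * k - 1" using k4 by simp
  ultimately show False using assms(2-4) has_cycle_mono by (metis le_sup_iff)
qed

lemma red_splitI:
  assumes "S \<subseteq> A" "\<not> has_cycle B S (2 * k - 1)"
    "S1 \<subseteq> S" "S2 \<subseteq> S" "S1 \<inter> S2 = {}" "\<And>p q. p \<in> S1 \<Longrightarrow> q \<in> S2 \<Longrightarrow> \<not> R p q"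
    "k + 1 \<le> card S1" "k + 1 \<le> card S2" "card S \<le> card S1 + card S2 + 1"
  shows "red_split S S1 S2"
proof -
  have "complete_on R S1" by (rule blue_bip_clique[OF assms(1-6)]) (use assms in auto)
  moreover have "complete_on R S2" by (rule blue_bip_clique[OF assms(1,2,4,3)]) (use assms Bs in auto)
  ultimately show ?thesis using assms by (auto simp: red_split_def)
qed

text \<open>One vertex has to be given up to destroy the star. If \<open>X\<close> is too small to
  lose \<open>z\<close>, then \<open>Y\<close> is a red clique with \<open>2 * k - 2\<close>
  vertices, so \<open>z\<close> has at most one red neighbour in \<open>Y\<close>, and that
  neighbour is given up instead.\<close>

lemma red_split_star:
  assumes S: "S \<subseteq> A" "\<not> has_cycle B S (2 * k - 1)" "3 * k - 1 \<le> card S"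
    and XY: "X \<union> Y = S" "X \<inter> Y = {}" "card X \<le> 2 * k - 2" "card Y \<le> 2 * k - 2"
    and z: "z \<in> X" and star: "\<And>x y. x \<in> X \<Longrightarrow> y \<in> Y \<Longrightarrow> R x y \<Longrightarrow> x = z"
  shows "\<exists>S1 S2. red_split S S1 S2"
proof -
  have f: "finite X" "finite Y" using XY(1) S(1) by (auto intro!: finite_sub)
  have c: "card S = card X + card Y" using card_Un_disjoint[OF f XY(2)] XY(1) by simp
  show ?thesis
  proof (cases "k + 2 \<le> card X")
    case True
    have "red_split S (X - {z}) Y"
    proof (rule red_splitI[OF S(1,2)])
      show "k + 1 \<le> card (X - {z})" "card S \<le> card (X - {z}) + card Y + 1" using True c z f by auto
      show "k + 1 \<le> card Y" using S(3) c XY k4 by linarith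
      show "\<not> R p q" if "p \<in> X - {z}" "q \<in> Y" for p q using star that by blast
    qed (use XY in auto)
    then show ?thesis by blast
  next
    case False
    have cX: "card X = k + 1" "card Y = 2 * k - 2" using False S(3) c XY(3,4) k4 by linarith+
    have cl: "complete_on R Y"
    proof (rule blue_bip_clique[OF S(1,2), of Y "X - {z}"])
      show "\<not> R p q" if "p \<in> Y" "q \<in> X - {z}" for p q using star[of q p] that Rs by blast
      show "k \<le> card Y" "k - 1 \<le> card (X - {z})" using cX z f k4 by auto
    qed (use XY in auto)
    have one: "y = y'" if h: "y \<in> Y" "y' \<in> Y" "R z y" "R z y'" for y y'
    proof (rule ccontr)
      assume ne: "y \<noteq> y'"
      have "2 \<le> 2 * k - 2" "2 * k - 2 \<le> card Y" using cX k4 by simp_all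
      then obtain ps where ps: "pth R ps y y'" "set ps \<subseteq> Y" "length ps = 2 * k - 2"
        using clique_path[OF f(2) cl sym h(1,2) ne] by blast
      have p: "pth R (ps @ [z]) y z" by (rule pth_snoc[OF ps(1) _ Rs[OF h(4)]]) (use ps z XY in auto)
      have "has_cycle R A (2 * k - 1)"
        by (rule has_cycle_close[OF p h(3)]) (use ps z XY S k4 in auto)
      then show False using no_red by blast
    qed
    obtain W where W: "W \<subseteq> Y" "card Y \<le> card W + 1" "\<And>y. y \<in> W \<Longrightarrow> \<not> R z y"
    proof (cases "\<exists>y\<in>Y. R z y")
      case True
      then obtain y where y: "y \<in> Y" "R z y" by blast
      show ?thesis by (rule that[of "Y - {y}"]) (use y one f in \<open>auto simp: card_Diff_singleton\<close>)
    next
      case False then show ?thesis using that[of Y] by auto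
    qed
    have "red_split S X W"
    proof (rule red_splitI[OF S(1,2)])
      show "k + 1 \<le> card X" "card S \<le> card X + card W + 1" "k + 1 \<le> card W" using cX c W(2) k4 by linarith+
      show "\<not> R p q" if "p \<in> X" "q \<in> W" for p q using star[of p q] that W by blast
    qed (use XY W in auto)
    then show ?thesis by blast
  qed
qed

text \<open>The biclique from \<open>mono_biclique\<close> must be blue, and its sides are red
  cliques. Every other vertex is red to all of one side, so \<open>S\<close> falls into two parts
  grown around the sides, with hardly any red edge between them.\<close>

lemma red_split_exists:
  assumes S: "S \<subseteq> A" "\<not> has_cycle B S (2 * k - 1)" "3 * k - 1 \<le> card S"
  shows "\<exists>S1 S2. red_split S S1 S2"
proof -
  have fS: "finite S" using S finite_sub by blast
  have nR: "\<not> has_cycle R S (2 * k - 1)" using redE S(1) by blast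
  have "\<not> has_biclique R S k"
  proof
    assume "has_biclique R S k"
    then obtain P Q where "P \<subseteq> S" "Q \<subseteq> S" "P \<inter> Q = {}" "card P = k" "card Q = k" "\<And>p q. p \<in> P \<Longrightarrow> q \<in> Q \<Longrightarrow> R p q"
      by (rule has_bicliqueE) (rule that)
    then have "has_biclique R A k" using S(1) by (intro has_bicliqueI[of P A Q]) auto
    then show False using no_red_biclique by blast
  qed
  then have "has_biclique B S k" using mono_biclique[OF sym fS S(3) k4 nR S(2)] by blast
  then obtain P Q where PQ: "P \<subseteq> S" "Q \<subseteq> S" "P \<inter> Q = {}" "card P = k" "card Q = k" "\<And>p q. p \<in> P \<Longrightarrow> q \<in> Q \<Longrightarrow> \<not> R p q"
    by (rule has_bicliqueE) (rule that)
  have f: "finite P" "finite Q" using PQ fS by (auto intro: finite_subset)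
  have clP: "complete_on R P" by (rule blue_bip_clique[OF S(1,2) PQ(1-3,6)]) (use PQ in auto)
  have clQ: "complete_on R Q" by (rule blue_bip_clique[OF S(1,2) PQ(2,1)]) (use PQ Bs in auto)
  define X where "X = {y \<in> S. \<forall>c\<in>P. y \<noteq> c \<longrightarrow> R y c}"
  define Y where "Y = S - X"
  have XY: "X \<union> Y = S" "X \<inter> Y = {}" by (auto simp: X_def Y_def)
  have PX: "P \<subseteq> X" using PQ(1) clP by (auto simp: X_def complete_on_def)
  obtain p0 where p0: "p0 \<in> P" using PQ k4 by fastforce
  have QY: "Q \<subseteq> Y"
  proof
    fix q assume q: "q \<in> Q"
    then have "\<not> R q p0" "q \<noteq> p0" using PQ(3,6) p0 Bs by auto
    then show "q \<in> Y" using p0 q PQ(2) by (auto simp: X_def Y_def)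
  qed
  have coX: "R x c" if "x \<in> X" "c \<in> P" "c \<noteq> x" for x c using that by (auto simp: X_def)
  have coY: "R y c" if h: "y \<in> Y" "c \<in> Q" "c \<noteq> y" for y c
  proof (rule ccontr)
    assume n: "\<not> R y c"
    have yQ: "y \<notin> Q" using n complete_onD[OF clQ _ h(2)] h(3) by blast
    have yP: "y \<notin> P" using h(1) PX by (auto simp: Y_def)
    obtain p where p: "p \<in> P" "\<not> R y p" using h(1) by (auto simp: X_def Y_def)
    have "has_cycle B (insert y (P \<union> Q)) (2 * (k - 1) + 1)"
      by (rule bip_apex_cycle[OF f PQ(3) symB PQ(6) p(1) h(2) yP yQ p(2) n]) (use PQ k4 in auto)
    moreover have "2 * (k - 1) + 1 = 2 * k - 1" using k4 by simp
    moreover have "insert y (P \<union> Q) \<subseteq> S" using PQ h(1) by (auto simp: Y_def)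
    ultimately show False using S(2) has_cycle_mono by metis
  qed
  have fXY: "finite X" "finite Y" using fS by (auto simp: X_def Y_def)
  have small: "card D \<le> 2 * k - 2" if "D \<subseteq> A" "finite D" "C \<subseteq> D" "card C = k" "\<And>y c. y \<in> D \<Longrightarrow> c \<in> C \<Longrightarrow> c \<noteq> y \<Longrightarrow> R y c" for D C
  proof (rule ccontr)
    assume "\<not> ?thesis"
    then have "has_cycle R D (2 * k - 1)"
      using that k4 by (intro core_cycle[of R D C k] sym) auto
    then show False using redE that(1) by blast
  qed
  have cX: "card X \<le> 2 * k - 2" by (rule small[OF _ fXY(1) PX PQ(4) coX]) (use S in \<open>auto simp: X_def\<close>)
  have cY: "card Y \<le> 2 * k - 2" by (rule small[OF _ fXY(2) QY PQ(5) coY]) (use S in \<open>auto simp: Y_def\<close>)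
  have cS: "card S = card X + card Y" using card_Un_disjoint[OF fXY XY(2)] XY(1) by simp
  \<comment> \<open>Two disjoint red cross edges would join a path with \<open>k\<close> vertices
    around \<open>P\<close> to one with \<open>k - 1\<close> vertices around
    \<open>Q\<close>.\<close>
  have cross: "\<not> R x y \<or> \<not> R x' y'" if h: "x \<in> X" "x' \<in> X" "y \<in> Y" "y' \<in> Y" "x \<noteq> x'" "y \<noteq> y'" for x x' y y'
  proof (rule ccontr)
    assume n: "\<not> ?thesis"
    have dif: "k - 2 \<le> card (V - {a, b})" if "finite V" "card V = k" for V and a b :: 'a
    proof -
      have "card V - card {a, b} \<le> card (V - {a, b})" by (rule diff_card_le_card_Diff) simp
      moreover have "card {a, b} \<le> 2" by (cases "a = b") auto
      ultimately show ?thesis using that by linarith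
    qed
    have "\<exists>xs. pth R xs x x' \<and> set xs \<subseteq> P \<union> {x, x'} \<and> length xs = (k - 2) + 2"
      by (rule core_path[OF f(1) clP sym h(5)]) (use coX h k4 dif[OF f(1) PQ(4)] in auto)
    then obtain xs where xs: "pth R xs x x'" "set xs \<subseteq> P \<union> {x, x'}" "length xs = (k - 2) + 2" by blast
    have d3: "k - 3 \<le> card (Q - {y', y})" using dif[OF f(2) PQ(5), of y' y] by simp
    have "\<exists>ys. pth R ys y' y \<and> set ys \<subseteq> Q \<union> {y', y} \<and> length ys = (k - 3) + 2"
      by (rule core_path[OF f(2) clQ sym h(6)[symmetric]]) (use coY h k4 d3 in auto)
    then obtain ys where ys: "pth R ys y' y" "set ys \<subseteq> Q \<union> {y', y}" "length ys = (k - 3) + 2" by blast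
    have sX: "set xs \<subseteq> X" "set ys \<subseteq> Y" using xs ys h PX QY by auto
    have p: "pth R (xs @ ys) x y"
      by (rule pth_append[OF xs(1) ys(1)]) (use sX XY n in auto)
    have "has_cycle R S (2 * k - 1)"
      by (rule has_cycle_close[OF p Rs]) (use n sX XY xs ys k4 in auto)
    then show False using nR by blast
  qed
  show ?thesis
  proof (rule star_cases[of X Y R, OF cross], assumption+, goal_cases none left right)
    case none
    have "red_split S X Y"
      by (rule red_splitI[OF S(1,2)]) (use XY none cS cX cY S(3) k4 in auto)
    then show ?case by blast
  next
    case (left e0 f0)
    show ?case by (rule red_split_star[OF S XY cX cY left(1)]) (use left(4) in blast)
  next
    case (right e0 f0)
    have "Y \<union> X = S" "Y \<inter> X = {}" using XY by auto
    then show ?case by (rule red_split_star[OF S _ _ cY cX right(2)]) (use right(4)[OF _ _ Rs] in blast)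
  qed
qed

end

section \<open>Large blue degree\<close>

text \<open>Models a cycle under construction. It starts with the vertices of the clique
  \<open>Y\<close> as one-vertex paths; as all ends stay in \<open>Y\<close>, the remaining paths
  can be joined at any time.\<close>

definition path_system :: "('a \<Rightarrow> 'a \<Rightarrow> bool) \<Rightarrow> 'a set \<Rightarrow> 'a set \<Rightarrow> 'a list set \<Rightarrow> bool" where
  "path_system R Y W PS \<longleftrightarrow> finite PS \<and>
     (\<forall>P\<in>PS. P \<noteq> [] \<and> distinct P \<and> successively R P \<and> hd P \<in> Y \<and> last P \<in> Y) \<and>
     (\<forall>P\<in>PS. \<forall>Q\<in>PS. P \<noteq> Q \<longrightarrow> set P \<inter> set Q = {}) \<and> \<Union>(set ` PS) = W"

text \<open>The list \<open>ts\<close> is empty when two ends are joined by an edge of the clique,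
  and a single vertex when they are joined through a vertex outside it.\<close>

lemma path_system_merge:
  assumes sy: "symp R" and PS: "path_system R Y W PS" and PQ: "P \<in> PS" "Q \<in> PS" "P \<noteq> Q"
    and ts: "set ts \<inter> W = {}" "distinct ts" "successively R (last P # ts @ [last Q])"
  shows "\<exists>PS'. path_system R Y (W \<union> set ts) PS' \<and> card PS = Suc (card PS')"
proof -
  define X where "X = P @ ts @ rev Q"
  have fin: "finite PS" and dj: "\<And>P Q. P \<in> PS \<Longrightarrow> Q \<in> PS \<Longrightarrow> P \<noteq> Q \<Longrightarrow> set P \<inter> set Q = {}"
    and W: "\<Union>(set ` PS) = W"
    and ok: "\<And>P. P \<in> PS \<Longrightarrow> P \<noteq> [] \<and> distinct P \<and> successively R P \<and> hd P \<in> Y \<and> last P \<in> Y"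
    using PS by (auto simp: path_system_def)
  have PQo: "P \<noteq> []" "distinct P" "successively R P" "hd P \<in> Y" "Q \<noteq> []" "distinct Q" "successively R Q" "hd Q \<in> Y"
    using ok PQ by auto
  have sub: "set P \<subseteq> W" "set Q \<subseteq> W" using W PQ by auto
  have sX: "set X = set P \<union> set ts \<union> set Q" by (auto simp: X_def)
  have "successively R (rev Q)"
  proof -
    have "successively (\<lambda>x y. R y x) Q" using PQo(7) sy by (simp add: successively_conv_nth sympD)
    then show ?thesis by simp
  qed
  moreover have "hd (rev Q) = last Q" using PQo by (simp add: hd_rev)
  ultimately have "successively R X"
    using ts(3) PQo(1,3,5) by (cases "ts = []") (auto simp: X_def successively_append_iff successively_Cons)
  moreover have "distinct X"
    using PQo dj[OF PQ] ts(1,2) sub by (auto simp: X_def)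
  moreover have "hd X \<in> Y" "last X \<in> Y" "X \<noteq> []" using PQo by (auto simp: X_def last_rev)
  ultimately have okX: "X \<noteq> [] \<and> distinct X \<and> successively R X \<and> hd X \<in> Y \<and> last X \<in> Y" by blast
  have djX: "set X \<inter> set Z = {}" if "Z \<in> PS" "Z \<noteq> P" "Z \<noteq> Q" for Z
  proof -
    have "set Z \<subseteq> W" using W that by auto
    then show ?thesis using dj[OF that(1) PQ(1) that(2)] dj[OF that(1) PQ(2) that(3)] ts(1) unfolding sX by blast
  qed
  have XN: "X \<notin> PS - {P, Q}"
    using djX[of X] okX by (metis Diff_iff inf.idem insertI1 insertI2 set_empty)
  define PS' where "PS' = insert X (PS - {P, Q})"
  have "path_system R Y (W \<union> set ts) PS'"
    unfolding path_system_def
  proof (intro conjI)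
    show "finite PS'" using fin by (simp add: PS'_def)
    show "\<forall>P\<in>PS'. P \<noteq> [] \<and> distinct P \<and> successively R P \<and> hd P \<in> Y \<and> last P \<in> Y"
      using okX ok by (simp add: PS'_def)
    show "\<forall>P\<in>PS'. \<forall>Q\<in>PS'. P \<noteq> Q \<longrightarrow> set P \<inter> set Q = {}"
      using djX dj by (auto simp: PS'_def)
    show "\<Union>(set ` PS') = W \<union> set ts"
      unfolding W[symmetric] PS'_def using sX PQ by auto
  qed
  moreover have "card PS = Suc (card PS')"
  proof -
    have "card PS' = Suc (card (PS - {P, Q}))" using XN fin by (simp add: PS'_def)
    moreover have "card (PS - {P, Q}) = card PS - 2" using PQ fin by (simp add: card_Diff_subset)
    moreover have "2 \<le> card PS" using card_mono[of PS "{P, Q}"] PQ fin by simp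
    ultimately show ?thesis by simp
  qed
  ultimately show ?thesis by blast
qed

lemma path_system_single:
  assumes sy: "symp R" and cl: "complete_on R Y"
  shows "path_system R Y W PS \<Longrightarrow> card PS = Suc n \<Longrightarrow> \<exists>P. path_system R Y W {P}"
proof (induction n arbitrary: PS)
  case 0
  then show ?case by (metis One_nat_def card_1_singletonE)
next
  case (Suc n)
  obtain P where P: "P \<in> PS" using Suc.prems(2) by fastforce
  have fin: "finite PS" using Suc.prems by (simp add: path_system_def)
  obtain Q where Q: "Q \<in> PS" "Q \<noteq> P" using pick_other[OF fin, of P] Suc.prems(2) by auto
  have l: "last P \<in> Y" "last Q \<in> Y" "last P \<in> set P" "last Q \<in> set Q" "set P \<inter> set Q = {}"
    using Suc.prems(1) P Q by (auto simp: path_system_def)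
  then have "last P \<noteq> last Q" by auto
  then have "R (last P) (last Q)" by (rule complete_onD[OF cl l(1,2)])
  then obtain PS' where "path_system R Y W PS'" "card PS = Suc (card PS')"
    using path_system_merge[OF sy Suc.prems(1) P Q(1) Q(2)[symmetric], of "[]"] by auto
  then show ?case using Suc by auto
qed

lemma path_system_cycle:
  assumes sy: "symp R" and cl: "complete_on R Y" and PS: "path_system R Y W PS" and W: "3 \<le> card W"
  shows "has_cycle R W (card W)"
proof -
  have "PS \<noteq> {}" using PS W by (auto simp: path_system_def)
  then obtain n where "card PS = Suc n" using PS by (metis card_gt_0_iff gr0_conv_Suc path_system_def)
  then obtain P where P: "path_system R Y W {P}" using path_system_single[OF sy cl PS] by blast
  then have p: "pth R P (hd P) (last P)" and h: "hd P \<in> Y" "last P \<in> Y" and W': "set P = W" and d: "distinct P" "P \<noteq> []"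
    by (auto simp: path_system_def pth_def)
  have len: "length P = card W" using distinct_card[OF d(1)] W' by simp
  have "last P \<noteq> hd P"
    using len W d by (simp add: last_conv_nth hd_conv_nth nth_eq_iff_index_eq)
  then have "R (last P) (hd P)" using complete_onD[OF cl h(2,1)] by blast
  then show ?thesis using has_cycle_close[OF p _ len W] W' by blast
qed

text \<open>Among the path ends in \<open>Y\<close>, the unused neighbours of any four number more than \<open>card T\<close> with
  multiplicity, so two of the paths can be joined through a vertex of \<open>T\<close>.\<close>
lemma clique_insertion:
  assumes sy: "symp R" and Y: "finite Y" "complete_on R Y" and T: "finite T" "Y \<inter> T = {}"
    and deg: "\<And>y. y \<in> Y \<Longrightarrow> q + p \<le> card {t \<in> T. R y t}"
    and c: "p + 3 \<le> card Y" "card T < 4 * (q + 1)"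
  shows "has_cycle R (Y \<union> T) (card Y + p)"
proof -
  have "\<exists>U PS. U \<subseteq> T \<and> card U = p' \<and> path_system R Y (Y \<union> U) PS \<and> card PS + p' = card Y" if "p' \<le> p" for p'
    using that
  proof (induction p')
    case 0
    have "path_system R Y Y ((\<lambda>y. [y]) ` Y)" using Y by (auto simp: path_system_def)
    moreover have "card ((\<lambda>y. [y]) ` Y) = card Y" by (rule card_image) (auto simp: inj_on_def)
    ultimately have "{} \<subseteq> T \<and> card ({} :: 'a set) = 0 \<and> path_system R Y (Y \<union> {}) ((\<lambda>y. [y]) ` Y) \<and>
        card ((\<lambda>y. [y]) ` Y) + 0 = card Y" by simp
    then show ?case by blast
  next
    case (Suc p')
    then obtain U PS where U: "U \<subseteq> T" "card U = p'" and PS: "path_system R Y (Y \<union> U) PS" "card PS + p' = card Y"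
      by auto
    have fU: "finite U" using U T finite_subset by blast
    have "4 \<le> card PS" using PS(2) c(1) Suc.prems by linarith
    then obtain F where F: "F \<subseteq> PS" "card F = 4" "finite F" by (rule obtain_subset_with_card_n)
    define N where "N P = {t \<in> T - U. R (last P) t}" for P
    have cN: "q + 1 \<le> card (N P)" if "P \<in> F" for P
    proof -
      have "last P \<in> Y" using PS(1) F that by (auto simp: path_system_def)
      then have "q + p \<le> card {t \<in> T. R (last P) t}" by (rule deg)
      moreover have "N P = {t \<in> T. R (last P) t} - U" by (auto simp: N_def)
      moreover have "card {t \<in> T. R (last P) t} - card U \<le> card ({t \<in> T. R (last P) t} - U)"
        by (rule diff_card_le_card_Diff[OF fU])
      ultimately show ?thesis using U(2) Suc.prems by simp
    qed
    have fN: "finite (N P)" for P using T by (simp add: N_def)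
    have "\<not> (\<forall>P\<in>F. \<forall>Q\<in>F. P \<noteq> Q \<longrightarrow> N P \<inter> N Q = {})"
    proof
      assume d: "\<forall>P\<in>F. \<forall>Q\<in>F. P \<noteq> Q \<longrightarrow> N P \<inter> N Q = {}"
      have "card (\<Union>P\<in>F. N P) = (\<Sum>P\<in>F. card (N P))"
        by (rule card_UN_disjoint[OF F(3)]) (use fN d in auto)
      also have "\<dots> \<ge> (\<Sum>P\<in>F. q + 1)" by (rule sum_mono) (rule cN)
      finally have "4 * (q + 1) \<le> card (\<Union>P\<in>F. N P)" using F(2) by simp
      also have "\<dots> \<le> card T" by (rule card_mono[OF T(1)]) (auto simp: N_def)
      finally show False using c(2) by simp
    qed
    then obtain P Q t where PQ: "P \<in> F" "Q \<in> F" "P \<noteq> Q" "t \<in> N P" "t \<in> N Q" by blast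
    have t: "t \<in> T" "t \<notin> U" "R (last P) t" "R (last Q) t" "t \<notin> Y" using PQ T by (auto simp: N_def)
    have "R t (last Q)" using sympD[OF sy t(4)] .
    then have "\<exists>PS'. path_system R Y (Y \<union> U \<union> set [t]) PS' \<and> card PS = Suc (card PS')"
      by (intro path_system_merge[OF sy PS(1) _ _ PQ(3)]) (use PQ F t in auto)
    then obtain PS' where PS': "path_system R Y (Y \<union> U \<union> set [t]) PS'" "card PS = Suc (card PS')" by blast
    have "Y \<union> U \<union> set [t] = Y \<union> insert t U" by simp
    then have "path_system R Y (Y \<union> insert t U) PS'" using PS'(1) by metis
    moreover have "card (insert t U) = Suc p'" using t fU U by simp
    moreover have "card PS' + Suc p' = card Y" using PS(2) PS'(2) by simp
    ultimately show ?case using U(1) t(1) by (intro exI[of _ "insert t U"] exI[of _ PS']) simp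
  qed
  then obtain U PS where U: "U \<subseteq> T" "card U = p" "path_system R Y (Y \<union> U) PS" by blast
  have "card (Y \<union> U) = card Y + p"
    using U Y T finite_subset[OF U(1)] by (subst card_Un_disjoint) auto
  then have "has_cycle R (Y \<union> U) (card Y + p)" using path_system_cycle[OF sy Y(2) U(3)] c(1) by simp
  then show ?thesis using has_cycle_mono U(1) by (metis Un_mono order_refl)
qed

context no_wheel
begin

definition blue_nb :: "'a \<Rightarrow> 'a set" where "blue_nb x = {y \<in> A. y \<noteq> x \<and> \<not> R x y}"
definition red_nb :: "'a \<Rightarrow> 'a set" where "red_nb x = {y \<in> A. y \<noteq> x \<and> R x y}"

lemma nb_card:
  assumes "x \<in> A" shows "card (blue_nb x) + card (red_nb x) = 6 * k - 6"
proof -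
  have "card (blue_nb x \<union> red_nb x) = card (blue_nb x) + card (red_nb x)"
    by (rule card_Un_disjoint) (auto simp: blue_nb_def red_nb_def finA)
  moreover have "blue_nb x \<union> red_nb x = A - {x}" by (auto simp: blue_nb_def red_nb_def)
  ultimately show ?thesis using assms finA cardA by simp
qed

lemma blue_nb_split:
  assumes "x \<in> A" "3 * k - 1 \<le> card (blue_nb x)"
  shows "\<exists>S1 S2. red_split (blue_nb x) S1 S2"
  by (rule red_split_exists) (use assms no_blue in \<open>auto simp: blue_nb_def\<close>)

text \<open>Otherwise every vertex of \<open>S2\<close> has large red degree, necessarily towards
  the vertices outside the split, and inserting some of these into the clique \<open>S2\<close>
  yields a red rim.\<close>

lemma split_wide:
  assumes x: "x \<in> A" "3 * k - 1 \<le> card (blue_nb x)" and sp: "red_split (blue_nb x) S1 S2"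
  shows "\<exists>s\<in>S2. 3 * k - 1 \<le> card (blue_nb s)"
proof (rule ccontr)
  assume n: "\<not> ?thesis"
  have sub: "S1 \<subseteq> A" "S2 \<subseteq> A" "S1 \<inter> S2 = {}" and cl: "complete_on R S2"
    and b: "\<And>x y. x \<in> S1 \<Longrightarrow> y \<in> S2 \<Longrightarrow> \<not> R x y"
    and c: "k + 1 \<le> card S1" "k + 1 \<le> card S2" "card (blue_nb x) \<le> card S1 + card S2 + 1"
    using sp by (auto simp: red_split_def blue_nb_def)
  have fin: "finite S1" "finite S2" using sub finite_sub by auto
  define T where "T = A - (S1 \<union> S2)"
  have cU: "card (S1 \<union> S2) = card S1 + card S2" using card_Un_disjoint[OF fin sub(3)] .
  have "card T = card A - card (S1 \<union> S2)"
    unfolding T_def using sub fin by (intro card_Diff_subset) auto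
  then have cT: "card T \<le> 3 * k - 3" using cU c(3) x(2) cardA k4 by simp
  have c2: "card S2 \<le> 2 * k - 2" by (rule red_clique_card[OF sub(2) cl])
  \<comment> \<open>Of at least \<open>3 * k - 4\<close> red neighbours, none lies in
    \<open>S1\<close> and at most \<open>card S2 - 1\<close> in \<open>S2\<close>. With
    \<open>p = 2 * k - 1 - card S2\<close> this leaves \<open>(k - 2) + p\<close> in
    \<open>T\<close>, and \<open>card T <= 3 * k - 3 < 4 * (k - 1)\<close>.\<close>
  have "has_cycle R (S2 \<union> T) (card S2 + (2 * k - 1 - card S2))"
  proof (rule clique_insertion[OF sym fin(2) cl, where q = "k - 2"])
    show "finite T" "S2 \<inter> T = {}" using finA by (auto simp: T_def)
    show "2 * k - 1 - card S2 + 3 \<le> card S2" "card T < 4 * (k - 2 + 1)" using c c2 cT k4 by simp_all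
    fix y assume y: "y \<in> S2"
    have "card (blue_nb y) \<le> 3 * k - 2" using n y by force
    then have r: "3 * k - 4 \<le> card (red_nb y)" using nb_card[of y] y sub k4 by auto
    have "red_nb y \<subseteq> (S2 - {y}) \<union> {t \<in> T. R y t}"
    proof
      fix t assume t: "t \<in> red_nb y"
      then have "t \<notin> S1" using b[of t y] y Rs[of y t] by (auto simp: red_nb_def)
      then show "t \<in> (S2 - {y}) \<union> {t \<in> T. R y t}" using t by (auto simp: red_nb_def T_def)
    qed
    then have "card (red_nb y) \<le> card ((S2 - {y}) \<union> {t \<in> T. R y t})"
      using fin finA by (intro card_mono) (auto simp: T_def)
    also have "\<dots> \<le> card (S2 - {y}) + card {t \<in> T. R y t}" by (rule card_Un_le)
    finally show "k - 2 + (2 * k - 1 - card S2) \<le> card {t \<in> T. R y t}"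
      using r y fin c c2 k4 by simp
  qed
  moreover have "card S2 + (2 * k - 1 - card S2) = 2 * k - 1" using c2 by simp
  ultimately show False using redE[of "S2 \<union> T"] sub by (auto simp: T_def)
qed

lemma red_clique_in_split:
  assumes "red_split S S1 S2" "complete_on R C" "C \<subseteq> S1 \<union> S2" shows "C \<subseteq> S1 \<or> C \<subseteq> S2"
proof (rule ccontr)
  assume "\<not> ?thesis"
  then obtain a b where "a \<in> C" "a \<in> S1" "b \<in> C" "b \<in> S2" using assms(3) by blast
  moreover have "a \<noteq> b" "\<not> R a b" using assms(1) calculation by (auto simp: red_split_def)
  ultimately show False using complete_onD[OF assms(2)] by blast
qed

text \<open>The split around \<open>x\<close> gives two classes that are blue to each other. A
  vertex \<open>s\<close> of one class is again of large blue degree and blue to the other class, so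
  the split around \<open>s\<close> supplies a third class.\<close>

lemma blue_degree:
  assumes "x \<in> A" shows "card (blue_nb x) \<le> 3 * k - 2"
proof (rule ccontr)
  assume "\<not> ?thesis"
  then have x: "3 * k - 1 \<le> card (blue_nb x)" by simp
  obtain S1 S2 where sp: "red_split (blue_nb x) S1 S2" using blue_nb_split[OF assms x] by blast
  obtain s where s: "s \<in> S2" "3 * k - 1 \<le> card (blue_nb s)" using split_wide[OF assms x sp] by blast
  have h: "S1 \<subseteq> A" "S2 \<subseteq> A" "S1 \<inter> S2 = {}" "complete_on R S1" "complete_on R S2"
    and b: "\<And>x y. x \<in> S1 \<Longrightarrow> y \<in> S2 \<Longrightarrow> \<not> R x y"
    and c: "k + 1 \<le> card S1" "k + 1 \<le> card S2"
    using sp by (auto simp: red_split_def blue_nb_def)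
  obtain V1 V2 where sp': "red_split (blue_nb s) V1 V2" using blue_nb_split[of s] s h(2) by blast
  have S1s: "S1 \<subseteq> blue_nb s" using h b s(1) Bs by (auto simp: blue_nb_def)
  define Z where "Z = blue_nb s - (V1 \<union> V2)"
  have fb: "finite (blue_nb s)" using finA by (simp add: blue_nb_def)
  have V: "V1 \<subseteq> blue_nb s" "V2 \<subseteq> blue_nb s" "V1 \<inter> V2 = {}" "card (blue_nb s) \<le> card V1 + card V2 + 1"
    using sp' by (auto simp: red_split_def)
  have "card Z \<le> 1"
  proof -
    have "card (V1 \<union> V2) = card V1 + card V2"
      using V fb by (intro card_Un_disjoint) (auto intro: finite_subset)
    moreover have "card Z = card (blue_nb s) - card (V1 \<union> V2)"
      unfolding Z_def using V fb by (intro card_Diff_subset) (auto intro: finite_subset)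
    ultimately show ?thesis using V(4) by simp
  qed
  \<comment> \<open>\<open>W\<close> is the part of the second split that contains \<open>S1\<close>
    up to \<open>Z\<close>. The other part \<open>U\<close> is blue to \<open>S1 - Z\<close>, and it
    avoids \<open>S2\<close>, which is red to \<open>s\<close> apart from \<open>s\<close> itself.
    It remains to make \<open>U\<close> and \<open>S2\<close> blue to each other, at the cost of one
    star centre.\<close>
  have main: False if sp2: "red_split (blue_nb s) U W" and SU: "S1 - Z \<subseteq> W" and UZ: "U \<inter> Z = {}" for U W
  proof -
    have U: "U \<subseteq> blue_nb s" "U \<inter> W = {}" "k + 1 \<le> card U" "complete_on R U" "\<And>u w. u \<in> U \<Longrightarrow> w \<in> W \<Longrightarrow> \<not> R u w"
      using sp2 by (auto simp: red_split_def)
    have UA: "U \<subseteq> A" using U(1) by (auto simp: blue_nb_def)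
    have fU: "finite U" "finite S2" "finite S1" using UA h finite_sub by auto
    have US1: "U \<inter> S1 = {}" using SU UZ U(2) by blast
    have US2: "U \<inter> S2 = {}"
      using U(1) complete_onD[OF h(5) s(1)] by (auto simp: blue_nb_def)
    define C1 where "C1 = S1 - Z"
    have C1: "C1 \<subseteq> S1" "C1 \<subseteq> W" using SU by (auto simp: C1_def)
    have cC1: "k \<le> card C1"
      using c(1) \<open>card Z \<le> 1\<close> diff_card_le_card_Diff[of Z S1] fb by (simp add: C1_def Z_def)
    have tri: False if C: "C2 \<subseteq> S2" "C3 \<subseteq> U" "k \<le> card C2" "k \<le> card C3" "\<And>x y. x \<in> C2 \<Longrightarrow> y \<in> C3 \<Longrightarrow> \<not> R x y" for C2 C3
    proof (rule no_blue_tripartite[of C1 C2 C3])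
      show "\<not> R x y" if "x \<in> C1" "y \<in> C2" for x y using b that C(1) C1(1) by blast
      show "\<not> R x y" if "x \<in> C1" "y \<in> C3" for x y
      proof (rule Bs, rule U(5))
        show "y \<in> U" "x \<in> W" using that C(2) C1(2) by blast+
      qed
      show "C1 \<subseteq> A" "C2 \<subseteq> A" "C3 \<subseteq> A" using C1 C h UA by blast+
      show "C1 \<inter> C2 = {}" "C1 \<inter> C3 = {}" "C2 \<inter> C3 = {}" using C1 C h(3) US1 US2 by blast+
    qed (use C cC1 in auto)
    have cross: "\<not> R x y \<or> \<not> R x' y'"
      if e: "x \<in> S2" "x' \<in> S2" "y \<in> U" "y' \<in> U" "x \<noteq> x'" "y \<noteq> y'" for x x' y y'
    proof (rule ccontr)
      assume n: "\<not> ?thesis"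
      have "2 \<le> k" "k \<le> card S2" "2 \<le> k - 1" "k - 1 \<le> card U" using c(2) U(3) k4 by simp_all
      then obtain xs ys where xs: "pth R xs x x'" "set xs \<subseteq> S2" "length xs = k"
        and ys: "pth R ys y' y" "set ys \<subseteq> U" "length ys = k - 1"
        using clique_path[OF fU(2) h(5) sym e(1,2,5), of k] clique_path[OF fU(1) U(4) sym e(4,3) e(6)[symmetric], of "k - 1"]
        by blast
      have p: "pth R (xs @ ys) x y"
        by (rule pth_append[OF xs(1) ys(1)]) (use xs ys US2 n in auto)
      have "has_cycle R A (2 * k - 1)"
        by (rule has_cycle_close[OF p Rs]) (use n xs ys h UA k4 in auto)
      then show False using no_red by blast
    qed
    show False
    proof (rule star_cases[of S2 U R, OF cross], assumption+, goal_cases none left right)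
      case none
      show False by (rule tri[of S2 U]) (use none c U(3) in auto)
    next
      case (left e0 f0)
      show False
      proof (rule tri[of "S2 - {e0}" U])
        show "\<not> R x y" if "x \<in> S2 - {e0}" "y \<in> U" for x y using left(4) that by blast
      qed (use left(1) c U(3) fU in auto)
    next
      case (right e0 f0)
      show False
      proof (rule tri[of S2 "U - {f0}"])
        show "\<not> R x y" if "x \<in> S2" "y \<in> U - {f0}" for x y using right(4) that by blast
      qed (use right(2) c U(3) fU in auto)
    qed
  qed
  have "S1 - Z \<subseteq> V1 \<union> V2" using S1s by (auto simp: Z_def)
  then have "S1 - Z \<subseteq> V1 \<or> S1 - Z \<subseteq> V2"
    by (rule red_clique_in_split[OF sp' complete_on_subset[OF h(4)], rotated]) blast
  then show False
    using main[OF sp'] main[OF red_split_sym[OF sp']] by (auto simp: Z_def)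
qed

lemma red_degree: "x \<in> A \<Longrightarrow> 3 * k - 4 \<le> card (red_nb x)"
  using blue_degree[of x] nb_card[of x] k4 by linarith

end

section \<open>Dirac's theorem\<close>

lemma dirac:
  assumes sy: "symp R" and V: "finite V" "3 \<le> card V"
    and deg: "\<And>v. v \<in> V \<Longrightarrow> card V \<le> 2 * card {w \<in> V. w \<noteq> v \<and> R v w}"
  shows "has_cycle R V (card V)"
proof -
  define Pth where "Pth xs \<longleftrightarrow> xs \<noteq> [] \<and> distinct xs \<and> successively R xs \<and> set xs \<subseteq> V" for xs
  have len: "length xs \<le> card V" if "Pth xs" for xs
    using that card_mono[OF V(1), of "set xs"] distinct_card[of xs] by (simp add: Pth_def)
  have "V \<noteq> {}" using V by auto
  then obtain s where "s \<in> V" by blast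
  then have "Pth [s]" by (simp add: Pth_def)
  then obtain xs where xs: "Pth xs" and max: "\<And>ys. Pth ys \<Longrightarrow> length ys \<le> length xs"
    using ex_has_greatest_nat[of Pth "[s]" length "card V + 1"] len by (metis le_imp_less_Suc Suc_eq_plus1)
  define a where "a = hd xs" define b where "b = last xs" define m where "m = length xs"
  have d: "xs \<noteq> []" "distinct xs" "successively R xs" "set xs \<subseteq> V" using xs by (auto simp: Pth_def)
  have ab: "a \<in> set xs" "b \<in> set xs" "a = xs ! 0" "b = xs ! (m - 1)" "m > 0"
    using d by (auto simp: a_def b_def m_def hd_conv_nth last_conv_nth)
  have na: "w \<in> set xs" if "w \<in> V" "R a w" for w
  proof (rule ccontr)
    assume "w \<notin> set xs"
    then have "Pth (w # xs)" using d that sympD[OF sy that(2)] by (auto simp: Pth_def successively_Cons a_def)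
    then show False using max[of "w # xs"] by simp
  qed
  have nb: "w \<in> set xs" if "w \<in> V" "R b w" for w
  proof (rule ccontr)
    assume "w \<notin> set xs"
    then have "Pth (xs @ [w])" using d that by (auto simp: Pth_def successively_append_iff b_def)
    then show False using max[of "xs @ [w]"] by simp
  qed
  define I where "I = {i. Suc i < m \<and> R a (xs ! Suc i)}"
  define J where "J = {i. Suc i < m \<and> R b (xs ! i)}"
  have fin: "finite I" "finite J" by (auto simp: I_def J_def intro: finite_subset[of _ "{..<m}"])
  have "card {w \<in> V. w \<noteq> a \<and> R a w} \<le> card ((\<lambda>i. xs ! Suc i) ` I)"
  proof (rule card_mono)
    show "{w \<in> V. w \<noteq> a \<and> R a w} \<subseteq> (\<lambda>i. xs ! Suc i) ` I"
    proof
      fix w assume w: "w \<in> {w \<in> V. w \<noteq> a \<and> R a w}"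
      then obtain i where i: "i < m" "xs ! i = w" using na by (auto simp: in_set_conv_nth m_def)
      then obtain i' where "i = Suc i'" using w ab(3) by (cases i) auto
      then show "w \<in> (\<lambda>i. xs ! Suc i) ` I" using i w by (auto simp: I_def)
    qed
  qed (use fin in auto)
  also have "\<dots> \<le> card I" by (rule card_image_le[OF fin(1)])
  finally have cI: "card V \<le> 2 * card I" using deg[of a] ab(1) d(4) by auto
  have "card {w \<in> V. w \<noteq> b \<and> R b w} \<le> card ((\<lambda>i. xs ! i) ` J)"
  proof (rule card_mono)
    show "{w \<in> V. w \<noteq> b \<and> R b w} \<subseteq> (\<lambda>i. xs ! i) ` J"
    proof
      fix w assume w: "w \<in> {w \<in> V. w \<noteq> b \<and> R b w}"
      then obtain i where i: "i < m" "xs ! i = w" using nb by (auto simp: in_set_conv_nth m_def)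
      then have "i \<noteq> m - 1" using w ab(4) by auto
      then show "w \<in> (\<lambda>i. xs ! i) ` J" using i w by (auto simp: J_def)
    qed
  qed (use fin in auto)
  also have "\<dots> \<le> card J" by (rule card_image_le[OF fin(2)])
  finally have cJ: "card V \<le> 2 * card J" using deg[of b] ab(2) d(4) by auto
  have mV: "m \<le> card V" using len[OF xs] by (simp add: m_def)
  have IJ: "I \<union> J \<subseteq> {..<m - 1}" by (auto simp: I_def J_def)
  have "card (I \<union> J) \<le> m - 1" using card_mono[OF _ IJ] by simp
  \<comment> \<open>Both index sets have at least \<open>card V / 2\<close> elements among fewer
    than \<open>card V\<close> positions. A common index lets the path be closed by reversing its
    second part.\<close>
  then have "I \<inter> J \<noteq> {}"
    using card_Un_disjoint[OF fin] cI cJ mV ab(5) V(2) by fastforce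
  then obtain i where i: "Suc i < m" "R a (xs ! Suc i)" "R b (xs ! i)" by (auto simp: I_def J_def)
  have "card I \<le> m - 1" using card_mono[of "{..<m - 1}" I] IJ by simp
  then have m3: "3 \<le> m" and mb: "card V + 2 \<le> 2 * m" using cI V(2) ab(5) by linarith+
  have "set (take (Suc i) xs) \<inter> set (drop (Suc i) xs) = {}" using d(2) by (rule set_take_disj_set_drop_if_distinct) simp
  moreover have "pth R (take (Suc i) xs) a (xs ! i)"
    using d i by (auto simp: pth_def a_def m_def hd_conv_nth last_conv_nth successively_conv_nth)
  moreover have "pth R (drop (Suc i) xs) (xs ! Suc i) b"
    using d i by (auto simp: pth_def b_def m_def hd_drop_conv_nth successively_conv_nth)
  ultimately have p: "pth R (take (Suc i) xs @ rev (drop (Suc i) xs)) a (xs ! Suc i)"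
    using sympD[OF sy i(3)] by (intro pth_append[OF _ pth_rev[OF sy]]) auto
  have st: "set (take (Suc i) xs @ rev (drop (Suc i) xs)) = set xs"
    by (metis append_take_drop_id set_append set_rev)
  have "length (take (Suc i) xs @ rev (drop (Suc i) xs)) = m" using i by (simp add: m_def)
  from has_cycle_close[OF p sympD[OF sy i(2)] this m3]
  have cy: "has_cycle R (set xs) m" using st by blast
  have "m = card V"
  proof (rule ccontr)
    assume "m \<noteq> card V"
    have cm: "card (set xs) = m" using distinct_card[OF d(2)] by (simp add: m_def)
    then have "set xs \<noteq> V" using \<open>m \<noteq> card V\<close> by auto
    then obtain v where v: "v \<in> V" "v \<notin> set xs" using d(4) by blast
    obtain x where x: "cyf R x m" "range x \<subseteq> set xs" using has_cycle_cyf[OF cy] by blast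
    have rx: "range x = set xs" using card_subset_eq[OF _ x(2)] cyf_card_range[OF x(1)] cm by simp
    have "\<exists>w\<in>set xs. R v w"
    proof (rule ccontr)
      assume "\<not> ?thesis"
      then have "{w \<in> V. w \<noteq> v \<and> R v w} \<subseteq> V - insert v (set xs)" by auto
      then have "card {w \<in> V. w \<noteq> v \<and> R v w} \<le> card (V - insert v (set xs))" using V by (intro card_mono) auto
      also have "\<dots> = card V - (m + 1)" using v d(4) cm by (subst card_Diff_subset) auto
      finally show False using deg[OF v(1)] mb V(2) by linarith
    qed
    then obtain i where i: "R v (x i)" using rx by (metis imageE)
    have p: "pth R (map x [i..<i + m]) (x i) (x (i + m - 1))" by (rule arc[OF x(1)]) (use m3 in auto)
    have "pth R (v # map x [i..<i + m]) v (x (i + m - 1))"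
      by (rule pth_Cons[OF p _ i]) (use v rx in auto)
    then have "Pth (v # map x [i..<i + m])" using v d(4) rx by (auto simp: pth_def Pth_def)
    then show False using max[of "v # map x [i..<i + m]"] by (simp add: m_def)
  qed
  then show ?thesis using has_cycle_mono[OF cy d(4)] by simp
qed

context no_wheel
begin

text \<open>Pairwise disjoint sets would form a blue tripartite graph. A vertex shared by two of the
  sets is blue to all the others, hence a hub: if \<open>X\<close> and \<open>Z\<close> had
  \<open>k\<close> further vertices together, \<open>bip_wheel\<close> would make these a red
  clique, although a blue edge between \<open>X\<close> and \<open>Z\<close> remains.\<close>

lemma blue_triple:
  assumes sub: "X \<subseteq> A" "Y \<subseteq> A" "Z \<subseteq> A" and c: "k \<le> card X" "k \<le> card Y" "k \<le> card Z"
    and XY: "\<And>x y. x \<in> X \<Longrightarrow> y \<in> Y \<Longrightarrow> x \<noteq> y \<Longrightarrow> \<not> R x y"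
    and YZ: "\<And>x y. x \<in> Y \<Longrightarrow> y \<in> Z \<Longrightarrow> x \<noteq> y \<Longrightarrow> \<not> R x y"
    and XZ: "\<And>x y. x \<in> X \<Longrightarrow> y \<in> Z \<Longrightarrow> x \<noteq> y \<Longrightarrow> \<not> R x y"
    and u: "Y \<inter> (X \<union> Z) \<subseteq> {u}"
  shows "X = Z \<and> card X = k"
proof -
  have fin: "finite X" "finite Y" "finite Z" using sub finite_sub by auto
  have edge: "\<exists>a\<in>X \<union> Z - {w}. \<exists>b\<in>X \<union> Z - {w}. a \<noteq> b \<and> \<not> R a b" for w
  proof -
    obtain a where a: "a \<in> X" "a \<noteq> w" using pick_other[OF fin(1), of w] c(1) k4 by auto
    have "card {w, a} \<le> 2" by (simp add: card_insert_if)
    then have "2 \<le> card Z - card {w, a}" using c(3) k4 by simp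
    then have "2 \<le> card (Z - {w, a})" using diff_card_le_card_Diff[of "{w, a}" Z] by simp
    then have "Z - {w, a} \<noteq> {}" by (intro notI) simp
    then obtain b where b: "b \<in> Z" "b \<noteq> w" "b \<noteq> a" by blast
    then have "\<not> R a b" using XZ[OF a(1) b(1)] by simp
    moreover have "a \<in> X \<union> Z - {w}" "b \<in> X \<union> Z - {w}" "a \<noteq> b" using a b by auto
    ultimately show ?thesis by blast
  qed
  have hub: "card (X \<union> Z - {w}) < k"
    if w: "w \<in> A" "\<And>v. v \<in> X \<union> Z \<Longrightarrow> v \<noteq> w \<Longrightarrow> \<not> R w v" "\<And>v. v \<in> Y \<Longrightarrow> v \<noteq> w \<Longrightarrow> \<not> R w v"
      and d: "(Y - {w}) \<inter> (X \<union> Z) = {}" for w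
  proof (rule ccontr)
    assume n: "\<not> ?thesis"
    have "complete_on R (X \<union> Z - {w})"
    proof (rule bip_wheel[OF w(1), of _ "Y - {w}"])
      show "\<not> R p q" if "p \<in> X \<union> Z - {w}" "q \<in> Y - {w}" for p q
      proof -
        have "p \<noteq> q" "p \<in> X \<or> p \<in> Z" "q \<in> Y" using that d by auto
        then show ?thesis using XY[of p q] YZ[of q p] Bs[of q p] by metis
      qed
      show "k - 1 \<le> card (Y - {w})" using c(2) fin diff_card_le_card_Diff[of "{w}" Y] by simp
    qed (use sub w d n in auto)
    then show False using edge[of w] by (auto simp: complete_on_def)
  qed
  have fXZ: "finite (X \<union> Z)" using fin by simp
  have le: "card (X \<union> Z) \<le> k"
  proof (cases "Y \<inter> (X \<union> Z) = {}")
    case False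
    then have uY: "u \<in> Y" "u \<in> X \<or> u \<in> Z" using u by auto
    have "card (X \<union> Z - {u}) < k"
    proof (rule hub)
      show "\<not> R u v" if "v \<in> X \<union> Z" "v \<noteq> u" for v using XY[of v u] YZ[of u v] uY(1) that Bs by blast
      show "\<not> R u v" if "v \<in> Y" "v \<noteq> u" for v using XY[of u v] YZ[of v u] uY(2) that Bs by blast
    qed (use uY sub u in auto)
    then show ?thesis using uY fXZ by (simp add: card_Diff_singleton_if split: if_splits)
  next
    case True
    show ?thesis
    proof (cases "X \<inter> Z = {}")
      case X0: True
      have False
        by (rule no_blue_tripartite[of X Y Z]) (use sub c True X0 XY YZ XZ in blast)+
      then show ?thesis by blast
    next
      case False
      then obtain w where w: "w \<in> X" "w \<in> Z" by blast
      have "card (X \<union> Z - {w}) < k"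
      proof (rule hub)
        show "\<not> R w v" if "v \<in> X \<union> Z" "v \<noteq> w" for v using XZ[of v w] XZ[of w v] w that Bs by blast
        show "\<not> R w v" if "v \<in> Y" "v \<noteq> w" for v using XY[of w v] w that by blast
      qed (use w sub True in auto)
      then show ?thesis using w fXZ by (simp add: card_Diff_singleton_if)
    qed
  qed
  have "card (X \<union> Z) = card X" "card (X \<union> Z) = card Z" "card X = k"
    using le c card_mono[OF fXZ, of X] card_mono[OF fXZ, of Z] by auto
  then show ?thesis using card_subset_eq[OF fXZ, of X] card_subset_eq[OF fXZ, of Z] by auto
qed


section \<open>Extending odd red cycles\<close>

text \<open>The failure of the growth step: an odd red cycle shorter than a rim that does not
  lengthen by two. The aim is to show that it cannot occur.\<close>

definition stuck :: "(nat \<Rightarrow> 'a) \<Rightarrow> nat \<Rightarrow> bool" where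
  "stuck x j \<longleftrightarrow> cyf R x j \<and> range x \<subseteq> A \<and> odd j \<and> j \<le> 2 * k - 3 \<and> \<not> has_cycle R A (j + 2)"

definition ext_nb :: "(nat \<Rightarrow> 'a) \<Rightarrow> nat \<Rightarrow> 'a set" where
  "ext_nb x i = {y \<in> A - range x. R (x i) y}"

definition int_deg :: "(nat \<Rightarrow> 'a) \<Rightarrow> nat \<Rightarrow> nat" where
  "int_deg x i = card {y \<in> range x. y \<noteq> x i \<and> R (x i) y}"

lemma stuckD:
  assumes "stuck x j"
  shows "cyf R x j" "range x \<subseteq> A" "odd j" "3 \<le> j" "j \<le> 2 * k - 3" "\<not> has_cycle R A (j + 2)"
  using assms by (auto simp: stuck_def cyf_def)

lemma stuck_shift: "stuck x j \<Longrightarrow> stuck (\<lambda>i. x (d + i)) j"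
  using cyf_shift[of R x j d] cyf_shift_range[of R x j d] by (simp add: stuck_def)

lemma ext_nb_shift: "stuck x j \<Longrightarrow> ext_nb (\<lambda>i. x (d + i)) i = ext_nb x (d + i)"
  using cyf_shift_range[OF stuckD(1), of x j d] by (simp add: ext_nb_def)

lemma finite_ext [simp]: "finite (ext_nb x i)"
  using finA by (auto simp: ext_nb_def)

lemma ext_sub: "ext_nb x i \<subseteq> A"
  by (auto simp: ext_nb_def)

lemma ext_card:
  assumes "stuck x j" shows "3 * k - 4 \<le> card (ext_nb x i) + int_deg x i" "int_deg x i \<le> j - 1"
proof -
  note s = stuckD[OF assms]
  have f: "finite (range x)" by (rule cyf_finite_range[OF s(1)])
  have "red_nb (x i) = ext_nb x i \<union> {y \<in> range x. y \<noteq> x i \<and> R (x i) y}"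
    using s(2) by (auto simp: red_nb_def ext_nb_def)
  then have "card (red_nb (x i)) \<le> card (ext_nb x i) + int_deg x i"
    unfolding int_deg_def by (metis card_Un_le)
  moreover have "x i \<in> A" using s(2) by auto
  ultimately show "3 * k - 4 \<le> card (ext_nb x i) + int_deg x i" using red_degree[of "x i"] by linarith
  have "int_deg x i \<le> card (range x - {x i})" unfolding int_deg_def using f by (intro card_mono) auto
  then show "int_deg x i \<le> j - 1" using cyf_card_range[OF s(1)] f by simp
qed

text \<open>At most \<open>j - 1 <= 2 * k - 4\<close> of the \<open>3 * k - 4\<close> guaranteed red
  neighbours lie on the cycle.\<close>

lemma ext_ge: "stuck x j \<Longrightarrow> k \<le> card (ext_nb x i)"
  using ext_card[of x j i] stuckD(5)[of x j] k4 by linarith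

text \<open>The value \<open>k - 1\<close> exceeds half of every admissible \<open>j\<close>, which
  is the hypothesis of \<open>ext_skip\<close>.\<close>

lemma int_degI: "stuck x j \<Longrightarrow> card (ext_nb x i) \<le> 2 * k - 3 \<Longrightarrow> k - 1 \<le> int_deg x i"
  using ext_card[of x j i] k4 by linarith

lemma ext_adj:
  assumes "stuck x j" "u \<in> ext_nb x i" "w \<in> ext_nb x (Suc i)" "u \<noteq> w" shows "\<not> R u w"
proof
  assume "R u w"
  have h: "u \<notin> range x" "w \<notin> range x" "R u (x i)" "R w (x (Suc i))" "u \<in> A" "w \<in> A"
    using assms Rs by (auto simp: ext_nb_def)
  have "has_cycle R (insert u (insert w (range x))) (j + 2)"
    by (rule ear2[OF sym stuckD(1)[OF assms(1)] h(1,2) assms(4) \<open>R u w\<close> h(3,4)])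
  then have "has_cycle R A (j + 2)" by (rule has_cycle_mono) (use h stuckD(2)[OF assms(1)] in auto)
  then show False using stuckD(6)[OF assms(1)] by simp
qed

text \<open>Distinct common neighbours over two different cycle edges could both be
  inserted.\<close>

lemma ext_two:
  assumes "stuck x j" "u \<in> ext_nb x i" "u \<in> ext_nb x (Suc i)" "w \<in> ext_nb x l" "w \<in> ext_nb x (Suc l)" "i < l" "l < i + j"
  shows "u = w"
proof (rule ccontr)
  assume ne: "u \<noteq> w"
  have h: "u \<notin> range x" "w \<notin> range x" "R u (x i)" "R u (x (Suc i))" "R w (x l)" "R w (x (Suc l))" "u \<in> A" "w \<in> A"
    using assms Rs by (auto simp: ext_nb_def)
  have "has_cycle R (insert u (insert w (range x))) (j + 2)"
    by (rule two_ears[OF sym stuckD(1)[OF assms(1)] h(1,2) ne assms(6,7) h(3-6)])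
  then have "has_cycle R A (j + 2)" by (rule has_cycle_mono) (use h stuckD(2)[OF assms(1)] in auto)
  then show False using stuckD(6)[OF assms(1)] by simp
qed

text \<open>A vertex with more than half of the cycle as neighbours can be inserted between two consecutive ones of
  them, which frees its own place on the cycle.\<close>
lemma ext_skip:
  assumes st: "stuck x j" and d: "k - 1 \<le> int_deg x (Suc i)"
    and uw: "u \<in> ext_nb x i" "w \<in> ext_nb x (i + 2)" "u \<noteq> w"
  shows "\<not> R u w"
proof
  assume Ruw: "R u w"
  note s = stuckD[OF st]
  define T where "T = {t. 1 \<le> t \<and> t < j \<and> R (x (Suc i)) (x (Suc i + t))}"
  have fT: "finite T" "T \<subseteq> {..<j}" by (auto simp: T_def intro: finite_subset[of _ "{..<j}"])
  have "{y \<in> range x. y \<noteq> x (Suc i) \<and> R (x (Suc i)) y} \<subseteq> (\<lambda>t. x (Suc i + t)) ` T"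
  proof
    fix y assume y: "y \<in> {y \<in> range x. y \<noteq> x (Suc i) \<and> R (x (Suc i)) y}"
    then have "y \<in> range (\<lambda>t. x (Suc i + t))" unfolding cyf_shift_range[OF s(1)] by simp
    then obtain t where "t < j" "y = x (Suc i + t)"
      using cyf_range[OF cyf_shift[OF s(1), of "Suc i"]] by auto
    moreover from this have "t \<noteq> 0" using y by (intro notI) simp
    ultimately show "y \<in> (\<lambda>t. x (Suc i + t)) ` T" using y by (auto simp: T_def)
  qed
  then have "int_deg x (Suc i) \<le> card T"
    unfolding int_deg_def by (meson card_image_le card_mono fT(1) finite_imageI order_trans)
  then have "j < 2 * card T" using d s(5) k4 by linarith
  then obtain t where t: "t \<in> T" "Suc t mod j \<in> T" using consecutive_in_cycle[OF fT(2)] by blast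
  have t2: "Suc t < j"
  proof (rule ccontr)
    assume "\<not> ?thesis"
    then have "Suc t = j" using t fT(2) by auto
    then show False using t(2) by (auto simp: T_def)
  qed
  define l where "l = Suc i + t"
  have l: "i + 2 \<le> l" "Suc l \<le> i + j" "R (x (Suc i)) (x l)" "R (x (Suc i)) (x (Suc l))"
    using t t2 by (auto simp: l_def T_def)
  have h: "u \<notin> range x" "w \<notin> range x" "R (x i) u" "R w (x (i + 2))" "u \<in> A" "w \<in> A"
    using uw Rs by (auto simp: ext_nb_def)
  have a1: "pth R (map x [i + 2..<Suc l]) (x (i + 2)) (x l)"
    using arc[OF s(1), of "i + 2" "Suc l"] l by simp
  have a2: "pth R (map x [Suc l..<Suc (i + j)]) (x (Suc l)) (x i)"
    using arc[OF s(1), of "Suc l" "Suc (i + j)"] l cyf_period[OF s(1)] by simp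
  have window: "x a \<noteq> x (Suc i)" if "i + 2 \<le> a" "a \<le> i + j" for a
    using inj_onD[OF cyf_inj_window[OF s(1), of "Suc i"], of a "Suc i"] that by auto
  have p1: "pth R (map x [i + 2..<Suc l] @ [x (Suc i)]) (x (i + 2)) (x (Suc i))"
    by (rule pth_snoc[OF a1 _ Rs[OF l(3)]]) (use window l in force)
  have dj: "set (map x [i + 2..<Suc l]) \<inter> set (map x [Suc l..<Suc (i + j)]) = {}"
    by (rule arcs_disjoint[OF s(1)]) (use l in auto)
  have xs: "x (Suc i) \<notin> set (map x [Suc l..<Suc (i + j)])"
  proof
    assume "x (Suc i) \<in> set (map x [Suc l..<Suc (i + j)])"
    then obtain a where "x (Suc i) = x a" "Suc l \<le> a" "a < Suc (i + j)" by auto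
    then show False using window[of a] l by simp
  qed
  have p2: "pth R ((map x [i + 2..<Suc l] @ [x (Suc i)]) @ map x [Suc l..<Suc (i + j)]) (x (i + 2)) (x i)"
    by (rule pth_append[OF p1 a2 _ l(4)]) (use dj xs in auto)
  have p3: "pth R (w # (map x [i + 2..<Suc l] @ [x (Suc i)]) @ map x [Suc l..<Suc (i + j)]) w (x i)"
    by (rule pth_Cons[OF p2 _ h(4)]) (use h(2) in auto)
  have p4: "pth R ((w # (map x [i + 2..<Suc l] @ [x (Suc i)]) @ map x [Suc l..<Suc (i + j)]) @ [u]) w u"
    by (rule pth_snoc[OF p3 _ h(3)]) (use h(1) uw(3) in auto)
  have "has_cycle R A (j + 2)"
    by (rule has_cycle_close[OF p4 Ruw]) (use h s(2) l in auto)
  then show False using s(6) by simp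
qed

text \<open>If both vertices had few chords, both outer neighbourhoods would have at least
  \<open>2 * k - 2\<close> vertices. The first is no red clique, as \<open>x i\<close> would enlarge
  it to \<open>2 * k - 1\<close>; by \<open>bip_wheel\<close> each vertex of the second then has few
  blue neighbours there, so the second is red enough for Dirac's theorem.\<close>

lemma ext_edge:
  assumes st: "stuck x j" and e: "ext_nb x i \<inter> ext_nb x (Suc i) = {}"
  shows "k - 1 \<le> int_deg x i \<or> k - 1 \<le> int_deg x (Suc i)"
proof (rule ccontr)
  assume n: "\<not> ?thesis"
  let ?U = "ext_nb x i" and ?V = "ext_nb x (Suc i)"
  have big: "2 * k - 2 \<le> card ?U" "2 * k - 2 \<le> card ?V"
    using n int_degI[OF st, of i] int_degI[OF st, of "Suc i"] k4 by linarith+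
  have B: "\<not> R u v" if "u \<in> ?U" "v \<in> ?V" for u v using ext_adj[OF st that] that e by blast
  have xA: "x t \<in> A" for t using stuckD(2)[OF st] by auto
  have "\<not> complete_on R ?U"
  proof
    assume "complete_on R ?U"
    moreover have "R (x i) y" "R y (x i)" if "y \<in> ?U" for y using that Rs[of "x i" y] by (auto simp: ext_nb_def)
    ultimately have "complete_on R (insert (x i) ?U)" by (simp add: complete_on_def)
    moreover have "x i \<notin> ?U" by (simp add: ext_nb_def)
    then have "card (insert (x i) ?U) = Suc (card ?U)" by simp
    ultimately show False
      using red_clique_card[of "insert (x i) ?U"] ext_sub[of x i] xA big(1) k4 by simp
  qed
  then have deg: "card {w \<in> ?V. w \<noteq> v \<and> \<not> R v w} \<le> k - 2" if v: "v \<in> ?V" for v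
  proof (rule contrapos_np)
    assume "\<not> card {w \<in> ?V. w \<noteq> v \<and> \<not> R v w} \<le> k - 2"
    then have c: "k - 1 \<le> card {w \<in> ?V. w \<noteq> v \<and> \<not> R v w}" by simp
    show "complete_on R ?U"
    proof (rule bip_wheel[of v ?U "{w \<in> ?V. w \<noteq> v \<and> \<not> R v w}"])
      show "\<not> R v p" if "p \<in> ?U" for p by (rule Bs[OF B[OF that v]])
      show "k \<le> card ?U" using big(1) k4 by simp
      show "{w \<in> ?V. w \<noteq> v \<and> \<not> R v w} \<subseteq> A" using ext_sub[of x "Suc i"] by auto
    qed (use v B e c ext_sub[of x i] ext_sub[of x "Suc i"] in auto)
  qed
  obtain V' where V': "V' \<subseteq> ?V" "card V' = 2 * k - 2" "finite V'" using big(2) by (rule obtain_subset_with_card_n)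
  define D where "D = insert (x (Suc i)) V'"
  have xn: "x (Suc i) \<notin> V'" using V'(1) by (auto simp: ext_nb_def)
  have cD: "card D = 2 * k - 1" using V' xn k4 by (simp add: D_def)
  have DA: "D \<subseteq> A" using V'(1) ext_sub xA by (auto simp: D_def)
  have Rx: "R (x (Suc i)) v" if "v \<in> V'" for v using that V'(1) by (auto simp: ext_nb_def)
  \<comment> \<open>Inside \<open>V'\<close> a vertex keeps at least
    \<open>(2 * k - 3) - (k - 2)\<close> red neighbours; with \<open>x (Suc i)\<close> these are
    \<open>k\<close>, more than half of \<open>2 * k - 1\<close>.\<close>
  have "has_cycle R D (card D)"
  proof (rule dirac[OF sym])
    show "finite D" "3 \<le> card D" using V' cD k4 by (auto simp: D_def)
    fix v assume v: "v \<in> D"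
    show "card D \<le> 2 * card {w \<in> D. w \<noteq> v \<and> R v w}"
    proof (cases "v = x (Suc i)")
      case True
      then have "{w \<in> D. w \<noteq> v \<and> R v w} = V'" using Rx xn by (auto simp: D_def)
      then show ?thesis using cD V' k4 by simp
    next
      case False
      then have vV: "v \<in> V'" using v by (simp add: D_def)
      have "V' - {v} - {w \<in> ?V. w \<noteq> v \<and> \<not> R v w} \<subseteq> {w \<in> V'. w \<noteq> v \<and> R v w}" using V'(1) by auto
      then have "card (V' - {v} - {w \<in> ?V. w \<noteq> v \<and> \<not> R v w}) \<le> card {w \<in> V'. w \<noteq> v \<and> R v w}"
        using V' by (intro card_mono) auto
      moreover have "card (V' - {v}) - card {w \<in> ?V. w \<noteq> v \<and> \<not> R v w} \<le> card (V' - {v} - {w \<in> ?V. w \<noteq> v \<and> \<not> R v w})"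
        by (rule diff_card_le_card_Diff) simp
      moreover have "card (V' - {v}) = 2 * k - 3" using vV V' by simp
      ultimately have c: "k - 1 \<le> card {w \<in> V'. w \<noteq> v \<and> R v w}" using deg[of v] vV V'(1) k4 by fastforce
      have "{w \<in> D. w \<noteq> v \<and> R v w} = insert (x (Suc i)) {w \<in> V'. w \<noteq> v \<and> R v w}"
        using Rs[OF Rx[OF vV]] False by (auto simp: D_def)
      then have "card {w \<in> D. w \<noteq> v \<and> R v w} = Suc (card {w \<in> V'. w \<noteq> v \<and> R v w})"
        using xn V'(3) by simp
      then show ?thesis using c cD k4 by linarith
    qed
  qed
  then show False using redE[OF _ DA] cD by simp
qed

text \<open>\<open>blue_triple\<close> applies to three successive outer neighbourhoods:
  neighbouring ones are blue to each other by \<open>ext_adj\<close>, the outer two by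
  \<open>ext_skip\<close>.\<close>

lemma ext_corner:
  assumes st: "stuck x j" and d: "k - 1 \<le> int_deg x (Suc i)"
    and u: "ext_nb x (Suc i) \<inter> (ext_nb x i \<union> ext_nb x (i + 2)) \<subseteq> {u}"
  shows "ext_nb x i = ext_nb x (i + 2)" "card (ext_nb x i) = k"
proof -
  have "ext_nb x i = ext_nb x (i + 2) \<and> card (ext_nb x i) = k"
    by (rule blue_triple[OF ext_sub ext_sub ext_sub ext_ge[OF st] ext_ge[OF st] ext_ge[OF st] _ _ _ u])
      (use ext_adj[OF st] ext_skip[OF st d] in auto)
  then show "ext_nb x i = ext_nb x (i + 2)" "card (ext_nb x i) = k" by auto
qed

lemma ext_nb_period: "stuck x j \<Longrightarrow> ext_nb x (i + j) = ext_nb x i"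
  using cyf_period[OF stuckD(1), of x j i] by (simp add: ext_nb_def)

text \<open>A corner gives an outer neighbourhood of size \<open>k\<close>, hence many chords at
  that cycle vertex, hence the next corner. Two successive corners produce two disjoint sets of size
  \<open>k\<close> that are blue inside and between, and these contain a blue wheel.\<close>

lemma not_stuck_path:
  assumes st: "stuck x j" and e: "\<And>i. Suc i < j \<Longrightarrow> ext_nb x i \<inter> ext_nb x (Suc i) = {}"
  shows False
proof -
  note s = stuckD[OF st]
  have "k - 1 \<le> int_deg x (Suc 0) \<or> k - 1 \<le> int_deg x (Suc (Suc 0))"
    by (rule ext_edge[OF st e]) (use s(4) in simp)
  then obtain i where i: "i \<le> 1" "k - 1 \<le> int_deg x (Suc i)" by (metis One_nat_def le_refl zero_le)
  have "j \<noteq> 4" using s(3) by auto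
  \<comment> \<open>A vertex with \<open>k - 1\<close> chords forces \<open>j >= k >= 4\<close>, and
    \<open>j\<close> is odd. Hence \<open>i + 3 <= 4 < j\<close>, so both corners avoid the closing
    edge.\<close>
  then have j: "5 \<le> j" using i(2) ext_card(2)[OF st, of "Suc i"] k4 by linarith
  have e0: "ext_nb x i \<inter> ext_nb x (Suc i) = {}" by (rule e) (use i j in simp)
  have e1: "ext_nb x (Suc i) \<inter> ext_nb x (i + 2) = {}" using e[of "Suc i"] i j by simp
  have e2: "ext_nb x (i + 2) \<inter> ext_nb x (Suc (i + 2)) = {}" by (rule e) (use i j in simp)
  \<comment> \<open>The intersection is empty here, so any value serves as the exceptional
    vertex.\<close>
  have c: "ext_nb x i = ext_nb x (i + 2)" "card (ext_nb x i) = k"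
    by (rule ext_corner[OF st i(2), of undefined]; use e0 e1 in blast)+
  have d: "k - 1 \<le> int_deg x (Suc (Suc i))"
    using int_degI[OF st, of "i + 2"] c k4 by simp
  have c': "ext_nb x (Suc i) = ext_nb x (Suc i + 2)" "card (ext_nb x (Suc i)) = k"
    by (rule ext_corner[OF st d, of undefined]; use e1 e2 in auto)+
  have "ext_nb x i \<noteq> {}" using c(2) k4 by auto
  then obtain h where h: "h \<in> ext_nb x i" by blast
  have b1: "\<not> R u v" if "u \<in> ext_nb x i" "v \<in> ext_nb x i" "u \<noteq> v" for u v
    using ext_skip[OF st i(2), of u v] that c(1) by auto
  have b2: "\<not> R u v" if "u \<in> ext_nb x (Suc i)" "v \<in> ext_nb x (Suc i)" "u \<noteq> v" for u v
    using ext_skip[OF st d, of u v] that c'(1) by auto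
  have b3: "\<not> R u v" if "u \<in> ext_nb x i" "v \<in> ext_nb x (Suc i)" for u v
    using ext_adj[OF st that] that e0 by blast
  have "complete_on R (ext_nb x (Suc i))"
  proof (rule bip_wheel[of h _ "ext_nb x i - {h}"])
    show "\<not> R p q" if "p \<in> ext_nb x (Suc i)" "q \<in> ext_nb x i - {h}" for p q by (rule Bs[OF b3]) (use that in auto)
    show "\<not> R h q" if "q \<in> ext_nb x i - {h}" for q using b1[OF h] that by auto
    show "\<not> R h p" if "p \<in> ext_nb x (Suc i)" for p by (rule b3[OF h that])
  qed (use h e0 c c' ext_sub[of x i] ext_sub[of x "Suc i"] in auto)
  moreover have "ext_nb x (Suc i) \<noteq> {}" using c'(2) k4 by auto
  then obtain a where a: "a \<in> ext_nb x (Suc i)" by blast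
  obtain b where "b \<in> ext_nb x (Suc i)" "b \<noteq> a" using pick_other[of "ext_nb x (Suc i)" a] c'(2) k4 by auto
  ultimately show False using a b2 by (auto simp: complete_on_def)
qed

text \<open>Odd length is used here: going around the cycle in steps of two reaches every outer neighbourhood.\<close>
lemma not_stuck_common:
  assumes st: "stuck x j" and u: "\<And>i. i < j \<Longrightarrow> ext_nb x i \<inter> ext_nb x (Suc i) \<subseteq> {u}"
  shows False
proof -
  note s = stuckD[OF st]
  have per: "ext_nb x (i + j) = ext_nb x i" for i by (rule ext_nb_period[OF st])
  have u: "ext_nb x i \<inter> ext_nb x (Suc i) \<subseteq> {u}" for i
  proof -
    have "ext_nb x (a + j * t) = ext_nb x a" for a t
      by (induction t) (use per in \<open>auto simp: add.assoc[symmetric] add.commute[of j]\<close>)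
    from this[of "i mod j" "i div j"] this[of "Suc (i mod j)" "i div j"]
    have "ext_nb x i = ext_nb x (i mod j)" "ext_nb x (Suc i) = ext_nb x (Suc (i mod j))" by simp_all
    then show ?thesis using u[of "i mod j"] s(4) by simp
  qed
  obtain t where t: "j = 2 * t + 1" using s(3) by (rule oddE)
  have ex: "\<exists>i. k - 1 \<le> int_deg x i"
  proof (rule ccontr)
    assume n: "\<nexists>i. k - 1 \<le> int_deg x i"
    then have ne: "ext_nb x i \<inter> ext_nb x (Suc i) \<noteq> {}" for i using ext_edge[OF st, of i] by blast
    have uU: "u \<in> ext_nb x i" for i using ne[of i] u[of i] by blast
    define V where "V i = ext_nb x i - {u}" for i
    define W where "W = (\<Union>i. V i)"
    have cV: "2 * k - 3 \<le> card (V i)" for i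
    proof -
      have "\<not> card (ext_nb x i) \<le> 2 * k - 3" using int_degI[OF st, of i] n by blast
      then show ?thesis using uU[of i] by (simp add: V_def)
    qed
    have "W \<subseteq> blue_nb u"
    proof
      fix w assume "w \<in> W"
      then obtain i where "w \<in> ext_nb x i" "w \<noteq> u" by (auto simp: W_def V_def)
      then show "w \<in> blue_nb u"
        using Bs[OF ext_adj[OF st _ uU]] ext_sub[of x i] by (auto simp: blue_nb_def)
    qed
    moreover have fb: "finite (blue_nb u)" using finA by (simp add: blue_nb_def)
    ultimately have W: "finite W" "card W \<le> card (blue_nb u)" by (auto intro: finite_subset card_mono)
    have cW: "card W \<le> 3 * k - 2" using W(2) blue_degree[of u] uU[of 0] ext_sub[of x 0] by fastforce
    have dV: "V i \<inter> V (Suc i) = {}" for i using u[of i] by (auto simp: V_def)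
    have VW: "V i \<union> V (Suc i) = W" for i
    proof (rule card_seteq[OF W(1)])
      show "V i \<union> V (Suc i) \<subseteq> W" by (auto simp: W_def)
      have "card (V i \<union> V (Suc i)) = card (V i) + card (V (Suc i))"
        by (rule card_Un_disjoint[OF _ _ dV]) (auto simp: V_def)
      \<comment> \<open>Two disjoint sets have at least \<open>2 * (2 * k - 3)\<close> elements,
        which is at least \<open>3 * k - 2\<close> because \<open>k >= 4\<close>; so they already
        fill \<open>W\<close>.\<close>
      then show "card W \<le> card (V i \<union> V (Suc i))" using cW cV[of i] cV[of "Suc i"] k4 by linarith
    qed
    have step: "V (Suc (Suc i)) = V i" for i
      using VW[of i] VW[of "Suc i"] dV[of i] dV[of "Suc i"] by blast
    have "V (2 * a) = V 0" for a by (induction a) (simp_all add: step)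
    from this[of t] have "V (2 * t) = V 0" .
    moreover have "V (Suc (2 * t)) = V 0" using per[of 0] t by (simp add: V_def)
    ultimately have "V 0 = {}" using dV[of "2 * t"] by simp
    then show False using cV[of 0] k4 by simp
  qed
  then obtain i0 where i0: "k - 1 \<le> int_deg x i0" by blast
  have "int_deg x (i0 + j) = int_deg x i0" using cyf_period[OF s(1), of i0] by (simp add: int_deg_def)
  then obtain n0 where n0: "k - 1 \<le> int_deg x (Suc n0)" using i0 s(4) by (metis add_gr_0 gr0_conv_Suc not_numeral_le_zero neq0_conv)
  have corner: "ext_nb x n = ext_nb x (n + 2)" "card (ext_nb x n) = k" if "k - 1 \<le> int_deg x (Suc n)" for n
    by (rule ext_corner[OF st that, of u]; use u[of n] u[of "Suc n"] in auto)+
  \<comment> \<open>A corner makes the outer neighbourhood two places further on have size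
    \<open>k\<close>, so the vertex there has enough chords to be the middle of the next
    corner.\<close>
  have all: "k - 1 \<le> int_deg x (Suc (n0 + a))" for a
  proof (induction a)
    case 0 then show ?case using n0 by simp
  next
    case (Suc a)
    then show ?case using int_degI[OF st, of "n0 + a + 2"] corner[of "n0 + a"] k4 by simp
  qed
  have two: "ext_nb x (n0 + b + 2 * a) = ext_nb x (n0 + b)" for a b
  proof (induction a)
    case (Suc a)
    then show ?case using corner(1)[OF all[of "b + 2 * a"]] by (simp add: add.assoc)
  qed simp
  have "ext_nb x (n0 + 1 + 2 * t) = ext_nb x n0" using per[of n0] t by (simp add: algebra_simps)
  then have "ext_nb x (Suc n0) = ext_nb x n0" using two[of 1 t] by simp
  then have "ext_nb x n0 \<subseteq> {u}" using u[of n0] by simp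
  then have "card (ext_nb x n0) \<le> 1" using card_mono[of "{u}"] by fastforce
  then show False using corner(2)[OF n0] k4 by simp
qed

text \<open>By \<open>ext_two\<close>, common outer neighbours over different cycle edges coincide.
  So either a single edge has any, and rotating it to the closing position leaves a path without
  them, or all of them are one vertex \<open>u\<close>.\<close>

lemma not_stuck: "\<not> stuck x j"
proof
  assume st: "stuck x j"
  show False
  proof (cases "\<forall>i. ext_nb x i \<inter> ext_nb x (Suc i) = {}")
    case True
    then show False using not_stuck_common[OF st, of undefined] by blast
  next
    case False
    then obtain i0 u where u: "u \<in> ext_nb x i0" "u \<in> ext_nb x (Suc i0)" by blast
    \<comment> \<open>The rotation moves the edge between \<open>x i0\<close> and
      \<open>x (Suc i0)\<close> to the closing position \<open>j - 1\<close>.\<close>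
    define y where "y i = x (Suc i0 + i)" for i
    have sy: "stuck y j" using stuck_shift[OF st, of "Suc i0"] by (simp add: y_def[abs_def])
    note s = stuckD[OF sy]
    have ey: "ext_nb y i = ext_nb x (Suc i0 + i)" for i
      using ext_nb_shift[OF st, of "Suc i0" i] by (simp add: y_def[abs_def])
    have "Suc i0 + (j - 1) = i0 + j" "Suc i0 + Suc (j - 1) = Suc i0 + j" using s(4) by simp_all
    then have uy: "u \<in> ext_nb y (j - 1)" "u \<in> ext_nb y (Suc (j - 1))"
      unfolding ey using u ext_nb_period[OF st, of i0] ext_nb_period[OF st, of "Suc i0"] by metis+
    have eq: "w = v" if "w \<in> ext_nb y m" "w \<in> ext_nb y (Suc m)" "m < j - 1" "v \<in> ext_nb y (j - 1)" "v \<in> ext_nb y (Suc (j - 1))" for w v m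
      by (rule ext_two[OF sy that(1,2,4,5,3)]) (use s(4) in simp)
    show False
    proof (cases "\<forall>m<j - 1. ext_nb y m \<inter> ext_nb y (Suc m) = {}")
      case True
      then show False by (intro not_stuck_path[OF sy]) auto
    next
      case False
      then obtain m w where m: "m < j - 1" "w \<in> ext_nb y m" "w \<in> ext_nb y (Suc m)" by blast
      have "w = u" by (rule eq[OF m(2,3,1) uy])
      have "ext_nb y i \<inter> ext_nb y (Suc i) \<subseteq> {u}" if "i < j" for i
      proof (cases "i = j - 1")
        case True
        then show ?thesis using eq[OF m(2,3,1)] \<open>w = u\<close> by auto
      next
        case False
        then have "i < j - 1" using that by simp
        then show ?thesis using eq[OF _ _ _ uy] by blast
      qed
      then show False by (rule not_stuck_common[OF sy])
    qed
  qed
qed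

lemma no_wheel_impossible: False
proof -
  have tri: "has_cycle R A 3"
  proof (rule ccontr)
    assume n: "\<not> has_cycle R A 3"
    have "A \<noteq> {}" using cardA k4 by auto
    then obtain v where v: "v \<in> A" by blast
    have fr: "finite (red_nb v)" using finA by (simp add: red_nb_def)
    \<comment> \<open>Without a red triangle the red neighbourhood of \<open>v\<close> is a blue
      clique; with \<open>2 * k\<close> vertices it contains a hub and a rim.\<close>
    have "2 * k \<le> card (red_nb v)" using red_degree[OF v] k4 by simp
    moreover have b: "\<not> R a b" if "a \<in> red_nb v" "b \<in> red_nb v" "a \<noteq> b" for a b
    proof
      assume "R a b"
      then have "pth R [v, a, b] v b" using that by (auto simp: pth_def red_nb_def)
      moreover have "R b v" using that Rs by (auto simp: red_nb_def)
      ultimately have "has_cycle R A 3"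
        by (rule has_cycle_close) (use that v in \<open>auto simp: red_nb_def\<close>)
      then show False using n by simp
    qed
    ultimately have "red_nb v \<noteq> {}" using k4 by auto
    then obtain h where h: "h \<in> red_nb v" by blast
    have "complete_on B (red_nb v - {h})" using b by (auto simp: complete_on_def)
    moreover have "2 * k - 1 \<le> card (red_nb v - {h})" using \<open>2 * k \<le> card (red_nb v)\<close> h fr by simp
    ultimately have cy: "has_cycle B (red_nb v - {h}) (2 * k - 1)"
      using k4 fr by (intro clique_cycle symB) auto
    show False
    proof (rule wheelE[OF _ cy])
      show "h \<in> A" "red_nb v - {h} \<subseteq> A" using h by (simp_all add: red_nb_def subset_iff)
      show "\<not> R h y" if "y \<in> red_nb v - {h}" for y by (rule b[OF h]) (use that in auto)
    qed simp
  qed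
  have "has_cycle R A (2 * a + 3)" if "a \<le> k - 2" for a
    using that
  proof (induction a)
    case 0 then show ?case using tri by simp
  next
    case (Suc a)
    then obtain x where x: "cyf R x (2 * a + 3)" "range x \<subseteq> A" using has_cycle_cyf by (metis Suc_leD)
    have "\<not> stuck x (2 * a + 3)" by (rule not_stuck)
    then show ?case using x Suc.prems by (auto simp: stuck_def)
  qed
  from this[of "k - 2"] have "has_cycle R A (2 * (k - 2) + 3)" by simp
  moreover have "2 * (k - 2) + 3 = 2 * k - 1" using k4 by simp
  ultimately show False using no_red by metis
qed

end

section \<open>The Ramsey number\<close>

text \<open>The relation \<open>Q\<close> is separate from the colouring so that the lemma serves
  both \<open>R\<close> and its negation. The periodic form of the rim absorbs the reduction modulo
  \<open>m\<close> in \<open>cycle_graph\<close>.\<close>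

lemma contains_wheel:
  assumes m: "3 \<le> m" and cy: "has_cycle Q Y m" and Y: "Y \<subseteq> {..<N}" and h: "h < N" "h \<notin> Y"
    and hub: "\<And>y. y \<in> Y \<Longrightarrow> c {h, y} = col"
    and rim: "\<And>y z. y \<in> Y \<Longrightarrow> z \<in> Y \<Longrightarrow> y \<noteq> z \<Longrightarrow> Q y z \<Longrightarrow> c {y, z} = col"
  shows "contains_copy (colour_class N c col) (wheel (Suc m))"
proof -
  obtain x where x: "cyf Q x m" "range x \<subseteq> Y" using has_cycle_cyf[OF cy] by blast
  define \<phi> where "\<phi> i = (if i = m then h else x i)" for i
  have xY: "x i \<in> Y" for i using x(2) by auto
  have edge: "{a, b} \<in> edges (colour_class N c col)" if "a < N" "b < N" "a \<noteq> b" "c {a, b} = col" for a b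
    using that by (auto simp: colour_class_def nsets_def)
  have inj: "inj_on x {..<m}" using x(1) by (simp add: cyf_def)
  have "inj_on \<phi> (verts (wheel (Suc m)))"
    using inj xY h(2) by (auto simp: wheel_def cycle_graph_def \<phi>_def inj_on_def)
  moreover have "\<phi> ` verts (wheel (Suc m)) \<subseteq> verts (colour_class N c col)"
    using xY Y h(1) by (auto simp: wheel_def cycle_graph_def colour_class_def \<phi>_def)
  moreover have "\<phi> ` e \<in> edges (colour_class N c col)" if e: "e \<in> edges (wheel (Suc m))" for e
  proof -
    consider (rim) i where "i < m" "e = {i, Suc i mod m}" | (hub) v where "v < m" "e = {m, v}"
      using e by (auto simp: wheel_def cycle_graph_def)
    then show ?thesis
    proof cases
      case rim
      have "Suc i mod m \<noteq> m" using m mod_less_divisor[of m "Suc i"] by linarith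
      then have "\<phi> ` e = {x i, x (Suc i)}" using rim cyf_mod[OF x(1), of "Suc i"] by (simp add: \<phi>_def)
      moreover have "x i \<noteq> x (Suc i)"
      proof -
        have "i \<noteq> Suc i mod m" using m rim(1) by (cases "Suc i = m") auto
        then show ?thesis using cyf_eq_iff[OF x(1), of i "Suc i"] rim(1) by simp
      qed
      moreover have "Q (x i) (x (Suc i))" using x(1) by (simp add: cyf_def)
      ultimately show ?thesis using edge[of "x i" "x (Suc i)"] assms(7)[OF xY xY] xY Y
        by (metis lessThan_iff subsetD)
    next
      case hub
      then have "\<phi> ` e = {h, x v}" by (auto simp: \<phi>_def)
      moreover have "h \<noteq> x v" "x v < N" using xY[of v] h(2) Y by auto
      ultimately show ?thesis using edge[of h "x v"] assms(6)[OF xY] h(1) by simp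
    qed
  qed
  ultimately show ?thesis unfolding contains_copy_def by (intro exI[of _ \<phi>]) simp
qed

text \<open>The colour \<open>col\<close> plays the part of red in the locale; keeping it variable
  covers both outcomes of the pigeonhole step.\<close>

lemma wheel_in_neighbourhood:
  assumes k: "4 \<le> k" and v: "v < N" and card: "6 * k - 5 \<le> card {y. y < N \<and> y \<noteq> v \<and> c {v, y} = col}"
    and col: "\<And>e. c e \<noteq> col \<Longrightarrow> c e = col'"
  shows "contains_copy (colour_class N c col) (wheel (2 * k)) \<or> contains_copy (colour_class N c col') (wheel (2 * k))"
proof (rule ccontr)
  assume n: "\<not> ?thesis"
  obtain A where A: "A \<subseteq> {y. y < N \<and> y \<noteq> v \<and> c {v, y} = col}" "card A = 6 * k - 5" "finite A"
    using card by (rule obtain_subset_with_card_n)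
  define R where "R x y \<longleftrightarrow> c {x, y} = col" for x y
  have s: "Suc (2 * k - 1) = 2 * k" "3 \<le> 2 * k - 1" using k by simp_all
  interpret no_wheel R A k
  proof
    show "symp R" by (auto simp: symp_def R_def insert_commute)
    show "\<not> has_cycle R A (2 * k - 1)"
    proof
      assume "has_cycle R A (2 * k - 1)"
      then have "contains_copy (colour_class N c col) (wheel (Suc (2 * k - 1)))"
        by (rule contains_wheel[OF s(2), where h = v]) (use A v in \<open>auto simp: R_def\<close>)
      then show False using n s(1) by simp
    qed
    fix h assume h: "h \<in> A"
    show "\<not> has_cycle (\<lambda>x y. \<not> R x y) {y \<in> A. y \<noteq> h \<and> \<not> R h y} (2 * k - 1)"
    proof
      assume "has_cycle (\<lambda>x y. \<not> R x y) {y \<in> A. y \<noteq> h \<and> \<not> R h y} (2 * k - 1)"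
      then have "contains_copy (colour_class N c col') (wheel (Suc (2 * k - 1)))"
        by (rule contains_wheel[OF s(2), where h = h]) (use A h col in \<open>auto simp: R_def\<close>)
      then show False using n s(1) by simp
    qed
  qed (use A k in auto)
  show False by (rule no_wheel_impossible)
qed

theorem theorem8:
  fixes n :: nat
  assumes "even n" and "n \<ge> 8"
  shows "ramsey_number (wheel n) (wheel n) \<le> 6 * n - 10"
proof -
  obtain k where k: "n = 2 * k" "4 \<le> k" using assms by (auto elim: evenE)
  define N where "N = 12 * k - 10"
  have "ramsey_arrows N (wheel n) (wheel n)"
    unfolding ramsey_arrows_def
  proof
    fix c :: "nat set \<Rightarrow> colour"
    define S where "S col = {y. y < N \<and> y \<noteq> 0 \<and> c {0, y} = col}" for col
    have "S Red \<union> S Blue = {..<N} - {0}" using colour.exhaust by (auto simp: S_def)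
    then have "card (S Red) + card (S Blue) \<ge> N - 1"
      using card_Un_le[of "S Red" "S Blue"] k by (simp add: N_def)
    \<comment> \<open>Vertex \<open>0\<close> has \<open>12 * k - 11 = 2 * (6 * k - 6) + 1\<close>
      neighbours.\<close>
    then consider (red) "6 * k - 5 \<le> card (S Red)" | (blue) "6 * k - 5 \<le> card (S Blue)"
      using k unfolding N_def by linarith
    then show "contains_copy (colour_class N c Red) (wheel n) \<or> contains_copy (colour_class N c Blue) (wheel n)"
    proof cases
      case red
      show ?thesis unfolding k(1)
        by (rule wheel_in_neighbourhood[OF k(2) _ red[unfolded S_def]]) (use k colour.exhaust in \<open>auto simp: N_def\<close>)
    next
      case blue
      show ?thesis unfolding k(1) disj_commute[of "contains_copy (colour_class N c Red) _"]
        by (rule wheel_in_neighbourhood[OF k(2) _ blue[unfolded S_def]]) (use k colour.exhaust in \<open>auto simp: N_def\<close>)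
    qed
  qed
  moreover have "N > 0" "N = 6 * n - 10" using k by (simp_all add: N_def)
  ultimately show ?thesis unfolding ramsey_number_def by (intro Least_le) simp
qed

end
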